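(* Let $\mathfrak g$ be a simple Lie algebra over $\mathbb C$ with corresponding group $G$. For any dominant integral weight $\lambda$, the structure of $\mathfrak g$-module on $V_\lambda$ induces structures of a $\mathfrak g^a$-module and of a $G^a$-module on $V^a_\lambda$. (Here an element $f_\alpha\in(\mathfrak n^-)^a$ acts by the maps $F_s/F_{s-1}\to F_{s+1}/F_s$ induced by $f_\alpha: F_s\to F_{s+1}$, an element $x\in\mathfrak b$ acts by the maps $F_s/F_{s-1}\to F_s/F_{s-1}$ induced by $x:F_s\to F_s$, and $G^a$ acts by exponentials of the operators from $\mathfrak g^a$.)
   Context: $\mathfrak g=\mathfrak n\oplus\mathfrak h\oplus\mathfrak n^-$ is a Cartan decomposition, $\mathfrak b=\mathfrak n\oplus\mathfrak h$, with Chevalley basis elements $e_\alpha\in\mathfrak n$, $f_\alpha\in\mathfrak n^-$ ($\alpha$ a positive root) of weights $\alpha$, $-\alpha$. $G$ is a simple Lie group with Lie algebra $\mathfrak g$ acting on all $V_\lambda$ (e.g. simply connected), $B\subset G$ is the Borel subgroup with Lie algebra $\mathfrak b$, and $M=\dim\mathfrak n$. $V_\lambda$ is the irreducible highest weight module with highest weight vector $v_\lambda$. PBW filtration: $F_s=\mathrm{span}\{x_1\cdots x_kv_\lambda:k\le s,\ x_i\in\mathfrak n^-\}$, $F_{-1}=0$; $V^a_\lambda=\bigoplus_{s\ge0}F_s/F_{s-1}$. The Lie algebra $\mathfrak g^a$ equals $\mathfrak g$ as a vector space, with bracket: $[h,f_\alpha]^a=-\alpha(h)f_\alpha$, $[h,e_\alpha]^a=\alpha(h)e_\alpha$,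 $[h,h_1]^a=0$ for $h,h_1\in\mathfrak h$; $[f_\alpha,f_\beta]^a=0$; $[e_\alpha,e_\beta]^a=[e_\alpha,e_\beta]$; $[e_\alpha,f_\beta]^a=[e_\alpha,f_\beta]$ if $\beta-\alpha$ is a positive root and $0$ otherwise. Thus $\mathfrak g^a$ is the semidirect sum of $\mathfrak b$ and the abelian ideal $(\mathfrak n^-)^a\simeq\mathfrak g/\mathfrak b$ (as a $\mathfrak b$-module). The group $G^a=\mathbb G_a^M\rtimes B$ is the semidirect product of the normal subgroup $\mathbb G_a^M$ (the vector group of the abelian Lie algebra $(\mathfrak n^-)^a$) and $B$, where $B$ acts on $(\mathfrak n^-)^a\simeq\mathfrak g/\mathfrak b$ via the adjoint action. *)

theory Defs
  imports
    "HOL-Analysis.Analysis"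
    "HOL-Library.Function_Algebras"
    "HOL-Algebra.Module"
    "HOL-Algebra.Coset"
begin

section \<open>Complex vector spaces\<close>

class complex_vector = ab_group_add +
  fixes scaleC :: "complex \<Rightarrow> 'a \<Rightarrow> 'a" (infixr "*\<^sub>C" 75)
  assumes scaleC_add_right: "c *\<^sub>C (x + y) = c *\<^sub>C x + c *\<^sub>C y"
    and scaleC_add_left: "(c + d) *\<^sub>C x = c *\<^sub>C x + d *\<^sub>C x"
    and scaleC_scaleC: "c *\<^sub>C (d *\<^sub>C x) = (c * d) *\<^sub>C x"
    and scaleC_one: "1 *\<^sub>C x = x"

interpretation cv: vector_space "scaleC :: complex \<Rightarrow> 'a \<Rightarrow> 'a::complex_vector"
  by unfold_locales (simp_all add: scaleC_add_right scaleC_add_left scaleC_scaleC scaleC_one)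

instantiation complex :: complex_vector
begin
definition scaleC_complex :: "complex \<Rightarrow> complex \<Rightarrow> complex" where
  "scaleC_complex c x = c * x"
instance by standard (simp_all add: scaleC_complex_def algebra_simps)
end

instantiation vec :: (complex_vector, finite) complex_vector
begin
definition scaleC_vec :: "complex \<Rightarrow> 'a ^ 'b \<Rightarrow> 'a ^ 'b" where
  "scaleC_vec c x = (\<chi> i. c *\<^sub>C (x $ i))"
instance
  by standard (simp_all add: scaleC_vec_def vec_eq_iff scaleC_add_right scaleC_add_left
      scaleC_scaleC scaleC_one)
end

instantiation prod :: (complex_vector, complex_vector) complex_vector
begin
definition scaleC_prod :: "complex \<Rightarrow> 'a \<times> 'b \<Rightarrow> 'a \<times> 'b" where
  "scaleC_prod c x = (c *\<^sub>C fst x, c *\<^sub>C snd x)"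
instance
  by standard (simp_all add: scaleC_prod_def scaleC_add_right scaleC_add_left
      scaleC_scaleC scaleC_one)
end

definition fin_dim :: "'v::complex_vector itself \<Rightarrow> bool" where
  "fin_dim _ \<longleftrightarrow> (\<exists>S::'v set. finite S \<and> cv.span S = UNIV)"

text \<open>A graded quotient is not a type, so modules for Lie algebras and for groups are
  carried by records of \<^locale>\<open>Module.module\<close> over the ring \<open>complex_ring\<close>; a complex vector
  space given by a type enters as \<open>whole\<close>.  The components \<open>mult\<close> and \<open>one\<close> of a module
  record carry no meaning.\<close>

definition complex_ring :: "complex ring" where
  "complex_ring = \<lparr>carrier = UNIV, mult = (*), one = 1, zero = 0, add = (+)\<rparr>"

definition whole :: "(complex, 'v::complex_vector) module" where
  "whole = \<lparr>carrier = UNIV, mult = undefined, one = undefined, zero = 0, add = (+),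
            smult = scaleC\<rparr>"

definition linear_endo :: "(complex, 'w) module \<Rightarrow> ('w \<Rightarrow> 'w) \<Rightarrow> bool" where
  "linear_endo M T \<longleftrightarrow> T \<in> carrier M \<rightarrow> carrier M
     \<and> (\<forall>x\<in>carrier M. \<forall>y\<in>carrier M. T (x \<oplus>\<^bsub>M\<^esub> y) = T x \<oplus>\<^bsub>M\<^esub> T y)
     \<and> (\<forall>c. \<forall>x\<in>carrier M. T (c \<odot>\<^bsub>M\<^esub> x) = c \<odot>\<^bsub>M\<^esub> T x)"

definition functional :: "(complex, 'w) module \<Rightarrow> ('w \<Rightarrow> complex) \<Rightarrow> bool" where
  "functional M \<psi> \<longleftrightarrow>
     (\<forall>x\<in>carrier M. \<forall>y\<in>carrier M. \<psi> (x \<oplus>\<^bsub>M\<^esub> y) = \<psi> x + \<psi> y)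
     \<and> (\<forall>c. \<forall>x\<in>carrier M. \<psi> (c \<odot>\<^bsub>M\<^esub> x) = c * \<psi> x)"

text \<open>\<open>E = exp T\<close> as operators on \<open>M\<close>.  The canonical topology of a finite-dimensional
  complex vector space is the one given by all its linear functionals, so the power series of
  \<open>exp T\<close> is required to converge pointwise after applying any functional.\<close>

definition is_exp :: "(complex, 'w) module \<Rightarrow> ('w \<Rightarrow> 'w) \<Rightarrow> ('w \<Rightarrow> 'w) \<Rightarrow> bool" where
  "is_exp M T E \<longleftrightarrow> (\<forall>w\<in>carrier M. E w \<in> carrier M
     \<and> (\<forall>\<psi>. functional M \<psi> \<longrightarrow> (\<lambda>k. \<psi> ((T ^^ k) w) / fact k) sums \<psi> (E w)))"


section \<open>Lie algebras\<close>

definition bilinear_alt :: "('g::complex_vector \<Rightarrow> 'g \<Rightarrow> 'g) \<Rightarrow> bool" where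
  "bilinear_alt br \<longleftrightarrow>
     (\<forall>x. Vector_Spaces.linear scaleC scaleC (br x))
     \<and> (\<forall>y. Vector_Spaces.linear scaleC scaleC (\<lambda>x. br x y))
     \<and> (\<forall>x. br x x = 0)"

definition lie_algebra :: "('g::complex_vector \<Rightarrow> 'g \<Rightarrow> 'g) \<Rightarrow> bool" where
  "lie_algebra br \<longleftrightarrow> bilinear_alt br
     \<and> (\<forall>x y z. br x (br y z) + br y (br z x) + br z (br x y) = 0)"

definition lie_ideal :: "('g::complex_vector \<Rightarrow> 'g \<Rightarrow> 'g) \<Rightarrow> 'g set \<Rightarrow> bool" where
  "lie_ideal br I \<longleftrightarrow> cv.subspace I \<and> (\<forall>x. \<forall>y\<in>I. br x y \<in> I)"

definition simple_lie_algebra :: "('g::complex_vector \<Rightarrow> 'g \<Rightarrow> 'g) \<Rightarrow> bool" where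
  "simple_lie_algebra br \<longleftrightarrow> lie_algebra br \<and> fin_dim TYPE('g)
     \<and> (\<exists>x y. br x y \<noteq> 0)
     \<and> (\<forall>I. lie_ideal br I \<longrightarrow> I = {0} \<or> I = UNIV)"

definition lie_subalgebra :: "('g::complex_vector \<Rightarrow> 'g \<Rightarrow> 'g) \<Rightarrow> 'g set \<Rightarrow> bool" where
  "lie_subalgebra br S \<longleftrightarrow> cv.subspace S \<and> (\<forall>x\<in>S. \<forall>y\<in>S. br x y \<in> S)"

fun lower_central :: "('g::complex_vector \<Rightarrow> 'g \<Rightarrow> 'g) \<Rightarrow> 'g set \<Rightarrow> nat \<Rightarrow> 'g set" where
  "lower_central br S 0 = S"
| "lower_central br S (Suc k) = cv.span {br x y | x y. x \<in> S \<and> y \<in> lower_central br S k}"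

definition cartan_subalgebra :: "('g::complex_vector \<Rightarrow> 'g \<Rightarrow> 'g) \<Rightarrow> 'g set \<Rightarrow> bool" where
  "cartan_subalgebra br h \<longleftrightarrow> lie_subalgebra br h
     \<and> (\<exists>k. lower_central br h k = {0})
     \<and> (\<forall>x. (\<forall>t\<in>h. br x t \<in> h) \<longrightarrow> x \<in> h)"

text \<open>Elements of the dual of \<open>h\<close> are represented by functions vanishing outside \<open>h\<close>, so that
  equality of functions is equality in the dual; they are not linear on the whole algebra.\<close>

definition dual_of :: "'g::complex_vector set \<Rightarrow> ('g \<Rightarrow> complex) set" where
  "dual_of h = {\<alpha>. (\<forall>x\<in>h. \<forall>y\<in>h. \<alpha> (x + y) = \<alpha> x + \<alpha> y)
     \<and> (\<forall>c. \<forall>x\<in>h. \<alpha> (c *\<^sub>C x) = c * \<alpha> x) \<and> (\<forall>x. x \<notin> h \<longrightarrow> \<alpha> x = 0)}"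

definition root_space ::
  "('g::complex_vector \<Rightarrow> 'g \<Rightarrow> 'g) \<Rightarrow> 'g set \<Rightarrow> ('g \<Rightarrow> complex) \<Rightarrow> 'g set" where
  "root_space br h \<alpha> = {x. \<forall>t\<in>h. br t x = \<alpha> t *\<^sub>C x}"

definition roots :: "('g::complex_vector \<Rightarrow> 'g \<Rightarrow> 'g) \<Rightarrow> 'g set \<Rightarrow> ('g \<Rightarrow> complex) set" where
  "roots br h = {\<alpha>\<in>dual_of h. \<alpha> \<noteq> 0 \<and> root_space br h \<alpha> \<noteq> {0}}"

text \<open>Positive roots are the roots on which a real linear functional on the real span of the
  roots, nonzero on every root, is positive.  The roots span a real form of the dual of \<open>h\<close>, so
  each such functional is \<open>\<alpha> \<mapsto> Re (\<alpha> \<xi>)\<close> for some \<open>\<xi>\<close> in \<open>h\<close>.\<close>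

definition positive_roots ::
  "('g::complex_vector \<Rightarrow> 'g \<Rightarrow> 'g) \<Rightarrow> 'g set \<Rightarrow> ('g \<Rightarrow> complex) set \<Rightarrow> bool" where
  "positive_roots br h P \<longleftrightarrow> (\<exists>\<xi>\<in>h. (\<forall>\<alpha>\<in>roots br h. Re (\<alpha> \<xi>) \<noteq> 0)
     \<and> P = {\<alpha>\<in>roots br h. Re (\<alpha> \<xi>) > 0})"

definition n_plus ::
  "('g::complex_vector \<Rightarrow> 'g \<Rightarrow> 'g) \<Rightarrow> 'g set \<Rightarrow> ('g \<Rightarrow> complex) set \<Rightarrow> 'g set" where
  "n_plus br h P = cv.span (\<Union>\<alpha>\<in>P. root_space br h \<alpha>)"

definition n_minus ::
  "('g::complex_vector \<Rightarrow> 'g \<Rightarrow> 'g) \<Rightarrow> 'g set \<Rightarrow> ('g \<Rightarrow> complex) set \<Rightarrow> 'g set" where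
  "n_minus br h P = cv.span (\<Union>\<alpha>\<in>P. root_space br h (- \<alpha>))"

definition borel_algebra ::
  "('g::complex_vector \<Rightarrow> 'g \<Rightarrow> 'g) \<Rightarrow> 'g set \<Rightarrow> ('g \<Rightarrow> complex) set \<Rightarrow> 'g set" where
  "borel_algebra br h P = {x + t | x t. x \<in> n_plus br h P \<and> t \<in> h}"

definition cartan_decomposition ::
  "('g::complex_vector \<Rightarrow> 'g \<Rightarrow> 'g) \<Rightarrow> 'g set \<Rightarrow> ('g \<Rightarrow> complex) set \<Rightarrow> bool" where
  "cartan_decomposition br h P \<longleftrightarrow> cartan_subalgebra br h \<and> positive_roots br h P
     \<and> (\<forall>z. \<exists>!(x, t, y). x \<in> n_plus br h P \<and> t \<in> h \<and> y \<in> n_minus br h P \<and> z = x + t + y)"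

definition root_vector ::
  "('g \<Rightarrow> complex) set \<Rightarrow> (('g \<Rightarrow> complex) \<Rightarrow> 'g) \<Rightarrow> (('g \<Rightarrow> complex) \<Rightarrow> 'g)
     \<Rightarrow> ('g \<Rightarrow> complex) \<Rightarrow> 'g::complex_vector" where
  "root_vector P e f \<alpha> = (if \<alpha> \<in> P then e \<alpha> else f (- \<alpha>))"

text \<open>The root vectors of a Chevalley basis, the remaining basis elements being the coroots
  \<open>[e \<alpha>, f \<alpha>]\<close> of the simple roots.  The last condition is the symmetry
  \<open>N(\<alpha>,\<beta>) = - N(-\<alpha>,-\<beta>)\<close> of the structure constants.\<close>

definition chevalley_vectors ::
  "('g::complex_vector \<Rightarrow> 'g \<Rightarrow> 'g) \<Rightarrow> 'g set \<Rightarrow> ('g \<Rightarrow> complex) set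
     \<Rightarrow> (('g \<Rightarrow> complex) \<Rightarrow> 'g) \<Rightarrow> (('g \<Rightarrow> complex) \<Rightarrow> 'g) \<Rightarrow> bool" where
  "chevalley_vectors br h P e f \<longleftrightarrow>
     (\<forall>\<alpha>\<in>P. root_space br h \<alpha> = cv.span {e \<alpha>} \<and> root_space br h (- \<alpha>) = cv.span {f \<alpha>}
        \<and> \<alpha> (br (e \<alpha>) (f \<alpha>)) = 2)
     \<and> (\<forall>\<alpha>\<in>roots br h. \<forall>\<beta>\<in>roots br h. \<alpha> + \<beta> \<in> roots br h \<longrightarrow>
          (let X = root_vector P e f in
           \<exists>N. br (X \<alpha>) (X \<beta>) = N *\<^sub>C X (\<alpha> + \<beta>)
             \<and> br (X (- \<alpha>)) (X (- \<beta>)) = (- N) *\<^sub>C X (- (\<alpha> + \<beta>))))"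

definition dominant_integral ::
  "('g::complex_vector \<Rightarrow> 'g \<Rightarrow> 'g) \<Rightarrow> 'g set \<Rightarrow> ('g \<Rightarrow> complex) set
     \<Rightarrow> (('g \<Rightarrow> complex) \<Rightarrow> 'g) \<Rightarrow> (('g \<Rightarrow> complex) \<Rightarrow> 'g) \<Rightarrow> ('g \<Rightarrow> complex) \<Rightarrow> bool" where
  "dominant_integral br h P e f lam \<longleftrightarrow> lam \<in> dual_of h
     \<and> (\<forall>\<alpha>\<in>P. lam (br (e \<alpha>) (f \<alpha>)) \<in> \<nat>)"

definition lie_module ::
  "('g::complex_vector \<Rightarrow> 'g \<Rightarrow> 'g) \<Rightarrow> (complex, 'w) module \<Rightarrow> ('g \<Rightarrow> 'w \<Rightarrow> 'w) \<Rightarrow> bool" where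
  "lie_module br M \<rho> \<longleftrightarrow> lie_algebra br \<and> Module.module complex_ring M
     \<and> (\<forall>x. linear_endo M (\<rho> x))
     \<and> (\<forall>x y. \<forall>w\<in>carrier M. \<rho> (x + y) w = \<rho> x w \<oplus>\<^bsub>M\<^esub> \<rho> y w)
     \<and> (\<forall>c x. \<forall>w\<in>carrier M. \<rho> (c *\<^sub>C x) w = c \<odot>\<^bsub>M\<^esub> \<rho> x w)
     \<and> (\<forall>x y. \<forall>w\<in>carrier M. \<rho> (br x y) w = \<rho> x (\<rho> y w) \<ominus>\<^bsub>M\<^esub> \<rho> y (\<rho> x w))"

definition irreducible_module :: "('g \<Rightarrow> 'v::complex_vector \<Rightarrow> 'v) \<Rightarrow> bool" where
  "irreducible_module \<rho> \<longleftrightarrow> (\<exists>w::'v. w \<noteq> 0)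
     \<and> (\<forall>W. cv.subspace W \<and> (\<forall>x. \<rho> x ` W \<subseteq> W) \<longrightarrow> W = {0} \<or> W = UNIV)"

definition highest_weight_vector ::
  "('g::complex_vector \<Rightarrow> 'g \<Rightarrow> 'g) \<Rightarrow> 'g set \<Rightarrow> ('g \<Rightarrow> complex) set
     \<Rightarrow> ('g \<Rightarrow> 'v::complex_vector \<Rightarrow> 'v) \<Rightarrow> ('g \<Rightarrow> complex) \<Rightarrow> 'v \<Rightarrow> bool" where
  "highest_weight_vector br h P \<rho> lam v \<longleftrightarrow> v \<noteq> 0
     \<and> (\<forall>x\<in>n_plus br h P. \<rho> x v = 0) \<and> (\<forall>t\<in>h. \<rho> t v = lam t *\<^sub>C v)"


section \<open>The PBW filtration and its associated graded space\<close>

definition pbw_filtration ::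
  "'g set \<Rightarrow> ('g \<Rightarrow> 'v::complex_vector \<Rightarrow> 'v) \<Rightarrow> 'v \<Rightarrow> nat \<Rightarrow> 'v set" where
  "pbw_filtration N \<rho> v s = cv.span {foldr \<rho> xs v | xs. set xs \<subseteq> N \<and> length xs \<le> s}"

text \<open>\<open>prev F s\<close> is \<open>F\<^sub>s\<^sub>-\<^sub>1\<close>, with \<open>F\<^sub>-\<^sub>1 = 0\<close>.\<close>

definition prev :: "(nat \<Rightarrow> 'v::zero set) \<Rightarrow> nat \<Rightarrow> 'v set" where
  "prev F s = (case s of 0 \<Rightarrow> {0} | Suc r \<Rightarrow> F r)"

text \<open>The direct sum of the quotients \<open>F\<^sub>s / F\<^sub>s\<^sub>-\<^sub>1\<close>: an element is the family of its components,
  each of them a coset, almost all of them zero.\<close>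

definition gr :: "(nat \<Rightarrow> 'v::complex_vector set) \<Rightarrow> (complex, nat \<Rightarrow> 'v set) module" where
  "gr F = \<lparr>carrier = {a. (\<forall>s. \<exists>w\<in>F s. a s = {w + u | u. u \<in> prev F s})
                          \<and> finite {s. a s \<noteq> prev F s}},
           mult = undefined, one = undefined,
           zero = prev F,
           add = (\<lambda>a b s. {x + y | x y. x \<in> a s \<and> y \<in> b s}),
           smult = (\<lambda>c a s. {c *\<^sub>C x + u | x u. x \<in> a s \<and> u \<in> prev F s})\<rparr>"

text \<open>For \<open>T\<close> with \<open>T F\<^sub>s \<subseteq> F\<^sub>s\<^sub>+\<^sub>d\<close> this is the direct sum of the induced maps
  \<open>F\<^sub>s / F\<^sub>s\<^sub>-\<^sub>1 \<rightarrow> F\<^sub>s\<^sub>+\<^sub>d / F\<^sub>s\<^sub>+\<^sub>d\<^sub>-\<^sub>1\<close>.\<close>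

definition gr_map ::
  "(nat \<Rightarrow> 'v::complex_vector set) \<Rightarrow> nat \<Rightarrow> ('v \<Rightarrow> 'v) \<Rightarrow> (nat \<Rightarrow> 'v set) \<Rightarrow> (nat \<Rightarrow> 'v set)" where
  "gr_map F d T a = (\<lambda>s. if s < d then prev F s
                         else {T x + u | x u. x \<in> a (s - d) \<and> u \<in> prev F s})"


section \<open>The degenerate Lie algebra\<close>

definition degenerate_bracket ::
  "('g::complex_vector \<Rightarrow> 'g \<Rightarrow> 'g) \<Rightarrow> 'g set \<Rightarrow> ('g \<Rightarrow> complex) set
     \<Rightarrow> (('g \<Rightarrow> complex) \<Rightarrow> 'g) \<Rightarrow> (('g \<Rightarrow> complex) \<Rightarrow> 'g) \<Rightarrow> 'g \<Rightarrow> 'g \<Rightarrow> 'g" where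
  "degenerate_bracket br h P e f = (THE br'. bilinear_alt br'
     \<and> (\<forall>t\<in>h. \<forall>\<alpha>\<in>P. br' t (f \<alpha>) = (- \<alpha> t) *\<^sub>C f \<alpha>)
     \<and> (\<forall>t\<in>h. \<forall>\<alpha>\<in>P. br' t (e \<alpha>) = \<alpha> t *\<^sub>C e \<alpha>)
     \<and> (\<forall>t\<in>h. \<forall>t'\<in>h. br' t t' = 0)
     \<and> (\<forall>\<alpha>\<in>P. \<forall>\<beta>\<in>P. br' (f \<alpha>) (f \<beta>) = 0)
     \<and> (\<forall>\<alpha>\<in>P. \<forall>\<beta>\<in>P. br' (e \<alpha>) (e \<beta>) = br (e \<alpha>) (e \<beta>))
     \<and> (\<forall>\<alpha>\<in>P. \<forall>\<beta>\<in>P. br' (e \<alpha>) (f \<beta>) = (if \<beta> - \<alpha> \<in> P then br (e \<alpha>) (f \<beta>) else 0)))"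

text \<open>The projection onto \<open>N\<close> along \<open>b\<close>; for \<open>N = n\<^sup>-\<close> it realises the identification
  of \<open>g / b\<close> with \<open>n\<^sup>-\<close>.\<close>

definition proj_along :: "'g::complex_vector set \<Rightarrow> 'g set \<Rightarrow> 'g \<Rightarrow> 'g" where
  "proj_along N b x = (THE y. y \<in> N \<and> x - y \<in> b)"

definition degenerate_action ::
  "'g::complex_vector set \<Rightarrow> 'g set \<Rightarrow> ('g \<Rightarrow> 'v::complex_vector \<Rightarrow> 'v) \<Rightarrow> (nat \<Rightarrow> 'v set)
     \<Rightarrow> 'g \<Rightarrow> (nat \<Rightarrow> 'v set) \<Rightarrow> (nat \<Rightarrow> 'v set)" where
  "degenerate_action N b \<rho> F z a =
     gr_map F 0 (\<rho> (z - proj_along N b z)) a \<oplus>\<^bsub>gr F\<^esub> gr_map F 1 (\<rho> (proj_along N b z)) a"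


section \<open>Complex Lie groups\<close>

record ('a, 'n) cgroup = "'a monoid" +
  gtop :: "'a topology"
  atlas :: "('a set \<times> ('a \<Rightarrow> complex ^ 'n)) set"

definition complex_differentiable_at ::
  "('x::{real_normed_vector, complex_vector} \<Rightarrow> 'y::{real_normed_vector, complex_vector})
     \<Rightarrow> 'x \<Rightarrow> bool" where
  "complex_differentiable_at F x \<longleftrightarrow>
     (\<exists>D. (F has_derivative D) (at x) \<and> (\<forall>c u. D (c *\<^sub>C u) = c *\<^sub>C D u))"

definition chart_inv :: "'a set \<times> ('a \<Rightarrow> 'b) \<Rightarrow> 'b \<Rightarrow> 'a" where
  "chart_inv k = inv_into (fst k) (snd k)"

definition complex_atlas :: "'a topology \<Rightarrow> ('a set \<times> ('a \<Rightarrow> complex ^ 'n)) set \<Rightarrow> bool" where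
  "complex_atlas X A \<longleftrightarrow> (\<Union>k\<in>A. fst k) = topspace X
     \<and> (\<forall>(U, \<phi>)\<in>A. openin X U \<and> open (\<phi> ` U)
          \<and> homeomorphic_map (subtopology X U) (top_of_set (\<phi> ` U)) \<phi>)
     \<and> (\<forall>k\<in>A. \<forall>l\<in>A. \<forall>x\<in>fst k \<inter> fst l.
          complex_differentiable_at (snd l \<circ> chart_inv k) (snd k x))"

text \<open>Complex differentiability at every point of an open set is holomorphy, so the last two
  conditions say that multiplication and inversion are holomorphic.\<close>

definition complex_lie_group :: "('a, 'n::finite) cgroup \<Rightarrow> bool" where
  "complex_lie_group G \<longleftrightarrow> group G
     \<and> topspace (gtop G) = carrier G \<and> Hausdorff_space (gtop G) \<and> second_countable (gtop G)
     \<and> complex_atlas (gtop G) (atlas G)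
     \<and> continuous_map (prod_topology (gtop G) (gtop G)) (gtop G) (\<lambda>(x, y). x \<otimes>\<^bsub>G\<^esub> y)
     \<and> continuous_map (gtop G) (gtop G) (\<lambda>x. inv\<^bsub>G\<^esub> x)
     \<and> (\<forall>k\<in>atlas G. \<forall>l\<in>atlas G. \<forall>m\<in>atlas G. \<forall>x\<in>fst k. \<forall>y\<in>fst l. x \<otimes>\<^bsub>G\<^esub> y \<in> fst m \<longrightarrow>
          complex_differentiable_at
            (\<lambda>(a, b). snd m (chart_inv k a \<otimes>\<^bsub>G\<^esub> chart_inv l b)) (snd k x, snd l y))
     \<and> (\<forall>k\<in>atlas G. \<forall>l\<in>atlas G. \<forall>x\<in>fst k. inv\<^bsub>G\<^esub> x \<in> fst l \<longrightarrow>
          complex_differentiable_at (\<lambda>a. snd l (inv\<^bsub>G\<^esub> (chart_inv k a))) (snd k x))"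

text \<open>In the following \<open>k\<close> is a chart at the unit, through which the tangent space at the unit
  is \<open>complex ^ 'n\<close>, and \<open>\<theta>\<close> is a linear identification of a Lie algebra with this tangent space.
  \<open>Ad\<close> is the derivative of conjugation at the unit, and the bracket on the tangent space is
  the derivative of \<open>Ad\<close> at the unit: \<open>[x, y] = ad x y\<close>.\<close>

definition Ad ::
  "('a, 'n::finite) cgroup \<Rightarrow> 'a set \<times> ('a \<Rightarrow> complex ^ 'n) \<Rightarrow> ('g \<Rightarrow> complex ^ 'n)
     \<Rightarrow> 'a \<Rightarrow> 'g \<Rightarrow> 'g" where
  "Ad G k \<theta> g x = inv_into UNIV \<theta> (frechet_derivative
     (\<lambda>a. snd k (g \<otimes>\<^bsub>G\<^esub> chart_inv k a \<otimes>\<^bsub>G\<^esub> inv\<^bsub>G\<^esub> g)) (at (snd k \<one>\<^bsub>G\<^esub>)) (\<theta> x))"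

definition has_lie_algebra ::
  "('a, 'n::finite) cgroup \<Rightarrow> ('g::complex_vector \<Rightarrow> 'g \<Rightarrow> 'g)
     \<Rightarrow> 'a set \<times> ('a \<Rightarrow> complex ^ 'n) \<Rightarrow> ('g \<Rightarrow> complex ^ 'n) \<Rightarrow> bool" where
  "has_lie_algebra G br k \<theta> \<longleftrightarrow> k \<in> atlas G \<and> \<one>\<^bsub>G\<^esub> \<in> fst k
     \<and> Vector_Spaces.linear scaleC scaleC \<theta> \<and> bij \<theta>
     \<and> (\<forall>y. ((\<lambda>a. \<theta> (Ad G k \<theta> (chart_inv k a) y)) has_derivative (\<lambda>u. \<theta> (br (inv_into UNIV \<theta> u) y)))
              (at (snd k \<one>\<^bsub>G\<^esub>)))"

definition simple_lie_group ::
  "('a, 'n::finite) cgroup \<Rightarrow> ('g::complex_vector \<Rightarrow> 'g \<Rightarrow> 'g)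
     \<Rightarrow> 'a set \<times> ('a \<Rightarrow> complex ^ 'n) \<Rightarrow> ('g \<Rightarrow> complex ^ 'n) \<Rightarrow> bool" where
  "simple_lie_group G br k \<theta> \<longleftrightarrow> complex_lie_group G \<and> connected_space (gtop G)
     \<and> simple_lie_algebra br \<and> has_lie_algebra G br k \<theta>"

text \<open>One-parameter subgroups with initial velocity \<open>x\<close>, that is \<open>\<gamma> t = exp (t x)\<close>.\<close>

definition one_parameter_subgroup ::
  "('a, 'n::finite) cgroup \<Rightarrow> 'a set \<times> ('a \<Rightarrow> complex ^ 'n) \<Rightarrow> ('g \<Rightarrow> complex ^ 'n)
     \<Rightarrow> (real \<Rightarrow> 'a) \<Rightarrow> 'g \<Rightarrow> bool" where
  "one_parameter_subgroup G k \<theta> \<gamma> x \<longleftrightarrow> continuous_map euclideanreal (gtop G) \<gamma>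
     \<and> (\<forall>s t. \<gamma> (s + t) = \<gamma> s \<otimes>\<^bsub>G\<^esub> \<gamma> t)
     \<and> ((\<lambda>t. snd k (\<gamma> t)) has_vector_derivative \<theta> x) (at 0)"

text \<open>For \<open>b\<close> a Borel subalgebra: the closed connected subgroup whose Lie algebra is \<open>b\<close>.\<close>

definition borel_subgroup ::
  "('a, 'n::finite) cgroup \<Rightarrow> 'a set \<times> ('a \<Rightarrow> complex ^ 'n) \<Rightarrow> ('g \<Rightarrow> complex ^ 'n)
     \<Rightarrow> 'g set \<Rightarrow> 'a set \<Rightarrow> bool" where
  "borel_subgroup G k \<theta> b B \<longleftrightarrow> subgroup B G \<and> closedin (gtop G) B \<and> connectedin (gtop G) B
     \<and> {x. \<exists>\<gamma>. one_parameter_subgroup G k \<theta> \<gamma> x \<and> range \<gamma> \<subseteq> B} = b"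

definition group_module ::
  "('a, 'e) monoid_scheme \<Rightarrow> (complex, 'w) module \<Rightarrow> ('a \<Rightarrow> 'w \<Rightarrow> 'w) \<Rightarrow> bool" where
  "group_module G M \<sigma> \<longleftrightarrow> group G \<and> Module.module complex_ring M
     \<and> (\<forall>g\<in>carrier G. linear_endo M (\<sigma> g))
     \<and> (\<forall>w\<in>carrier M. \<sigma> \<one>\<^bsub>G\<^esub> w = w)
     \<and> (\<forall>g\<in>carrier G. \<forall>g'\<in>carrier G. \<forall>w\<in>carrier M. \<sigma> (g \<otimes>\<^bsub>G\<^esub> g') w = \<sigma> g (\<sigma> g' w))"

text \<open>A finite-dimensional holomorphic representation of \<open>G\<close> whose differential is \<open>\<rho>\<close>, holomorphy
  and differential being those of the matrix coefficients.\<close>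

definition integrates ::
  "('a, 'n::finite) cgroup \<Rightarrow> 'a set \<times> ('a \<Rightarrow> complex ^ 'n) \<Rightarrow> ('g \<Rightarrow> complex ^ 'n)
     \<Rightarrow> ('a \<Rightarrow> 'v \<Rightarrow> 'v) \<Rightarrow> ('g \<Rightarrow> 'v::complex_vector \<Rightarrow> 'v) \<Rightarrow> bool" where
  "integrates G k \<theta> \<sigma> \<rho> \<longleftrightarrow> fin_dim TYPE('v) \<and> group_module G whole \<sigma>
     \<and> (\<forall>\<psi> w. functional whole \<psi> \<longrightarrow>
          (\<forall>l\<in>atlas G. \<forall>x\<in>fst l.
             complex_differentiable_at (\<lambda>a. \<psi> (\<sigma> (chart_inv l a) w)) (snd l x))
          \<and> ((\<lambda>a. \<psi> (\<sigma> (chart_inv k a) w)) has_derivative (\<lambda>u. \<psi> (\<rho> (inv_into UNIV \<theta> u) w)))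
              (at (snd k \<one>\<^bsub>G\<^esub>)))"


section \<open>The degenerate group\<close>

text \<open>The semidirect product of the vector group \<open>N\<close> and \<open>B\<close>, with \<open>B\<close> acting on \<open>N = g / b\<close>
  through \<open>Ad\<close>.\<close>

definition degenerate_group ::
  "('a, 'n::finite) cgroup \<Rightarrow> 'a set \<times> ('a \<Rightarrow> complex ^ 'n) \<Rightarrow> ('g \<Rightarrow> complex ^ 'n)
     \<Rightarrow> 'g::complex_vector set \<Rightarrow> 'g set \<Rightarrow> 'a set \<Rightarrow> ('g \<times> 'a) monoid" where
  "degenerate_group G k \<theta> N b B =
     \<lparr>carrier = N \<times> B,
      mult = (\<lambda>(y, g) (y', g'). (y + proj_along N b (Ad G k \<theta> g y'), g \<otimes>\<^bsub>G\<^esub> g')),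
      one = (0, \<one>\<^bsub>G\<^esub>)\<rparr>"

definition degenerate_topology ::
  "('a, 'n::finite) cgroup \<Rightarrow> ('g \<Rightarrow> complex ^ 'n) \<Rightarrow> 'g set \<Rightarrow> 'a set \<Rightarrow> ('g \<times> 'a) topology" where
  "degenerate_topology G \<theta> N B =
     prod_topology (pullback_topology N \<theta> euclidean) (subtopology (gtop G) B)"

definition continuous_coefficients ::
  "'a topology \<Rightarrow> (complex, 'w) module \<Rightarrow> ('a \<Rightarrow> 'w \<Rightarrow> 'w) \<Rightarrow> bool" where
  "continuous_coefficients X M \<sigma> \<longleftrightarrow> (\<forall>\<psi>. \<forall>w\<in>carrier M. functional M \<psi> \<longrightarrow>
     continuous_map X euclidean (\<lambda>g. \<psi> (\<sigma> g w)))"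

text \<open>One-parameter subgroups of the degenerate group with initial velocity \<open>y + x\<close>, where
  \<open>y = proj_along N b (y + x)\<close> lies in \<open>N\<close> and \<open>x\<close> in \<open>b\<close>.\<close>

definition degenerate_one_parameter_subgroup ::
  "('a, 'n::finite) cgroup \<Rightarrow> 'a set \<times> ('a \<Rightarrow> complex ^ 'n) \<Rightarrow> ('g \<Rightarrow> complex ^ 'n)
     \<Rightarrow> 'g::complex_vector set \<Rightarrow> 'g set \<Rightarrow> 'a set \<Rightarrow> (real \<Rightarrow> 'g \<times> 'a) \<Rightarrow> 'g \<Rightarrow> bool" where
  "degenerate_one_parameter_subgroup G k \<theta> N b B \<Gamma> z \<longleftrightarrow>
     range \<Gamma> \<subseteq> carrier (degenerate_group G k \<theta> N b B)
     \<and> (\<forall>s t. \<Gamma> (s + t) = \<Gamma> s \<otimes>\<^bsub>degenerate_group G k \<theta> N b B\<^esub> \<Gamma> t)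
     \<and> ((\<lambda>t. \<theta> (fst (\<Gamma> t))) has_vector_derivative \<theta> (proj_along N b z)) (at 0)
     \<and> one_parameter_subgroup G k \<theta> (\<lambda>t. snd (\<Gamma> t)) (z - proj_along N b z)"

end

theory Submission
  imports Defs
begin

text \<open>For \<open>x\<close> in \<open>b\<close> and \<open>y\<close> in \<open>n\<^sup>-\<close> write \<open>x y w = y x w + [x, y] w\<close>; the filtration is therefore stable
  under \<open>b\<close>, and modulo lower degree the operators of \<open>n\<^sup>-\<close> commute and \<open>[x, y]\<close> acts through its
  projection to \<open>n\<^sup>-\<close>, which is the bracket of \<open>g\<^sup>a\<close>.
  For \<open>g\<close> in \<open>B\<close> the automorphism \<open>Ad g\<close> preserves \<open>b\<close> and \<open>n\<^sup>+ = [b, b]\<close>, so \<open>\<sigma> g v\<close> is annihilated by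
  \<open>n\<^sup>+\<close> and hence proportional to \<open>v\<close>; together with \<open>\<sigma> g (\<rho> x w) = \<rho> (Ad g x) (\<sigma> g w)\<close> this shows that \<open>\<sigma> g\<close>
  preserves the filtration. The element \<open>(y, g)\<close> of \<open>G\<^sup>a\<close> acts by the operator induced by \<open>\<sigma> g\<close> followed
  by the exponential of the nilpotent operator induced by \<open>\<rho> y\<close>. The matrix coefficients of this
  action along a one-parameter subgroup satisfy the differential equation of the exponential.\<close>

section \<open>Complex linear algebra\<close>

text \<open>For g in B the element \<open>Ad g y\<close> usually leaves \<open>N\<close>, although y
  lies in it. In the graded space, however, an element of the Lie algebra acts in degree one only
  through its class modulo b, and this class is what the product of the degenerate group records.
  The degree estimates are therefore proved for all of the Lie algebra, and \<open>N\<close> enters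
  through the projection.

  The degenerate bracket is a definite description in terms of root vectors. It is matched with a
  closed formula by comparing weights, which requires that h is abelian, that the zero weight space
  is h, and that there are no weights besides 0, \<open>P\<close> and its negatives. These facts are
  drawn from nilpotency and self-normalisation of h, from simplicity, and from the triangular
  decomposition.

  The graded space has no topology of its own: limits and derivatives are visible only through
  linear functionals. Products of operators are therefore treated like products of matrices, by
  expanding in a finite system of vectors and coordinate functionals.\<close>

abbreviation clinear :: "('a::complex_vector \<Rightarrow> 'b::complex_vector) \<Rightarrow> bool" where
  "clinear \<equiv> Vector_Spaces.linear scaleC scaleC"

interpretation cvp: vector_space_pair
  "scaleC :: complex \<Rightarrow> 'a \<Rightarrow> 'a::complex_vector" "scaleC :: complex \<Rightarrow> 'b \<Rightarrow> 'b::complex_vector" ..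

lemma clinearI:
  assumes "\<And>x y. f (x + y) = f x + f y" "\<And>c x. f (c *\<^sub>C x) = c *\<^sub>C f x"
  shows "clinear f"
  by unfold_locales (use assms in auto)

lemmas clinear_add = cvp.linear_add
lemmas clinear_scale = cvp.linear_scale
lemmas clinear_0 = cvp.linear_0
lemmas clinear_diff = cvp.linear_diff
lemmas clinear_neg = cvp.linear_neg
lemmas clinear_sum = cvp.linear_sum

lemma clinear_span_subset:
  assumes "x \<in> cv.span S" "clinear f" "cv.subspace W" "\<And>x. x \<in> S \<Longrightarrow> f x \<in> W"
  shows "f x \<in> W"
proof -
  have "f ` cv.span S = cv.span (f ` S)" using cvp.linear_span_image[OF assms(2)] by simp
  also have "\<dots> \<subseteq> W" using assms by (intro cv.span_minimal) auto
  finally show ?thesis using assms(1) by auto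
qed

text \<open>Applying \<open>T s\<close> minus the scalar \<open>wt m s\<close> removes the term of
  index \<open>m\<close> and multiplies each other \<open>x i\<close> by
  \<open>wt i s - wt m s\<close>. The separating \<open>s\<close> depends on the pair of
  \<open>j\<close> and \<open>m\<close>, so the induction hypothesis is used once for each
  \<open>j\<close>.\<close>

lemma weight_vectors_independent:
  fixes T :: "'s \<Rightarrow> 'v::complex_vector \<Rightarrow> 'v" and wt :: "'i \<Rightarrow> 's \<Rightarrow> complex"
  assumes "finite R" "\<And>s. s \<in> S \<Longrightarrow> clinear (T s)"
    and "\<And>i s. i \<in> R \<Longrightarrow> s \<in> S \<Longrightarrow> T s (x i) = wt i s *\<^sub>C x i"
    and "\<And>i j. i \<in> R \<Longrightarrow> j \<in> R \<Longrightarrow> i \<noteq> j \<Longrightarrow> \<exists>s\<in>S. wt i s \<noteq> wt j s"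
    and "(\<Sum>i\<in>R. x i) = 0"
  shows "\<forall>i\<in>R. x i = 0"
  using assms(1,3-5)
proof (induction R arbitrary: x rule: finite_induct)
  case empty
  then show ?case by simp
next
  case (insert m R)
  have "x j = 0" if j: "j \<in> R" for j
  proof -
    obtain s where s: "s \<in> S" "wt j s \<noteq> wt m s"
      using insert.prems(2)[of j m] j insert.hyps by auto
    let ?y = "\<lambda>i. (wt i s - wt m s) *\<^sub>C x i"
    have lin: "clinear (T s)" using assms(2) s by auto
    have "(\<Sum>i\<in>insert m R. ?y i) = T s (\<Sum>i\<in>insert m R. x i) - wt m s *\<^sub>C (\<Sum>i\<in>insert m R. x i)"
      using insert.prems(1) s(1)
      by (simp only: clinear_sum[OF lin] cv.scale_sum_right cv.scale_left_diff_distrib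
          sum_subtractf[symmetric] cong: sum.cong)
    also have "\<dots> = 0" by (simp add: insert.prems(3) clinear_0[OF lin])
    finally have "(\<Sum>i\<in>R. ?y i) = 0" using insert.hyps by simp
    moreover have "T s' (?y i) = wt i s' *\<^sub>C ?y i" if "i \<in> R" "s' \<in> S" for i s'
      using insert.prems(1)[of i s'] that
      by (simp add: clinear_scale[OF assms(2)] scaleC_scaleC mult.commute)
    ultimately have "\<forall>i\<in>R. ?y i = 0"
      by (intro insert.IH) (use insert.prems(2) in auto)
    then show ?thesis using s j by auto
  qed
  then show ?case using insert.prems(3) insert.hyps by auto
qed

lemma span_Union_decompose:
  assumes "\<And>i. i \<in> Q \<Longrightarrow> cv.subspace (E i)" "z \<in> cv.span (\<Union>i\<in>Q. E i)"
  obtains R x where "finite R" "R \<subseteq> Q" "\<And>i. i \<in> R \<Longrightarrow> x i \<in> E i" "z = (\<Sum>i\<in>R. x i)"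
proof -
  \<comment> \<open>The families are defined on all of \<open>Q\<close> and vanish off
    \<open>R\<close>, so that two of them can be added over the union of their index sets.\<close>
  define Z where "Z = {z. \<exists>R x. finite R \<and> R \<subseteq> Q \<and> (\<forall>i\<in>Q. x i \<in> E i) \<and> (\<forall>i. i \<notin> R \<longrightarrow> x i = 0)
    \<and> z = (\<Sum>i\<in>R. x i)}"
  have "cv.subspace Z"
  proof (rule cv.subspaceI)
    show "0 \<in> Z" unfolding Z_def using assms(1) cv.subspace_0
      by (intro CollectI exI[of _ "{}"] exI[of _ "\<lambda>_. 0"]) auto
  next
    fix a b assume "a \<in> Z" "b \<in> Z"
    then obtain R x R' x' where *: "finite R" "R \<subseteq> Q" "\<forall>i\<in>Q. x i \<in> E i" "\<forall>i. i \<notin> R \<longrightarrow> x i = 0"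
       "a = (\<Sum>i\<in>R. x i)" "finite R'" "R' \<subseteq> Q" "\<forall>i\<in>Q. x' i \<in> E i" "\<forall>i. i \<notin> R' \<longrightarrow> x' i = 0"
       "b = (\<Sum>i\<in>R'. x' i)" unfolding Z_def by auto
    have "a = (\<Sum>i\<in>R \<union> R'. x i)" unfolding *(5) by (rule sum.mono_neutral_left) (use * in auto)
    moreover have "b = (\<Sum>i\<in>R \<union> R'. x' i)" unfolding *(10)
      by (rule sum.mono_neutral_left) (use * in auto)
    ultimately show "a + b \<in> Z" unfolding Z_def
      by (intro CollectI exI[of _ "R \<union> R'"] exI[of _ "\<lambda>i. x i + x' i"])
        (use * assms(1) in \<open>auto simp: sum.distrib intro!: cv.subspace_add\<close>)
  next
    fix c a assume "a \<in> Z"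
    then obtain R x where "finite R" "R \<subseteq> Q" "\<forall>i\<in>Q. x i \<in> E i" "\<forall>i. i \<notin> R \<longrightarrow> x i = 0"
       "a = (\<Sum>i\<in>R. x i)" unfolding Z_def by auto
    then show "c *\<^sub>C a \<in> Z" unfolding Z_def
      by (intro CollectI exI[of _ R] exI[of _ "\<lambda>i. c *\<^sub>C x i"])
        (use assms(1) in \<open>auto simp: cv.scale_sum_right intro!: cv.subspace_scale\<close>)
  qed
  moreover have "E i \<subseteq> Z" if i: "i \<in> Q" for i
  proof
    fix y assume "y \<in> E i"
    then show "y \<in> Z" unfolding Z_def using i assms(1) cv.subspace_0
      by (intro CollectI exI[of _ "{i}"] exI[of _ "\<lambda>j. if j = i then y else 0"]) auto
  qed
  ultimately have "cv.span (\<Union>i\<in>Q. E i) \<subseteq> Z" by (intro cv.span_minimal) auto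
  then have "z \<in> Z" using assms(2) by auto
  then show thesis using that unfolding Z_def by blast
qed

text \<open>The operators form an arbitrary family: h acting by the bracket gives the root spaces, a
  family with one member gives the eigenspaces of a single operator.\<close>

definition weight_space :: "'s set \<Rightarrow> ('s \<Rightarrow> 'v::complex_vector \<Rightarrow> 'v) \<Rightarrow> ('s \<Rightarrow> complex) \<Rightarrow> 'v set" where
  "weight_space S T \<mu> = {x. \<forall>s\<in>S. T s x = \<mu> s *\<^sub>C x}"

lemma subspace_weight_space:
  assumes "\<And>s. s \<in> S \<Longrightarrow> clinear (T s)"
  shows "cv.subspace (weight_space S T \<mu>)"
  by (rule cv.subspaceI)
    (auto simp: weight_space_def clinear_0[OF assms] clinear_add[OF assms] clinear_scale[OF assms]
      scaleC_add_right scaleC_scaleC mult.commute)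

text \<open>Write \<open>z\<close> with one vector per index and put \<open>- z\<close> at the new
  index \<open>m\<close>: these vectors have pairwise distinct weights and sum to zero.\<close>

lemma weight_vector_in_span_other_weights:
  fixes wt :: "'i \<Rightarrow> 's \<Rightarrow> complex"
  assumes T: "\<And>s. s \<in> S \<Longrightarrow> clinear (T s)"
    and z: "z \<in> cv.span (\<Union>i\<in>Q. weight_space S T (wt i))" "z \<in> weight_space S T (wt m)" "m \<notin> Q"
    and sep: "\<And>i j. i \<in> insert m Q \<Longrightarrow> j \<in> insert m Q \<Longrightarrow> i \<noteq> j \<Longrightarrow> \<exists>s\<in>S. wt i s \<noteq> wt j s"
  shows "z = 0"
proof -
  obtain R x where R: "finite R" "R \<subseteq> Q" "\<And>i. i \<in> R \<Longrightarrow> x i \<in> weight_space S T (wt i)"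
    "z = (\<Sum>i\<in>R. x i)"
    using span_Union_decompose[OF subspace_weight_space[OF T] z(1)] by blast
  let ?x = "x(m := - z)"
  have m: "m \<notin> R" using R(2) z(3) by auto
  have "\<forall>i\<in>insert m R. ?x i = 0"
  proof (rule weight_vectors_independent[where T=T and S=S and wt=wt])
    show "finite (insert m R)" using R by simp
    show "clinear (T s)" if "s \<in> S" for s using T that .
    show "T s (?x i) = wt i s *\<^sub>C ?x i" if "i \<in> insert m R" "s \<in> S" for i s
      using that R(3)[of i] z(2) by (auto simp: weight_space_def clinear_neg[OF T])
    show "\<exists>s\<in>S. wt i s \<noteq> wt j s" if "i \<in> insert m R" "j \<in> insert m R" "i \<noteq> j" for i j
      using sep[of i j] that R(2) by auto
    have "(\<Sum>i\<in>R. ?x i) = z" unfolding R(4) using m by (intro sum.cong) auto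
    then show "(\<Sum>i\<in>insert m R. ?x i) = 0" using R(1) m by (subst sum.insert) auto
  qed
  then show ?thesis by simp
qed

section \<open>The Borel subalgebra and the degenerate Lie algebra\<close>

locale cartan_setup =
  fixes br :: "'g::complex_vector \<Rightarrow> 'g \<Rightarrow> 'g"
    and h :: "'g set"
    and P :: "('g \<Rightarrow> complex) set"
    and e f :: "('g \<Rightarrow> complex) \<Rightarrow> 'g"
  assumes simple: "simple_lie_algebra br"
    and cartan: "cartan_decomposition br h P"
    and chev: "chevalley_vectors br h P e f"
begin

abbreviation "N \<equiv> n_minus br h P"
abbreviation "NP \<equiv> n_plus br h P"
abbreviation "b \<equiv> borel_algebra br h P"
abbreviation "pr \<equiv> proj_along N b"

lemma lie: "lie_algebra br" using simple by (simp add: simple_lie_algebra_def)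

lemma clinear_br: "clinear (br x)" and clinear_br': "clinear (\<lambda>x. br x y)" and br_self [simp]: "br x x = 0"
  using lie by (auto simp: lie_algebra_def bilinear_alt_def)

lemma jacobi: "br x (br y z) + br y (br z x) + br z (br x y) = 0"
  using lie by (auto simp: lie_algebra_def)

lemma br_simps [simp]:
  "br x (y + z) = br x y + br x z" "br (x + y) z = br x z + br y z"
  "br x (c *\<^sub>C y) = c *\<^sub>C br x y" "br (c *\<^sub>C x) y = c *\<^sub>C br x y"
  "br x 0 = 0" "br 0 x = 0" "br x (- y) = - br x y" "br (- x) y = - br x y"
  "br x (y - z) = br x y - br x z" "br (x - y) z = br x z - br y z"
  using clinear_add[OF clinear_br] clinear_add[OF clinear_br'] clinear_scale[OF clinear_br]
    clinear_scale[OF clinear_br'] clinear_0[OF clinear_br] clinear_0[OF clinear_br']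
    clinear_neg[OF clinear_br] clinear_neg[OF clinear_br'] clinear_diff[OF clinear_br]
    clinear_diff[OF clinear_br'] by auto

lemma br_anti: "br y x = - br x y"
proof -
  have "br (x + y) (x + y) = 0" by (rule br_self)
  then have "br x y + br y x = 0"
    unfolding br_simps(1,2) by (simp only: br_self add_0_left add_0_right add.commute)
  then show ?thesis by (simp add: add_eq_0_iff)
qed

lemma jacobi_left: "br (br x y) z = br x (br y z) - br y (br x z)"
  using jacobi[of x y z] br_anti[of z x] br_anti[of "br x y" z]
  by (simp add: algebra_simps)

section \<open>Cartan subalgebra, roots and the triangular decomposition\<close>

lemma csa: "cartan_subalgebra br h" and positive: "positive_roots br h P"
  using cartan by (auto simp: cartan_decomposition_def)

lemma subspace_h: "cv.subspace h" and br_h_h: "s \<in> h \<Longrightarrow> t \<in> h \<Longrightarrow> br s t \<in> h"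
  using csa unfolding cartan_subalgebra_def lie_subalgebra_def by blast+

lemma normalizer_h: "(\<And>t. t \<in> h \<Longrightarrow> br x t \<in> h) \<Longrightarrow> x \<in> h"
  using csa unfolding cartan_subalgebra_def by blast

lemma P_subset_roots: "P \<subseteq> roots br h" using positive by (auto simp: positive_roots_def)

lemma P_dual: "\<alpha> \<in> P \<Longrightarrow> \<alpha> \<in> dual_of h" "\<alpha> \<in> P \<Longrightarrow> \<alpha> \<noteq> 0"
  using P_subset_roots by (auto simp: roots_def)

lemma subspace_dual_of: assumes "\<alpha> \<in> dual_of h" "\<beta> \<in> dual_of h"
  shows "\<alpha> + \<beta> \<in> dual_of h" "\<alpha> - \<beta> \<in> dual_of h" "- \<alpha> \<in> dual_of h" "0 \<in> dual_of h"
  using assms by (auto simp: dual_of_def algebra_simps)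

lemma dual_separated: "\<alpha> \<in> dual_of h \<Longrightarrow> \<beta> \<in> dual_of h \<Longrightarrow> \<alpha> \<noteq> \<beta> \<Longrightarrow> \<exists>t\<in>h. \<alpha> t \<noteq> \<beta> t"
  by (auto simp: dual_of_def fun_eq_iff) metis

lemma root_space_weight: "root_space br h \<alpha> = weight_space h br \<alpha>"
  by (simp add: root_space_def weight_space_def)

lemma br_root_space:
  assumes "x \<in> root_space br h \<alpha>" "y \<in> root_space br h \<beta>"
  shows "br x y \<in> root_space br h (\<alpha> + \<beta>)"
proof -
  have "br t (br x y) = (\<alpha> t + \<beta> t) *\<^sub>C br x y" if "t \<in> h" for t
  proof -
    have "br t (br x y) = br (br t x) y + br x (br t y)" using jacobi_left[of t x y] by simp
    then show ?thesis using assms that by (simp add: root_space_def scaleC_add_left)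
  qed
  then show ?thesis by (simp add: root_space_def)
qed

lemma subspace_NP: "cv.subspace NP" and subspace_N: "cv.subspace N"
  by (auto simp: n_plus_def n_minus_def)

lemma decomposition:
  obtains x t y where "x \<in> NP" "t \<in> h" "y \<in> N" "z = x + t + y"
  using cartan unfolding cartan_decomposition_def by (auto elim!: allE[of _ z] ex1E)

lemma decomposition_unique:
  assumes "x \<in> NP" "t \<in> h" "y \<in> N" "x' \<in> NP" "t' \<in> h" "y' \<in> N" "x + t + y = x' + t' + y'"
  shows "x = x' \<and> t = t' \<and> y = y'"
proof -
  have "\<exists>!(a, s, c). a \<in> NP \<and> s \<in> h \<and> c \<in> N \<and> x + t + y = a + s + c"
    using cartan unfolding cartan_decomposition_def by blast
  then have "(x, t, y) = (x', t', y')" by (rule ex1E) (use assms in blast)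
  then show ?thesis by simp
qed

text \<open>\<open>[h, h]\<close> annihilates all root vectors; hence so does the last nonzero term of the lower
  central series of \<open>h\<close> if it lies in \<open>[h, h]\<close>, and that term would be central in \<open>g\<close>.\<close>

lemma br_h_h_root: assumes "s \<in> h" "t \<in> h" "x \<in> root_space br h \<alpha>" shows "br (br s t) x = 0"
  using assms by (simp add: jacobi_left root_space_def scaleC_scaleC mult.commute)

text \<open>The centre is an ideal, and it is not everything because some bracket is
  nonzero.\<close>

lemma center_trivial: assumes "\<And>x. br z x = 0" shows "z = 0"
proof -
  have "lie_ideal br {z. \<forall>x. br z x = 0}"
    unfolding lie_ideal_def by (auto intro!: cv.subspaceI simp: jacobi_left)
  then have "{z. \<forall>x. br z x = 0} = {0} \<or> {z. \<forall>x. br z x = 0} = UNIV"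
    using simple unfolding simple_lie_algebra_def by blast
  moreover have "{z. \<forall>x. br z x = 0} \<noteq> UNIV" using simple unfolding simple_lie_algebra_def by blast
  ultimately show ?thesis using assms by blast
qed

lemma h_abelian: assumes "s \<in> h" "t \<in> h" shows "br s t = 0"
proof -
  let ?L = "lower_central br h"
  have Lh: "?L k \<subseteq> h" for k
  proof (induction k)
    case (Suc k)
    then have "{br x y |x y. x \<in> h \<and> y \<in> ?L k} \<subseteq> h" using br_h_h by auto
    then show ?case using cv.span_minimal[OF _ subspace_h] by simp
  qed simp
  obtain k where k: "?L k = {0}" using csa by (auto simp: cartan_subalgebra_def)
  \<comment> \<open>Terms of index at least one are spanned by brackets from h and so annihilate all
    root vectors; if the next term vanishes they also commute with h, hence are central. The descent
    has to end at index 1, since h itself does not consist of brackets.\<close>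
  have down: "?L (Suc k) = {0}" if "?L (Suc (Suc k)) = {0}" for k
  proof -
    have "z = 0" if z: "z \<in> ?L (Suc k)" for z
    proof (rule center_trivial)
      have zh: "br z t = 0" if t: "t \<in> h" for t
      proof -
        have "br t z \<in> ?L (Suc (Suc k))" using z t by (auto simp del: lower_central.simps(1) intro!: cv.span_base)
        then show ?thesis using \<open>?L (Suc (Suc k)) = {0}\<close> br_anti[of z t] by auto
      qed
      have zroot: "br z x = 0" if x: "x \<in> root_space br h \<alpha>" for x \<alpha>
      proof -
        have "br w x \<in> {0}" if "w \<in> {br x y |x y. x \<in> h \<and> y \<in> ?L k}" for w
          using that Lh[of k] br_h_h_root[OF _ _ x] by blast
        then have "br z x \<in> {0}"
          using clinear_span_subset[OF _ clinear_br' cv.subspace_single_0,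
            of z "{br x y |x y. x \<in> h \<and> y \<in> ?L k}" x] z by simp
        then show ?thesis by simp
      qed
      show "br z x = 0" for x
      proof -
        obtain a t c where *: "a \<in> NP" "t \<in> h" "c \<in> N" "x = a + t + c" by (rule decomposition)
        have "br z a \<in> {0}" using *(1) unfolding n_plus_def
          by (rule clinear_span_subset[OF _ clinear_br]) (use zroot in auto)
        moreover have "br z c \<in> {0}" using *(3) unfolding n_minus_def
          by (rule clinear_span_subset[OF _ clinear_br]) (use zroot in auto)
        ultimately show ?thesis using * zh by simp
      qed
    qed
    moreover have "0 \<in> ?L (Suc k)" by (auto intro: cv.span_zero)
    ultimately show ?thesis by blast
  qed
  have "?L 1 = {0}"
  proof (cases k)
    case 0
    then have "h = {0}" using k by simp
    then show ?thesis by (auto intro: cv.span_zero)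
  next
    case (Suc j)
    have "?L (Suc j) = {0} \<Longrightarrow> ?L 1 = {0}" for j
      by (induction j) (use down in auto)
    then show ?thesis using k Suc by blast
  qed
  moreover have "br s t \<in> ?L 1" using assms by (auto intro!: cv.span_base)
  ultimately show ?thesis by blast
qed

text \<open>An element of weight zero commutes with h, so it normalises h and lies in it by
  self-normalisation; the other inclusion is commutativity of h.\<close>

lemma root_space_0: "root_space br h 0 = h"
proof
  show "root_space br h 0 \<subseteq> h"
  proof
    fix x assume "x \<in> root_space br h 0"
    then have "br x t = 0" if "t \<in> h" for t using that br_anti[of x t] by (simp add: root_space_def)
    then show "x \<in> h" using normalizer_h cv.subspace_0[OF subspace_h] by auto
  qed
  show "h \<subseteq> root_space br h 0" using h_abelian by (auto simp: root_space_def)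
qed

lemma e_root: "\<alpha> \<in> P \<Longrightarrow> root_space br h \<alpha> = cv.span {e \<alpha>}"
  and f_root: "\<alpha> \<in> P \<Longrightarrow> root_space br h (- \<alpha>) = cv.span {f \<alpha>}"
  using chev by (auto simp: chevalley_vectors_def)

lemma e_in: "\<alpha> \<in> P \<Longrightarrow> e \<alpha> \<in> root_space br h \<alpha>"
  and f_in: "\<alpha> \<in> P \<Longrightarrow> f \<alpha> \<in> root_space br h (- \<alpha>)"
  by (auto simp: e_root f_root intro: cv.span_base)

lemma root_space_subset_NP: "\<alpha> \<in> P \<Longrightarrow> root_space br h \<alpha> \<subseteq> NP"
  and root_space_subset_N: "\<alpha> \<in> P \<Longrightarrow> root_space br h (- \<alpha>) \<subseteq> N"
  unfolding n_plus_def n_minus_def by (auto intro: cv.span_base)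

lemma NP_subset_b: "NP \<subseteq> b" and h_subset_b: "h \<subseteq> b"
proof -
  have "x = x + 0" "x = 0 + x" for x :: 'g by simp_all
  then show "NP \<subseteq> b" "h \<subseteq> b"
    unfolding borel_algebra_def using cv.subspace_0[OF subspace_h] cv.subspace_0[OF subspace_NP]
    by blast+
qed

lemma subspace_b: "cv.subspace b"
  unfolding borel_algebra_def using cv.subspace_sums[OF subspace_NP subspace_h] .

lemma NP_eq: "NP = cv.span (e ` P)"
proof
  show "NP \<subseteq> cv.span (e ` P)" unfolding n_plus_def
  proof (rule cv.span_minimal, rule UN_least)
    fix \<alpha> assume "\<alpha> \<in> P"
    then show "root_space br h \<alpha> \<subseteq> cv.span (e ` P)"
      using cv.span_mono[of "{e \<alpha>}" "e ` P"] by (simp add: e_root)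
  qed simp
  show "cv.span (e ` P) \<subseteq> NP"
    by (rule cv.span_minimal) (use e_in root_space_subset_NP subspace_NP in auto)
qed

lemma N_eq: "N = cv.span (f ` P)"
proof
  show "N \<subseteq> cv.span (f ` P)" unfolding n_minus_def
  proof (rule cv.span_minimal, rule UN_least)
    fix \<alpha> assume "\<alpha> \<in> P"
    then show "root_space br h (- \<alpha>) \<subseteq> cv.span (f ` P)"
      using cv.span_mono[of "{f \<alpha>}" "f ` P"] by (simp add: f_root)
  qed simp
  show "cv.span (f ` P) \<subseteq> N"
    by (rule cv.span_minimal) (use f_in root_space_subset_N subspace_N in auto)
qed

lemma span_root_vectors: "cv.span (e ` P \<union> h \<union> f ` P) = UNIV"
proof -
  have "z \<in> cv.span (e ` P \<union> h \<union> f ` P)" for z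
  proof -
    obtain x t y where *: "x \<in> NP" "t \<in> h" "y \<in> N" "z = x + t + y" by (rule decomposition)
    have "x \<in> cv.span (e ` P \<union> h \<union> f ` P)" "y \<in> cv.span (e ` P \<union> h \<union> f ` P)"
      using *(1,3) unfolding NP_eq N_eq
      using cv.span_mono[of "e ` P" "e ` P \<union> h \<union> f ` P"] cv.span_mono[of "f ` P" "e ` P \<union> h \<union> f ` P"]
      by blast+
    then show ?thesis unfolding *(4) using *(2) by (intro cv.span_add) (auto intro: cv.span_base)
  qed
  then show ?thesis by auto
qed

lemma obtain_\<xi>:
  obtains \<xi> where "\<xi> \<in> h" "\<And>\<alpha>. \<alpha> \<in> roots br h \<Longrightarrow> Re (\<alpha> \<xi>) > 0 \<longleftrightarrow> \<alpha> \<in> P"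
    "\<And>\<alpha>. \<alpha> \<in> P \<Longrightarrow> Re (\<alpha> \<xi>) > 0"
  using positive by (auto simp: positive_roots_def)

text \<open>Evaluation at \<open>\<xi>\<close> has positive real part on \<alpha> + \<beta>, so this
  weight is nonzero; carrying a nonzero vector it is a root, and its sign puts it in
  \<open>P\<close>.\<close>

lemma P_add: assumes "\<alpha> \<in> P" "\<beta> \<in> P" "x \<in> root_space br h (\<alpha> + \<beta>)" "x \<noteq> 0" shows "\<alpha> + \<beta> \<in> P"
proof -
  obtain \<xi> where \<xi>: "\<xi> \<in> h" "\<And>\<alpha>. \<alpha> \<in> roots br h \<Longrightarrow> Re (\<alpha> \<xi>) > 0 \<longleftrightarrow> \<alpha> \<in> P"
    "\<And>\<alpha>. \<alpha> \<in> P \<Longrightarrow> Re (\<alpha> \<xi>) > 0" using obtain_\<xi> by blast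
  have pos: "Re ((\<alpha> + \<beta>) \<xi>) > 0" using \<xi>(3)[OF assms(1)] \<xi>(3)[OF assms(2)] by simp
  then have "\<alpha> + \<beta> \<noteq> 0" by (auto simp: fun_eq_iff) (metis add_pos_pos less_irrefl zero_complex.sel(1) plus_complex.sel(1))
  then have "\<alpha> + \<beta> \<in> roots br h"
    using assms subspace_dual_of P_dual by (auto simp: roots_def)
  then show ?thesis using \<xi>(2) pos by blast
qed

section \<open>The Borel subalgebra and its derived algebra\<close>

lemma br_NP_NP: assumes "x \<in> NP" "y \<in> NP" shows "br x y \<in> NP"
proof -
  have *: "br x y \<in> NP" if x: "x \<in> e ` P" "y \<in> e ` P" for x y
  proof -
    obtain \<alpha> \<beta> where "\<alpha> \<in> P" "\<beta> \<in> P" "x = e \<alpha>" "y = e \<beta>" using x by auto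
    then have "br x y \<in> root_space br h (\<alpha> + \<beta>)" using br_root_space e_in by auto
    then show ?thesis using P_add[OF \<open>\<alpha> \<in> P\<close> \<open>\<beta> \<in> P\<close>] root_space_subset_NP cv.subspace_0[OF subspace_NP]
      by (cases "br x y = 0") auto
  qed
  have step: "br x y \<in> NP" if "x \<in> e ` P" for x
    using assms(2) unfolding NP_eq[THEN eqset_imp_iff, of y]
    by (rule clinear_span_subset[OF _ clinear_br subspace_NP]) (use * that in auto)
  show ?thesis using assms(1) unfolding NP_eq[THEN eqset_imp_iff, of x]
    by (rule clinear_span_subset[OF _ clinear_br' subspace_NP]) (rule step)
qed

lemma br_h_NP: assumes "t \<in> h" "x \<in> NP" shows "br t x \<in> NP"
  using assms(2) unfolding NP_eq[THEN eqset_imp_iff, of x]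
proof (rule clinear_span_subset[OF _ clinear_br subspace_NP])
  fix x assume "x \<in> e ` P"
  then show "br t x \<in> NP" using e_in assms(1) root_space_subset_NP cv.subspace_scale[OF subspace_NP]
    by (fastforce simp: root_space_def)
qed

lemma br_b_b: assumes "x \<in> b" "y \<in> b" shows "br x y \<in> NP"
proof -
  obtain a t a' t' where *: "a \<in> NP" "t \<in> h" "x = a + t" "a' \<in> NP" "t' \<in> h" "y = a' + t'"
    using assms unfolding borel_algebra_def by blast
  have "br x y = br a a' - br t' a + br t a'" using * h_abelian br_anti[of a t'] by simp
  then show ?thesis using * br_NP_NP br_h_NP cv.subspace_add[OF subspace_NP] cv.subspace_diff[OF subspace_NP]
    by auto
qed

lemma br_b: "x \<in> b \<Longrightarrow> y \<in> b \<Longrightarrow> br x y \<in> b" using br_b_b NP_subset_b by blast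

text \<open>With \<open>br_b_b\<close> this makes \<open>NP\<close> the derived algebra of b, so an
  automorphism preserving b preserves it; that is how \<open>Ad g\<close> is controlled. A positive
  root \<alpha> is nonzero at some \<open>t\<close> in h, and \<open>e \<alpha>\<close> is then a
  multiple of its bracket with \<open>t\<close>.\<close>

lemma NP_derived: "NP \<subseteq> cv.span {br x y | x y. x \<in> b \<and> y \<in> b}"
  unfolding NP_eq
proof (rule cv.span_minimal)
  show "e ` P \<subseteq> cv.span {br x y |x y. x \<in> b \<and> y \<in> b}"
  proof
    fix x assume "x \<in> e ` P"
    then obtain \<alpha> where \<alpha>: "\<alpha> \<in> P" "x = e \<alpha>" by auto
    then obtain t where t: "t \<in> h" "\<alpha> t \<noteq> 0"
      using dual_separated[of \<alpha> 0] P_dual subspace_dual_of by fastforce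
    have x: "(1 / \<alpha> t) *\<^sub>C br t x = x" using e_in[OF \<alpha>(1)] \<alpha> t
      by (simp add: root_space_def scaleC_scaleC)
    have "br t x \<in> {br x y |x y. x \<in> b \<and> y \<in> b}"
      using t \<alpha> h_subset_b NP_subset_b e_in root_space_subset_NP by blast
    from cv.span_scale[OF cv.span_base[OF this], of "1 / \<alpha> t"]
    show "x \<in> cv.span {br x y |x y. x \<in> b \<and> y \<in> b}" unfolding x .
  qed
qed simp

section \<open>Projection along the Borel subalgebra and the semidirect bracket\<close>

lemma proj_unique: assumes "y \<in> N" "z - y \<in> b" shows "pr z = y"
  unfolding proj_along_def
proof (rule the_equality)
  fix y' assume y': "y' \<in> N \<and> z - y' \<in> b"
  obtain a t a' t' where *: "a \<in> NP" "t \<in> h" "z - y = a + t" "a' \<in> NP" "t' \<in> h" "z - y' = a' + t'"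
    using assms y' unfolding borel_algebra_def by blast
  then have "a + t + y = a' + t' + y'" by (simp add: algebra_simps)
  then show "y' = y" using decomposition_unique[of a t y a' t' y'] * assms y' by auto
qed (use assms in auto)

lemma proj_N [simp]: "pr z \<in> N" and proj_b [simp]: "z - pr z \<in> b"
proof -
  obtain x t y where *: "x \<in> NP" "t \<in> h" "y \<in> N" "z = x + t + y" by (rule decomposition)
  then have "z - y \<in> b" unfolding borel_algebra_def by auto
  then have "pr z = y" using * proj_unique by blast
  then show "pr z \<in> N" "z - pr z \<in> b" using * \<open>z - y \<in> b\<close> by auto
qed

lemma proj_of_N [simp]: "y \<in> N \<Longrightarrow> pr y = y"
  by (rule proj_unique) (use cv.subspace_0[OF subspace_b] in auto)

lemma proj_of_b [simp]: "x \<in> b \<Longrightarrow> pr x = 0"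
  by (rule proj_unique) (use cv.subspace_0[OF subspace_N] in auto)

lemma proj_add [simp]: "pr (x + y) = pr x + pr y"
  by (rule proj_unique)
    (auto intro: cv.subspace_add[OF subspace_N] simp: add_diff_add intro!: cv.subspace_add[OF subspace_b])

lemma proj_scale [simp]: "pr (c *\<^sub>C x) = c *\<^sub>C pr x"
proof (rule proj_unique)
  show "c *\<^sub>C x - c *\<^sub>C pr x \<in> b"
    using cv.subspace_scale[OF subspace_b proj_b[of x], of c] by (simp add: cv.scale_right_diff_distrib)
qed (auto intro: cv.subspace_scale[OF subspace_N])

lemma clinear_proj: "clinear pr" by (rule clinearI) auto

lemma proj_diff [simp]: "pr (x - y) = pr x - pr y" using clinear_diff[OF clinear_proj] .
lemma proj_neg [simp]: "pr (- y) = - pr y" using clinear_neg[OF clinear_proj] .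
lemma proj_0 [simp]: "pr 0 = 0" using clinear_0[OF clinear_proj] .

text \<open>Since b is a subalgebra, it acts on the quotient by b, and the representative taken in
  \<open>N\<close> does not matter.\<close>

lemma proj_br_proj: "x \<in> b \<Longrightarrow> pr (br x (pr z)) = pr (br x z)"
  using proj_of_b[OF br_b[of x "z - pr z"]] by simp

text \<open>The bracket of the semidirect sum of b with its module g / b, regarded as an abelian
  ideal and transported to g by \<open>pr\<close>: the first term lies in b, the other two are the
  action of b on the quotient.\<close>

definition dbr :: "'g \<Rightarrow> 'g \<Rightarrow> 'g" where
  "dbr z z' = br (z - pr z) (z' - pr z') + pr (br (z - pr z) (pr z')) - pr (br (z' - pr z') (pr z))"

lemma proj_dbr: "pr (dbr z z') = pr (br (z - pr z) (pr z')) - pr (br (z' - pr z') (pr z))"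
  unfolding dbr_def using br_b[OF proj_b proj_b] by (simp del: br_simps(9,10))

lemma dbr_minus_proj: "dbr z z' - pr (dbr z z') = br (z - pr z) (z' - pr z')"
  unfolding proj_dbr by (simp add: dbr_def)

lemma bilinear_alt_dbr: "bilinear_alt dbr"
  unfolding bilinear_alt_def
  by (intro conjI allI clinearI)
    (simp_all add: dbr_def scaleC_add_right scaleC_add_left algebra_simps cv.scale_right_diff_distrib)

lemma lie_algebra_dbr: "lie_algebra dbr"
  unfolding lie_algebra_def
proof (intro conjI allI)
  fix x y z
  have pj: "pr (br u (pr (br v w))) = pr (br u (br v w))" if "u \<in> b" for u v w
    using proj_br_proj that .
  have *: "dbr x (dbr y z) = br (x - pr x) (br (y - pr y) (z - pr z))
     + pr (br (x - pr x) (br (y - pr y) (pr z))) - pr (br (x - pr x) (br (z - pr z) (pr y)))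
     - pr (br (br (y - pr y) (z - pr z)) (pr x))" for x y z
    unfolding dbr_def[of x] dbr_minus_proj unfolding proj_dbr
    by (simp only: br_simps(9) proj_diff pj[OF proj_b] add_diff_eq)
  \<comment> \<open>Here \<open>X\<close>, \<open>Y\<close>, \<open>Z\<close> stand for the parts in
    b and \<open>a\<close>, \<open>b\<close>, \<open>c\<close> for the parts in \<open>N\<close>.
    The former add up to the Jacobi identity; the terms in each of the latter cancel separately,
    because the quotient is a module over b.\<close>
  have key: "br X (br Y Z) + pr (br X (br Y c)) - pr (br X (br Z b)) - pr (br (br Y Z) a)
      + (br Y (br Z X) + pr (br Y (br Z a)) - pr (br Y (br X c)) - pr (br (br Z X) b))
      + (br Z (br X Y) + pr (br Z (br X b)) - pr (br Z (br Y a)) - pr (br (br X Y) c)) = 0" for X Y Z a b c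
    using jacobi[of X Y Z] by (simp only: jacobi_left[of _ _ a] jacobi_left[of _ _ b] jacobi_left[of _ _ c] proj_diff)
      (simp add: algebra_simps)
  show "dbr x (dbr y z) + dbr y (dbr z x) + dbr z (dbr x y) = 0"
    unfolding * by (rule key)
qed (rule bilinear_alt_dbr)

section \<open>Identification with the bracket prescribed on root vectors\<close>

definition dbr_spec :: "('g \<Rightarrow> 'g \<Rightarrow> 'g) \<Rightarrow> bool" where
  "dbr_spec br' \<longleftrightarrow> bilinear_alt br'
     \<and> (\<forall>t\<in>h. \<forall>\<alpha>\<in>P. br' t (f \<alpha>) = (- \<alpha> t) *\<^sub>C f \<alpha>)
     \<and> (\<forall>t\<in>h. \<forall>\<alpha>\<in>P. br' t (e \<alpha>) = \<alpha> t *\<^sub>C e \<alpha>)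
     \<and> (\<forall>t\<in>h. \<forall>t'\<in>h. br' t t' = 0)
     \<and> (\<forall>\<alpha>\<in>P. \<forall>\<beta>\<in>P. br' (f \<alpha>) (f \<beta>) = 0)
     \<and> (\<forall>\<alpha>\<in>P. \<forall>\<beta>\<in>P. br' (e \<alpha>) (e \<beta>) = br (e \<alpha>) (e \<beta>))
     \<and> (\<forall>\<alpha>\<in>P. \<forall>\<beta>\<in>P. br' (e \<alpha>) (f \<beta>) = (if \<beta> - \<alpha> \<in> P then br (e \<alpha>) (f \<beta>) else 0))"

text \<open>Root vectors and h span everything, so a vector of any further weight lies in the span
  of other weight spaces and must vanish. This locates a bracket of root vectors in the triangular
  decomposition by its weight alone.\<close>

lemma weights_exhaust:
  assumes "\<gamma> \<in> dual_of h" "x \<in> root_space br h \<gamma>" "x \<noteq> 0"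
  shows "\<gamma> = 0 \<or> \<gamma> \<in> P \<or> - \<gamma> \<in> P"
proof (rule ccontr)
  assume contr: "\<not> (\<gamma> = 0 \<or> \<gamma> \<in> P \<or> - \<gamma> \<in> P)"
  let ?Q = "insert 0 (P \<union> uminus ` P)"
  have "e ` P \<union> h \<union> f ` P \<subseteq> (\<Union>\<alpha>\<in>?Q. root_space br h \<alpha>)"
    using e_in f_in root_space_0 by auto
  then have "x \<in> cv.span (\<Union>\<alpha>\<in>?Q. root_space br h \<alpha>)"
    using span_root_vectors cv.span_mono by blast
  then have "x = 0" unfolding root_space_weight
  proof (rule weight_vector_in_span_other_weights[OF clinear_br])
    show "x \<in> weight_space h br \<gamma>" using assms(2) unfolding root_space_weight .
    show "\<gamma> \<notin> ?Q" using contr by (auto simp: image_iff)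
    have "insert \<gamma> ?Q \<subseteq> dual_of h" using P_dual subspace_dual_of assms(1) by auto
    then show "\<exists>s\<in>h. i s \<noteq> j s" if "i \<in> insert \<gamma> ?Q" "j \<in> insert \<gamma> ?Q" "i \<noteq> j" for i j
      using that by (intro dual_separated) blast+
  qed
  then show False using assms by simp
qed

lemma e_b [simp]: "\<alpha> \<in> P \<Longrightarrow> e \<alpha> \<in> b" and f_N [simp]: "\<alpha> \<in> P \<Longrightarrow> f \<alpha> \<in> N" and h_b [simp]: "t \<in> h \<Longrightarrow> t \<in> b"
  using e_in f_in root_space_subset_NP root_space_subset_N NP_subset_b h_subset_b by blast+

lemma dbr_spec_dbr: "dbr_spec dbr"
  unfolding dbr_spec_def
proof (intro conjI ballI)
  fix \<alpha> \<beta> assume a: "\<alpha> \<in> P" "\<beta> \<in> P"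
  let ?x = "br (e \<alpha>) (f \<beta>)"
  have x: "?x \<in> root_space br h (\<alpha> - \<beta>)" using br_root_space[OF e_in[OF a(1)] f_in[OF a(2)]] by simp
  \<comment> \<open>The bracket has weight \<alpha> - \<beta>. If \<beta> - \<alpha> is a positive
    root, it lies in \<open>N\<close>; otherwise, when nonzero, its weight is zero or a positive
    root, so it lies in b and \<open>pr\<close> annihilates it.\<close>
  have "pr ?x = (if \<beta> - \<alpha> \<in> P then ?x else 0)"
  proof (cases "\<beta> - \<alpha> \<in> P")
    case True
    then have "?x \<in> N" using root_space_subset_N[OF True] x by auto
    then show ?thesis using True by simp
  next
    case False
    show ?thesis
    proof (cases "?x = 0")
      case True
      then show ?thesis by simp
    next
      case nz: False
      have "\<alpha> - \<beta> = 0 \<or> \<alpha> - \<beta> \<in> P"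
        using weights_exhaust[OF _ x nz] P_dual a subspace_dual_of False by auto
      then have "?x \<in> b" using x root_space_0 root_space_subset_NP NP_subset_b h_subset_b by auto
      then show ?thesis using False by simp
    qed
  qed
  then show "dbr (e \<alpha>) (f \<beta>) = (if \<beta> - \<alpha> \<in> P then ?x else 0)" using a by (simp add: dbr_def)
next
  fix t \<alpha> assume a: "t \<in> h" "\<alpha> \<in> P"
  have "br t (f \<alpha>) = (- \<alpha>) t *\<^sub>C f \<alpha>" using f_in[OF a(2)] a(1) by (simp add: root_space_def)
  then show "dbr t (f \<alpha>) = (- \<alpha> t) *\<^sub>C f \<alpha>" using a by (simp add: dbr_def)
  have "br t (e \<alpha>) = \<alpha> t *\<^sub>C e \<alpha>" using e_in[OF a(2)] a(1) by (simp add: root_space_def)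
  then show "dbr t (e \<alpha>) = \<alpha> t *\<^sub>C e \<alpha>" using a by (simp add: dbr_def)
qed (simp_all add: bilinear_alt_dbr dbr_def h_abelian)

text \<open>The relations cover a mixed pair from the spanning set in one order only; the
  alternating law gives the opposite order, and linearity extends the equality in one argument after
  the other.\<close>

lemma dbr_spec_unique: assumes "dbr_spec br1" "dbr_spec br2" shows "br1 = br2"
proof -
  have lin: "clinear (br1 x)" "clinear (br2 x)" "clinear (\<lambda>x. br1 x y)" "clinear (\<lambda>x. br2 x y)" for x y
    using assms by (simp_all add: dbr_spec_def bilinear_alt_def)
  have "br' y x = - br' x y" if "dbr_spec br'" for br' x y
  proof -
    have l: "clinear (br' x)" "clinear (\<lambda>x. br' x y)" and z: "br' x x = 0" for x y
      using that by (simp_all add: dbr_spec_def bilinear_alt_def)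
    have "br' (x + y) (x + y) = (br' x x + br' y x) + (br' x y + br' y y)"
      unfolding clinear_add[OF l(1)] clinear_add[OF l(2)] ..
    then show ?thesis unfolding z by (simp add: eq_neg_iff_add_eq_0)
  qed
  note anti = this[OF assms(1)] this[OF assms(2)]
  let ?S = "e ` P \<union> h \<union> f ` P"
  have S: "br1 x y = br2 x y" if xy: "x \<in> ?S" "y \<in> ?S" for x y
  proof -
    have c: "t \<in> h \<Longrightarrow> \<alpha> \<in> P \<Longrightarrow> br1 t (f \<alpha>) = br2 t (f \<alpha>)" "t \<in> h \<Longrightarrow> \<alpha> \<in> P \<Longrightarrow> br1 t (e \<alpha>) = br2 t (e \<alpha>)"
      "t \<in> h \<Longrightarrow> t' \<in> h \<Longrightarrow> br1 t t' = br2 t t'" "\<alpha> \<in> P \<Longrightarrow> \<beta> \<in> P \<Longrightarrow> br1 (f \<alpha>) (f \<beta>) = br2 (f \<alpha>) (f \<beta>)"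
      "\<alpha> \<in> P \<Longrightarrow> \<beta> \<in> P \<Longrightarrow> br1 (e \<alpha>) (e \<beta>) = br2 (e \<alpha>) (e \<beta>)"
      "\<alpha> \<in> P \<Longrightarrow> \<beta> \<in> P \<Longrightarrow> br1 (e \<alpha>) (f \<beta>) = br2 (e \<alpha>) (f \<beta>)" for t t' \<alpha> \<beta>
      using assms by (simp_all add: dbr_spec_def)
    have swap: "br1 v u = br2 v u" if "br1 u v = br2 u v" for u v
      using that anti(1)[of v u] anti(2)[of v u] by simp
    show ?thesis using xy
      by (elim UnE imageE) (simp_all add: c swap[OF c(1)] swap[OF c(2)] swap[OF c(6)])
  qed
  have S': "br1 x y = br2 x y" if "x \<in> ?S" for x y
    by (rule cvp.linear_eq_on[OF lin(1,2)]) (use span_root_vectors S that in auto)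
  have "br1 x y = br2 x y" for x y
    by (rule cvp.linear_eq_on[OF lin(3,4)]) (use span_root_vectors S' in auto)
  then show ?thesis by blast
qed

lemma degenerate_bracket_eq: "degenerate_bracket br h P e f = dbr"
  unfolding degenerate_bracket_def dbr_spec_def[symmetric]
  using dbr_spec_dbr dbr_spec_unique by blast

end

section \<open>The associated graded space of a filtration\<close>

lemma functional_whole_iff: "functional whole \<psi> \<longleftrightarrow>
  (\<forall>x y. \<psi> (x + y) = \<psi> x + \<psi> y) \<and> (\<forall>c x. \<psi> (c *\<^sub>C x) = c * \<psi> x)"
  by (simp add: functional_def whole_def)

lemma functional_whole_sum:
  assumes "functional whole \<psi>" shows "\<psi> (sum g A) = (\<Sum>i\<in>A. \<psi> (g i))"
proof (induction A rule: infinite_finite_induct)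
  have "\<psi> (0 *\<^sub>C 0) = 0 * \<psi> 0" using assms unfolding functional_whole_iff by blast
  then have z: "\<psi> 0 = 0" by simp
  show "\<psi> (sum g A) = (\<Sum>i\<in>A. \<psi> (g i))" if "infinite A" for A using that z by simp
  show "\<psi> (sum g {}) = (\<Sum>i\<in>{}. \<psi> (g i))" using z by simp
qed (use assms[unfolded functional_whole_iff] in auto)

lemma linear_endo_whole_iff: "linear_endo whole T \<longleftrightarrow> clinear T"
proof
  assume "linear_endo whole T"
  then show "clinear T" by (intro clinearI) (auto simp: linear_endo_def whole_def)
next
  assume "clinear T"
  then show "linear_endo whole T"
    by (auto simp: linear_endo_def whole_def clinear_add clinear_scale)
qed

lemma cring_complex_ring: "cring complex_ring"
proof (rule cringI)
  show "abelian_group complex_ring"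
  proof (rule abelian_groupI)
    fix x assume "x \<in> carrier complex_ring"
    show "\<exists>y\<in>carrier complex_ring. y \<oplus>\<^bsub>complex_ring\<^esub> x = \<zero>\<^bsub>complex_ring\<^esub>"
      by (rule bexI[of _ "- x"]) (auto simp: complex_ring_def)
  qed (auto simp: complex_ring_def)
  show "comm_monoid complex_ring" by (rule comm_monoidI) (auto simp: complex_ring_def)
qed (auto simp: complex_ring_def algebra_simps)

text \<open>A finite dual basis, with the expansion required only under functionals; this suffices
  because matrix coefficients are all that continuity and \<open>is_exp\<close> refer to.\<close>

definition frame ::
  "(complex, 'w) module \<Rightarrow> 'i set \<Rightarrow> ('i \<Rightarrow> 'w) \<Rightarrow> ('i \<Rightarrow> 'w \<Rightarrow> complex) \<Rightarrow> bool" where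
  "frame M I u c \<longleftrightarrow> finite I \<and> (\<forall>i\<in>I. u i \<in> carrier M \<and> functional M (c i))
     \<and> (\<forall>\<psi> w. functional M \<psi> \<longrightarrow> w \<in> carrier M \<longrightarrow> \<psi> w = (\<Sum>i\<in>I. c i w * \<psi> (u i)))"

lemma finite_basis:
  assumes "fin_dim TYPE('v)"
  obtains S :: "'v::complex_vector set" and c :: "'v \<Rightarrow> 'v \<Rightarrow> complex"
  where "finite S" "\<And>x. functional whole (c x)" "\<And>w. w = (\<Sum>x\<in>S. c x w *\<^sub>C x)"
proof -
  obtain S0 :: "'v set" where S0: "finite S0" "cv.span S0 = UNIV" using assms by (auto simp: fin_dim_def)
  obtain S where S: "S \<subseteq> S0" "cv.independent S" "S0 \<subseteq> cv.span S"
    using cv.maximal_independent_subset by blast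
  have span: "cv.span S = UNIV" using S0(2) S(3) cv.span_minimal[of S0 "cv.span S"] by auto
  have fin: "finite S" using S(1) S0(1) finite_subset by blast
  show thesis
  proof (rule that[of S "\<lambda>x w. cv.representation S w x"])
    show "functional whole (\<lambda>w. cv.representation S w x)" for x
      using S(2) span by (simp add: functional_whole_iff cv.representation_add cv.representation_scale)
    show "w = (\<Sum>x\<in>S. cv.representation S w x *\<^sub>C x)" for w
      using cv.sum_representation_eq[OF S(2), of w S] span fin by simp
  qed (rule fin)
qed

lemma frame_whole:
  assumes "finite S" "\<And>x. functional whole (c x)" "\<And>w. w = (\<Sum>x\<in>S. c x w *\<^sub>C x)"
  shows "frame whole S (\<lambda>x. x) c"
proof -
  have "\<psi> w = (\<Sum>x\<in>S. c x w * \<psi> x)" if "functional whole \<psi>" for \<psi> w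
  proof -
    have "\<psi> w = \<psi> (\<Sum>x\<in>S. c x w *\<^sub>C x)" using assms(3)[of w] by simp
    also have "\<dots> = (\<Sum>x\<in>S. c x w * \<psi> x)"
      unfolding functional_whole_sum[OF that] using that by (simp add: functional_whole_iff)
    finally show ?thesis .
  qed
  then show ?thesis using assms by (simp add: frame_def whole_def)
qed

lemma projection_onto_subspace:
  fixes U :: "'v::complex_vector set"
  assumes "cv.subspace U"
  obtains q where "clinear q" "\<And>x. q x \<in> U" "\<And>x. x \<in> U \<Longrightarrow> q x = x"
proof -
  have "\<exists>g. range g \<subseteq> U \<and> clinear g \<and> (\<forall>v\<in>U. g v = v)"
    using cvp.linear_exists_left_inverse_on[of "id :: 'v \<Rightarrow> 'v" U] assms cv.linear_id by auto
  then show ?thesis using that by auto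
qed

locale filtration =
  fixes F :: "nat \<Rightarrow> 'v::complex_vector set" and m :: nat
  assumes fin_dim: "fin_dim TYPE('v)"
    and subspace_F: "cv.subspace (F s)"
    and F_mono: "F s \<subseteq> F (Suc s)"
    and F_m: "F m = UNIV"
begin

lemma subspace_prev: "cv.subspace (prev F s)"
  by (cases s) (auto simp: prev_def subspace_F)

lemma prev_subset: "prev F s \<subseteq> F s"
  using F_mono cv.subspace_0[OF subspace_F] by (cases s) (auto simp: prev_def)

lemma prev_Suc [simp]: "prev F (Suc s) = F s" and prev_0 [simp]: "prev F 0 = {0}"
  by (simp_all add: prev_def)

lemma prev_UNIV: assumes "s > m" shows "prev F s = UNIV"
proof -
  have "F (m + k) = UNIV" for k by (induction k) (use F_m F_mono in auto)
  then show ?thesis using assms by (auto simp: less_iff_Suc_add)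
qed

lemmas prev_closed =
  cv.subspace_0[OF subspace_prev] cv.subspace_add[OF subspace_prev] cv.subspace_diff[OF subspace_prev]
  cv.subspace_scale[OF subspace_prev] cv.subspace_neg[OF subspace_prev] cv.subspace_sum[OF subspace_prev]
lemma prev_diff_trans: "x - y \<in> prev F s \<Longrightarrow> y - z \<in> prev F s \<Longrightarrow> x - z \<in> prev F s"
  using prev_closed(2)[of "x - y" s "y - z"] by simp
lemmas F_closed =
  cv.subspace_0[OF subspace_F] cv.subspace_add[OF subspace_F] cv.subspace_diff[OF subspace_F]
  cv.subspace_scale[OF subspace_F] cv.subspace_neg[OF subspace_F] cv.subspace_sum[OF subspace_F]

section \<open>Graded elements as classes of families of representatives\<close>

definition sec :: "(nat \<Rightarrow> 'v) \<Rightarrow> bool" where "sec w \<longleftrightarrow> (\<forall>s. w s \<in> F s)"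

definition cls :: "(nat \<Rightarrow> 'v) \<Rightarrow> nat \<Rightarrow> 'v set" where "cls w = (\<lambda>s. {w s + u | u. u \<in> prev F s})"

lemma mem_cls: "x \<in> cls w s \<longleftrightarrow> x - w s \<in> prev F s"
proof
  assume "x - w s \<in> prev F s"
  moreover have "x = w s + (x - w s)" by simp
  ultimately show "x \<in> cls w s" unfolding cls_def by blast
qed (auto simp: cls_def)

lemma cls_eq_iff: "cls w = cls w' \<longleftrightarrow> (\<forall>s. w s - w' s \<in> prev F s)"
proof
  assume eq: "cls w = cls w'"
  have "w s \<in> cls w s" for s unfolding mem_cls by (simp add: prev_closed)
  then show "\<forall>s. w s - w' s \<in> prev F s" unfolding eq mem_cls by blast
next
  assume *: "\<forall>s. w s - w' s \<in> prev F s"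
  have "x - w s \<in> prev F s \<longleftrightarrow> x - w' s \<in> prev F s" for x s
    using prev_closed(2)[of "x - w s" s "w s - w' s"] prev_closed(3)[of "x - w' s" s "w s - w' s"] * by auto
  then show "cls w = cls w'" by (intro ext Set.set_eqI) (simp add: mem_cls)
qed

lemma cls_eqI: "(\<And>s. w s - w' s \<in> prev F s) \<Longrightarrow> cls w = cls w'"
  by (simp add: cls_eq_iff)

text \<open>The finiteness condition in \<open>gr\<close> holds by itself, because all quotients
  above degree \<open>m\<close> vanish; every family of representatives therefore defines an
  element.\<close>

lemma carrier_gr: "carrier (gr F) = cls ` Collect sec"
proof
  show "carrier (gr F) \<subseteq> cls ` Collect sec"
  proof
    fix a assume "a \<in> carrier (gr F)"
    then have "\<forall>s. \<exists>x. x \<in> F s \<and> a s = {x + u |u. u \<in> prev F s}"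
      unfolding gr_def by auto
    from choice[OF this] obtain w where "\<forall>s. w s \<in> F s \<and> a s = {w s + u |u. u \<in> prev F s}" by blast
    then show "a \<in> cls ` Collect sec" by (intro image_eqI[of _ _ w]) (auto simp: cls_def sec_def)
  qed
  have "finite {s. cls w s \<noteq> prev F s}" for w
  proof (rule finite_subset)
    have "cls w s = prev F s" if "s > m" for s using prev_UNIV[OF that] by (auto simp: mem_cls)
    then show "{s. cls w s \<noteq> prev F s} \<subseteq> {..m}" by (auto simp: not_le[symmetric])
  qed simp
  then show "cls ` Collect sec \<subseteq> carrier (gr F)"
    unfolding gr_def by (auto simp: sec_def cls_def)
qed

lemma carrier_grE: assumes "a \<in> carrier (gr F)" obtains w where "sec w" "a = cls w"
  using assms by (auto simp: carrier_gr)

lemma cls_carrier [simp]: "sec w \<Longrightarrow> cls w \<in> carrier (gr F)" by (simp add: carrier_gr)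

lemma add_gr: "cls w \<oplus>\<^bsub>gr F\<^esub> cls w' = cls (\<lambda>s. w s + w' s)"
proof (intro ext Set.set_eqI iffI)
  fix s x assume "x \<in> (cls w \<oplus>\<^bsub>gr F\<^esub> cls w') s"
  then obtain y z where "y - w s \<in> prev F s" "z - w' s \<in> prev F s" "x = y + z"
    unfolding gr_def by (auto simp: mem_cls)
  then show "x \<in> cls (\<lambda>s. w s + w' s) s"
    using prev_closed(2)[of "y - w s" s "z - w' s"] by (simp add: mem_cls add_diff_add)
next
  fix s x assume "x \<in> cls (\<lambda>s. w s + w' s) s"
  then have "x - w' s \<in> cls w s" "w' s \<in> cls w' s" "x = (x - w' s) + w' s"
    by (simp_all add: mem_cls diff_diff_add add.commute prev_closed)
  then show "x \<in> (cls w \<oplus>\<^bsub>gr F\<^esub> cls w') s" unfolding gr_def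
    by (simp, intro exI[of _ "x - w' s"] exI[of _ "w' s"], simp)
qed

lemma smult_gr: "c \<odot>\<^bsub>gr F\<^esub> cls w = cls (\<lambda>s. c *\<^sub>C w s)"
proof (intro ext Set.set_eqI iffI)
  fix s x assume "x \<in> (c \<odot>\<^bsub>gr F\<^esub> cls w) s"
  then obtain y u where "y - w s \<in> prev F s" "u \<in> prev F s" "x = c *\<^sub>C y + u"
    unfolding gr_def by (auto simp: mem_cls)
  then show "x \<in> cls (\<lambda>s. c *\<^sub>C w s) s"
    using prev_closed(2)[of "c *\<^sub>C (y - w s)" s u] prev_closed(4)[of "y - w s" s c]
    by (simp add: mem_cls cv.scale_right_diff_distrib algebra_simps)
next
  fix s x assume "x \<in> cls (\<lambda>s. c *\<^sub>C w s) s"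
  then have "w s \<in> cls w s" "x - c *\<^sub>C w s \<in> prev F s" "x = c *\<^sub>C w s + (x - c *\<^sub>C w s)"
    by (simp_all add: mem_cls prev_closed)
  then show "x \<in> (c \<odot>\<^bsub>gr F\<^esub> cls w) s" unfolding gr_def
    by (simp, intro exI[of _ "w s"] exI[of _ "x - c *\<^sub>C w s"], simp)
qed

lemma zero_gr: "\<zero>\<^bsub>gr F\<^esub> = cls (\<lambda>_. 0)"
  by (auto simp: gr_def cls_def)

lemma sec_closed: "sec (\<lambda>_. 0)" "sec w \<Longrightarrow> sec w' \<Longrightarrow> sec (\<lambda>s. w s + w' s)" "sec w \<Longrightarrow> sec (\<lambda>s. c *\<^sub>C w s)"
  "sec w \<Longrightarrow> sec (\<lambda>s. - w s)"
  by (simp_all add: sec_def F_closed)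

lemma module_gr: "Module.module complex_ring (gr F)"
proof (rule moduleI[OF cring_complex_ring])
  show "abelian_group (gr F)"
  proof (rule abelian_groupI)
    fix x assume "x \<in> carrier (gr F)"
    then obtain w where "sec w" "x = cls w" by (rule carrier_grE)
    then show "\<exists>y\<in>carrier (gr F). y \<oplus>\<^bsub>gr F\<^esub> x = \<zero>\<^bsub>gr F\<^esub>"
      by (intro bexI[of _ "cls (\<lambda>s. - w s)"]) (simp_all add: add_gr zero_gr sec_closed)
  qed (auto elim!: carrier_grE simp: add_gr zero_gr sec_closed algebra_simps)
qed (auto elim!: carrier_grE simp: add_gr smult_gr sec_closed complex_ring_def
    scaleC_add_left scaleC_add_right scaleC_scaleC scaleC_one)

lemma minus_gr: assumes "sec w" "sec w'" shows "cls w \<ominus>\<^bsub>gr F\<^esub> cls w' = cls (\<lambda>s. w s - w' s)"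
proof -
  interpret M: abelian_group "gr F" using module_gr by (rule Module.module.axioms)
  have "\<ominus>\<^bsub>gr F\<^esub> cls w' = cls (\<lambda>s. - w' s)"
    by (rule M.minus_equality) (use assms in \<open>simp_all add: add_gr zero_gr sec_closed\<close>)
  then show ?thesis by (simp add: a_minus_def add_gr)
qed

text \<open>Computations in \<open>gr F\<close> are done on families of representatives; these are the linear maps on
  such families that descend to \<open>gr F\<close>.\<close>

definition graded_op :: "((nat \<Rightarrow> 'v) \<Rightarrow> (nat \<Rightarrow> 'v)) \<Rightarrow> bool" where
  "graded_op \<Phi> \<longleftrightarrow> (\<forall>w. sec w \<longrightarrow> sec (\<Phi> w))
     \<and> (\<forall>w. (\<forall>s. w s \<in> prev F s) \<longrightarrow> (\<forall>s. \<Phi> w s \<in> prev F s))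
     \<and> (\<forall>w w'. \<Phi> (\<lambda>s. w s + w' s) = (\<lambda>s. \<Phi> w s + \<Phi> w' s))
     \<and> (\<forall>c w. \<Phi> (\<lambda>s. c *\<^sub>C w s) = (\<lambda>s. c *\<^sub>C \<Phi> w s))"

definition lift :: "((nat \<Rightarrow> 'v) \<Rightarrow> (nat \<Rightarrow> 'v)) \<Rightarrow> (nat \<Rightarrow> 'v set) \<Rightarrow> (nat \<Rightarrow> 'v set)" where
  "lift \<Phi> a = cls (\<Phi> (SOME w. sec w \<and> a = cls w))"

lemma graded_op_prev: "graded_op \<Phi> \<Longrightarrow> (\<And>s. w s \<in> prev F s) \<Longrightarrow> \<Phi> w s \<in> prev F s"
  by (simp add: graded_op_def)

lemma lift_cls: assumes "graded_op \<Phi>" "sec w" shows "lift \<Phi> (cls w) = cls (\<Phi> w)"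
proof -
  define w' where "w' = (SOME w'. sec w' \<and> cls w = cls w')"
  have "sec w' \<and> cls w = cls w'" unfolding w'_def
    using someI[of "\<lambda>w'. sec w' \<and> cls w = cls w'" w] assms by simp
  \<comment> \<open>Subtraction is written as adding a multiple by -1, since
    \<open>graded_op\<close> speaks only of sums and scalar multiples.\<close>
  then have *: "\<forall>s. w' s + (-1) *\<^sub>C w s \<in> prev F s" using cls_eq_iff[of w' w] by simp
  have "\<Phi> w' s - \<Phi> w s = \<Phi> (\<lambda>s. w' s + (-1) *\<^sub>C w s) s" for s
    using assms(1) unfolding graded_op_def by (simp del: cv.scale_minus_left) simp
  also have "\<dots> s \<in> prev F s" for s
    by (rule graded_op_prev[OF assms(1)]) (use * in auto)
  finally show ?thesis unfolding lift_def w'_def[symmetric] by (intro cls_eqI)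
qed

lemma graded_op_sec: "graded_op \<Phi> \<Longrightarrow> sec w \<Longrightarrow> sec (\<Phi> w)" by (simp add: graded_op_def)

lemma graded_op_comp: "graded_op \<Phi> \<Longrightarrow> graded_op \<Psi> \<Longrightarrow> graded_op (\<lambda>w. \<Phi> (\<Psi> w))"
  unfolding graded_op_def by simp

lemma linear_endo_lift: assumes "graded_op \<Phi>" shows "linear_endo (gr F) (lift \<Phi>)"
  using assms unfolding linear_endo_def
  by (auto elim!: carrier_grE simp: lift_cls add_gr smult_gr sec_closed graded_op_sec)
     (simp_all add: graded_op_def)

definition shift :: "nat \<Rightarrow> ('v \<Rightarrow> 'v) \<Rightarrow> (nat \<Rightarrow> 'v) \<Rightarrow> (nat \<Rightarrow> 'v)" where
  "shift d T w s = (if s < d then 0 else T (w (s - d)))"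

lemma prev_shift:
  assumes "clinear T" "\<And>s. T ` F s \<subseteq> F (s + d)" "x \<in> prev F s" shows "T x \<in> prev F (s + d)"
  using assms clinear_0[OF assms(1)] by (cases s) (auto simp: prev_closed)

lemma graded_op_shift:
  assumes "clinear T" "\<And>s. T ` F s \<subseteq> F (s + d)" shows "graded_op (shift d T)"
proof -
  have "sec (shift d T w)" if "sec w" for w
    unfolding sec_def
  proof
    fix s show "shift d T w s \<in> F s"
      using that assms(2)[of "s - d"] by (cases "s < d") (auto simp: shift_def sec_def F_closed)
  qed
  moreover have "shift d T w s \<in> prev F s" if "\<forall>s. w s \<in> prev F s" for w s
    using prev_shift[OF assms, of "w (s - d)" "s - d"] that by (auto simp: shift_def prev_closed)
  ultimately show ?thesis unfolding graded_op_def
    by (auto simp: shift_def fun_eq_iff clinear_add[OF assms(1)] clinear_scale[OF assms(1)])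
qed

lemma gr_map_cls:
  assumes "clinear T" "\<And>s. T ` F s \<subseteq> F (s + d)" "sec w"
  shows "gr_map F d T (cls w) = cls (shift d T w)"
proof (intro ext Set.set_eqI)
  fix s x
  show "x \<in> gr_map F d T (cls w) s \<longleftrightarrow> x \<in> cls (shift d T w) s"
  proof (cases "s < d")
    case True
    then show ?thesis by (auto simp: gr_map_def shift_def cls_def)
  next
    case False
    have "x \<in> {T y + u |y u. y \<in> cls w (s - d) \<and> u \<in> prev F s} \<longleftrightarrow> x - T (w (s - d)) \<in> prev F s"
    proof
      assume "x \<in> {T y + u |y u. y \<in> cls w (s - d) \<and> u \<in> prev F s}"
      then obtain y u where *: "y - w (s - d) \<in> prev F (s - d)" "u \<in> prev F s" "x = T y + u"
        by (auto simp: mem_cls)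
      have "T (y - w (s - d)) \<in> prev F s" using prev_shift[OF assms(1,2) *(1)] False by simp
      from prev_closed(2)[OF this *(2)] show "x - T (w (s - d)) \<in> prev F s"
        unfolding *(3) clinear_diff[OF assms(1)] by (simp add: algebra_simps)
    next
      assume "x - T (w (s - d)) \<in> prev F s"
      moreover have "w (s - d) \<in> cls w (s - d)" by (simp add: mem_cls prev_closed)
      moreover have "x = T (w (s - d)) + (x - T (w (s - d)))" by simp
      ultimately show "x \<in> {T y + u |y u. y \<in> cls w (s - d) \<and> u \<in> prev F s}" by blast
    qed
    then show ?thesis using False by (simp add: gr_map_def shift_def mem_cls)
  qed
qed

text \<open>In each degree the functional pulls back to \<open>F s\<close>; composing with a linear
  projection onto \<open>F s\<close> extends it to the whole space, where the matrix coefficients of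
  the original module are at hand.\<close>

lemma functional_gr_decompose:
  assumes \<psi>: "functional (gr F) \<psi>"
  obtains \<Psi> where "\<And>s. functional whole (\<Psi> s)" "\<And>w. sec w \<Longrightarrow> \<psi> (cls w) = (\<Sum>s\<le>m. \<Psi> s (w s))"
    "\<And>s u. u \<in> F s \<Longrightarrow> \<Psi> s u = \<psi> (cls (\<lambda>r. if r = s then u else 0))"
proof -
  let ?\<iota> = "\<lambda>s u r. if r = s then u else (0::'v)"
  have "\<exists>q. clinear q \<and> (\<forall>x. q x \<in> F s) \<and> (\<forall>x\<in>F s. q x = x)" for s
    using projection_onto_subspace[OF subspace_F[of s]] by metis
  then obtain q where q: "\<And>s. clinear (q s)" "\<And>s x. q s x \<in> F s" "\<And>s x. x \<in> F s \<Longrightarrow> q s x = x"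
    by metis
  have sec: "sec (?\<iota> s u)" if "u \<in> F s" for s u using that by (simp add: sec_def F_closed)
  have add: "\<psi> (cls w) + \<psi> (cls w') = \<psi> (cls (\<lambda>s. w s + w' s))" if "sec w" "sec w'" for w w'
    using \<psi> that unfolding functional_def by (simp add: add_gr[symmetric])
  have scale: "\<psi> (cls (\<lambda>s. c *\<^sub>C w s)) = c * \<psi> (cls w)" if "sec w" for w c
    using \<psi> that unfolding functional_def by (simp add: smult_gr[symmetric])
  define \<Psi> where "\<Psi> s u = \<psi> (cls (?\<iota> s (q s u)))" for s u
  have f: "functional whole (\<Psi> s)" for s
    unfolding functional_whole_iff \<Psi>_def
  proof (intro conjI allI)
    fix x y show "\<psi> (cls (?\<iota> s (q s (x + y)))) = \<psi> (cls (?\<iota> s (q s x))) + \<psi> (cls (?\<iota> s (q s y)))"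
      unfolding add[OF sec[OF q(2)] sec[OF q(2)]] clinear_add[OF q(1)]
      by (rule arg_cong[of _ _ "\<lambda>w. \<psi> (cls w)"]) auto
  next
    fix c x show "\<psi> (cls (?\<iota> s (q s (c *\<^sub>C x)))) = c * \<psi> (cls (?\<iota> s (q s x)))"
      unfolding scale[OF sec[OF q(2)], symmetric] clinear_scale[OF q(1)]
      by (rule arg_cong[of _ _ "\<lambda>w. \<psi> (cls w)"]) auto
  qed
  have "\<psi> (cls w) = (\<Sum>s\<le>m. \<Psi> s (w s))" if w: "sec w" for w
  proof -
    \<comment> \<open>Induction on the truncation of the family. Cutting it off above degree
      \<open>m\<close> does not change the class, because \<open>prev F s\<close> is everything
      there.\<close>
    have "\<psi> (cls (\<lambda>s. if s < n then w s else 0)) = (\<Sum>s<n. \<Psi> s (w s))" for n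
    proof (induction n)
      case 0
      have "\<psi> (cls (\<lambda>_. 0)) = 0" using scale[OF sec_closed(1), of 0] by simp
      then show ?case by simp
    next
      case (Suc n)
      have s: "sec (\<lambda>s. if s < n then w s else 0)" using w by (simp add: sec_def F_closed)
      have "(\<Sum>s<Suc n. \<Psi> s (w s)) = \<psi> (cls (\<lambda>s. if s < n then w s else 0)) + \<psi> (cls (?\<iota> n (w n)))"
        using Suc w by (simp add: \<Psi>_def q(3) sec_def cong: if_cong)
      also have "\<dots> = \<psi> (cls (\<lambda>s. (if s < n then w s else 0) + ?\<iota> n (w n) s))"
        using add s sec w by (simp add: sec_def)
      also have "(\<lambda>s. (if s < n then w s else 0) + ?\<iota> n (w n) s) = (\<lambda>s. if s < Suc n then w s else 0)"
        by (auto simp: less_Suc_eq)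
      finally show ?case by simp
    qed
    from this[of "Suc m"] have "\<psi> (cls (\<lambda>s. if s < Suc m then w s else 0)) = (\<Sum>s\<le>m. \<Psi> s (w s))"
      by (simp add: lessThan_Suc_atMost)
    moreover have "cls (\<lambda>s. if s < Suc m then w s else 0) = cls w"
      by (rule cls_eqI) (use prev_UNIV in \<open>auto simp: prev_closed\<close>)
    ultimately show ?thesis by simp
  qed
  then show thesis using q(3) by (intro that[of \<Psi>] f) (auto simp: \<Psi>_def cong: if_cong)
qed

text \<open>Coordinates must not depend on the representative. Subtracting a linear projection onto
  \<open>prev F s\<close> gives \<open>\<kappa> s\<close>, which annihilates
  \<open>prev F s\<close>; coordinates of the original space are then applied to the result. The
  vectors obtained may be dependent, which \<open>frame\<close> permits.\<close>

lemma frame_gr: "\<exists>(I :: (nat \<times> 'v) set) u c. frame (gr F) I u c"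
proof -
  obtain S :: "'v set" and r where S: "finite S" "\<And>x. functional whole (r x)"
    "\<And>w. w = (\<Sum>x\<in>S. r x w *\<^sub>C x)" using finite_basis[OF fin_dim] by blast
  let ?\<iota> = "\<lambda>s u r. if r = s then u else (0::'v)"
  have "\<exists>q. clinear q \<and> (\<forall>x. q x \<in> F s) \<and> (\<forall>x\<in>F s. q x = x)" for s
    using projection_onto_subspace[OF subspace_F[of s]] by metis
  then obtain q where q: "\<And>s. clinear (q s)" "\<And>s x. q s x \<in> F s" "\<And>s x. x \<in> F s \<Longrightarrow> q s x = x"
    by metis
  have "\<exists>q. clinear q \<and> (\<forall>x. q x \<in> prev F s) \<and> (\<forall>x\<in>prev F s. q x = x)" for s
    using projection_onto_subspace[OF subspace_prev[of s]] by metis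
  then obtain q' where q': "\<And>s. clinear (q' s)" "\<And>s x. q' s x \<in> prev F s" "\<And>s x. x \<in> prev F s \<Longrightarrow> q' s x = x"
    by metis
  define \<kappa> where "\<kappa> s x = x - q' s x" for s x
  have \<kappa>F: "\<kappa> s x \<in> F s" if "x \<in> F s" for s x
    unfolding \<kappa>_def using that q'(2)[of s x] prev_subset[of s] F_closed(3) by blast
  have \<kappa>_lin: "clinear (\<kappa> s)" for s
    by (rule clinearI) (simp_all add: \<kappa>_def clinear_add[OF q'(1)] clinear_scale[OF q'(1)]
        cv.scale_right_diff_distrib)
  define c where "c = (\<lambda>(s, x) a. r x (\<kappa> s (SOME y. y \<in> a s)))"
  have c: "c (s, x) (cls w) = r x (\<kappa> s (w s))" for s x w
  proof -
    have "w s \<in> cls w s" by (simp add: mem_cls prev_closed)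
    then have "(SOME y. y \<in> cls w s) \<in> cls w s" by (rule someI)
    then have "\<kappa> s ((SOME y. y \<in> cls w s) - w s) = 0" by (simp add: mem_cls \<kappa>_def q'(3))
    then show ?thesis by (simp add: c_def clinear_diff[OF \<kappa>_lin])
  qed
  have "frame (gr F) ({..m} \<times> S) (\<lambda>(s, x). cls (?\<iota> s (q s x))) c"
    unfolding frame_def
  proof (intro conjI ballI allI impI)
    show "finite ({..m} \<times> S)" using S by simp
    show "(case i of (s, x) \<Rightarrow> cls (?\<iota> s (q s x))) \<in> carrier (gr F)" for i
      using q(2) by (auto split: prod.splits intro!: cls_carrier simp: sec_def F_closed)
    show "functional (gr F) (c i)" for i
      unfolding functional_def
      by (cases i) (auto elim!: carrier_grE simp: add_gr smult_gr c clinear_add[OF \<kappa>_lin]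
          clinear_scale[OF \<kappa>_lin] S(2)[unfolded functional_whole_iff])
    fix \<psi> a assume \<psi>: "functional (gr F) \<psi>" and "a \<in> carrier (gr F)"
    then obtain w where w: "sec w" "a = cls w" by (elim carrier_grE)
    obtain \<Psi> where \<Psi>: "\<And>s. functional whole (\<Psi> s)" "\<And>w. sec w \<Longrightarrow> \<psi> (cls w) = (\<Sum>s\<le>m. \<Psi> s (w s))"
      "\<And>s u. u \<in> F s \<Longrightarrow> \<Psi> s u = \<psi> (cls (?\<iota> s u))"
      using functional_gr_decompose[OF \<psi>] by blast
    have eq: "cls w = cls (\<lambda>s. \<kappa> s (w s))" by (rule cls_eqI) (simp add: \<kappa>_def q'(2))
    have "\<psi> a = (\<Sum>s\<le>m. \<Psi> s (\<kappa> s (w s)))"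
      unfolding w(2) eq using w(1) \<kappa>F by (intro \<Psi>(2)) (simp add: sec_def)
    also have "\<dots> = (\<Sum>s\<le>m. \<Sum>x\<in>S. c (s, x) a * \<psi> (cls (?\<iota> s (q s x))))"
    proof (rule sum.cong[OF refl])
      fix s
      \<comment> \<open>The vectors of \<open>S\<close> need not lie in \<open>F s\<close>; applying
        \<open>q s\<close> to the expansion moves each of them there without changing the left
        side.\<close>
      have "\<kappa> s (w s) = q s (\<Sum>x\<in>S. r x (\<kappa> s (w s)) *\<^sub>C x)"
        using S(3)[of "\<kappa> s (w s)"] q(3)[OF \<kappa>F] w(1) by (simp add: sec_def)
      then have "\<Psi> s (\<kappa> s (w s)) = \<Psi> s (\<Sum>x\<in>S. r x (\<kappa> s (w s)) *\<^sub>C q s x)"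
        by (simp add: clinear_sum[OF q(1)] clinear_scale[OF q(1)])
      also have "\<dots> = (\<Sum>x\<in>S. r x (\<kappa> s (w s)) * \<Psi> s (q s x))"
        using \<Psi>(1)[of s] by (simp add: functional_whole_sum functional_whole_iff)
      finally show "\<Psi> s (\<kappa> s (w s)) = (\<Sum>x\<in>S. c (s, x) a * \<psi> (cls (?\<iota> s (q s x))))"
        by (simp add: w(2) c \<Psi>(3)[OF q(2)])
    qed
    finally show "\<psi> a = (\<Sum>i\<in>{..m} \<times> S. c i a * \<psi> (case i of (s, x) \<Rightarrow> cls (?\<iota> s (q s x))))"
      by (simp add: sum.cartesian_product case_prod_beta)
  qed
  then show ?thesis by blast
qed

section \<open>Operators of degree one and their exponentials\<close>

definition raising :: "('v \<Rightarrow> 'v) \<Rightarrow> bool" where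
  "raising T \<longleftrightarrow> clinear T \<and> (\<forall>s. T ` F s \<subseteq> F (Suc s))"

lemma clinear_pow: fixes T :: "'v \<Rightarrow> 'v" shows "clinear T \<Longrightarrow> clinear (T ^^ k)"
proof (induction k)
  case 0
  then show ?case by (intro clinearI) simp_all
next
  case (Suc k)
  then show ?case by (intro clinearI) (simp_all add: clinear_add clinear_scale)
qed

lemma raising_pow: "raising T \<Longrightarrow> u \<in> F r \<Longrightarrow> (T ^^ k) u \<in> F (r + k)"
  by (induction k) (auto simp: raising_def)

lemma raising_prev: "raising T \<Longrightarrow> u \<in> prev F r \<Longrightarrow> T u \<in> prev F (Suc r)"
  using prev_shift[of T 1 u r] by (simp add: raising_def)

lemma raising_pow_prev: "raising T \<Longrightarrow> u \<in> prev F r \<Longrightarrow> (T ^^ k) u \<in> prev F (r + k)"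
  by (induction k) (simp, simp add: raising_prev del: prev_Suc)

text \<open>The difference of the next powers is \<open>T\<close> applied to the previous
  difference, which stays in lower degree, plus the difference of \<open>T\<close> and
  \<open>T'\<close> applied to a power of \<open>T'\<close>, and that difference does not raise
  degrees. So both operators induce the same powers on the graded space.\<close>

lemma raising_pow_cong:
  assumes "raising T" "raising T'" "\<And>s u. u \<in> F s \<Longrightarrow> T u - T' u \<in> F s" "u \<in> F r"
  shows "(T ^^ k) u - (T' ^^ k) u \<in> prev F (r + k)"
proof (induction k)
  case 0
  then show ?case by (simp add: prev_closed)
next
  case (Suc k)
  have "T ((T ^^ k) u - (T' ^^ k) u) \<in> prev F (Suc (r + k))" using raising_prev[OF assms(1) Suc] .
  moreover have "T ((T' ^^ k) u) - T' ((T' ^^ k) u) \<in> prev F (Suc (r + k))"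
    using assms(3) raising_pow[OF assms(2,4)] by simp
  moreover have "clinear T" using assms(1) by (simp add: raising_def)
  ultimately show ?case
    using prev_closed(2)[of "T ((T ^^ k) u - (T' ^^ k) u)" "Suc (r + k)" "T ((T' ^^ k) u) - T' ((T' ^^ k) u)"]
    by (simp add: clinear_diff)
qed

text \<open>The commutator of two operators of degree one is assumed to have degree one instead of
  two, hence it vanishes on the graded space; each exchange with a factor \<open>T\<close> leaves
  such an error.\<close>

lemma raising_pow_commute:
  assumes "raising T" "raising T'" "\<And>s u. u \<in> F s \<Longrightarrow> T (T' u) - T' (T u) \<in> F (Suc s)" "u \<in> F r"
  shows "T' ((T ^^ k) u) - (T ^^ k) (T' u) \<in> prev F (Suc (r + k))"
proof (induction k)
  case 0
  then show ?case using F_closed(1) by simp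
next
  case (Suc k)
  have lin: "clinear T" using assms(1) by (simp add: raising_def)
  have "T (T' ((T ^^ k) u)) - T' (T ((T ^^ k) u)) \<in> F (Suc (r + k))"
    using assms(3) raising_pow[OF assms(1,4)] by simp
  moreover have "T (T' ((T ^^ k) u) - (T ^^ k) (T' u)) \<in> F (Suc (r + k))"
    using raising_prev[OF assms(1) Suc] by simp
  ultimately have "T (T' ((T ^^ k) u) - (T ^^ k) (T' u)) - (T (T' ((T ^^ k) u)) - T' (T ((T ^^ k) u)))
     \<in> F (Suc (r + k))" by (rule F_closed(3)[rotated])
  then show ?case by (simp add: clinear_diff[OF lin])
qed

text \<open>The binomial theorem for operators that commute modulo lower degree: the usual
  induction, with the errors of all exchanges collected in \<open>prev\<close>.\<close>

lemma raising_binomial: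
  assumes "raising T" "raising T'" "\<And>s u. u \<in> F s \<Longrightarrow> T (T' u) - T' (T u) \<in> F (Suc s)" "u \<in> F r"
  shows "((\<lambda>x. T x + T' x) ^^ k) u - (\<Sum>j\<le>k. of_nat (k choose j) *\<^sub>C (T ^^ j) ((T' ^^ (k - j)) u))
    \<in> prev F (r + k)"
proof (induction k)
  case 0
  then show ?case by (simp add: prev_closed scaleC_one)
next
  case (Suc k)
  have lin: "clinear T" "clinear T'" using assms(1,2) by (simp_all add: raising_def)
  let ?U = "\<lambda>x. T x + T' x"
  have U: "raising ?U" unfolding raising_def
  proof
    show "clinear ?U"
      by (rule clinearI) (simp_all add: clinear_add[OF lin(1)] clinear_add[OF lin(2)] clinear_scale[OF lin(1)]
          clinear_scale[OF lin(2)] scaleC_add_right)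
    show "\<forall>s. ?U ` F s \<subseteq> F (Suc s)"
      using assms(1,2) unfolding raising_def by (intro allI image_subsetI F_closed(2)) blast+
  qed
  let ?g = "\<lambda>i j. (T ^^ i) ((T' ^^ j) u)"
  let ?c = "\<lambda>j. of_nat (k choose j) :: complex"
  let ?S = "\<Sum>j\<le>k. ?c j *\<^sub>C ?g j (k - j)"
  have 1: "?U ((?U ^^ k) u) - ?U ?S \<in> prev F (r + Suc k)"
    using raising_prev[OF U Suc] by (simp add: clinear_diff[OF lin(1)] clinear_diff[OF lin(2)] add_diff_add)
  have "?U ?S = (\<Sum>j\<le>k. ?c j *\<^sub>C ?g (Suc j) (k - j)) + (\<Sum>j\<le>k. ?c j *\<^sub>C T' (?g j (k - j)))"
    by (simp add: clinear_sum[OF lin(1)] clinear_sum[OF lin(2)] clinear_scale[OF lin(1)] clinear_scale[OF lin(2)])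
  moreover have "(\<Sum>j\<le>k. ?c j *\<^sub>C T' (?g j (k - j))) - (\<Sum>j\<le>k. ?c j *\<^sub>C ?g j (Suc (k - j))) \<in> prev F (r + Suc k)"
    unfolding sum_subtractf[symmetric] cv.scale_right_diff_distrib[symmetric]
  proof (intro prev_closed(6) prev_closed(4))
    fix j assume "j \<in> {..k}"
    then have "r + (k - j) + j = r + k" by simp
    then show "T' (?g j (k - j)) - ?g j (Suc (k - j)) \<in> prev F (r + Suc k)"
      using raising_pow_commute[OF assms(1-3) raising_pow[OF assms(2,4)], of j "k - j"] by simp
  qed
  ultimately have 2: "?U ?S - ((\<Sum>j\<le>k. ?c j *\<^sub>C ?g (Suc j) (k - j)) + (\<Sum>j\<le>k. ?c j *\<^sub>C ?g j (Suc (k - j))))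
     \<in> prev F (r + Suc k)" by (simp add: add_diff_add)
  \<comment> \<open>Pascal's rule. Shifting the index isolates the term with \<open>j = 0\<close>,
    and the coefficient \<open>k choose Suc k\<close> that appears at the top is zero.\<close>
  have 3: "(\<Sum>j\<le>Suc k. of_nat (Suc k choose j) *\<^sub>C ?g j (Suc k - j))
    = (\<Sum>j\<le>k. ?c j *\<^sub>C ?g (Suc j) (k - j)) + (\<Sum>j\<le>k. ?c j *\<^sub>C ?g j (Suc (k - j)))"
  proof -
    have "(\<Sum>j\<le>Suc k. of_nat (Suc k choose j) *\<^sub>C ?g j (Suc k - j))
      = ?g 0 (Suc k) + (\<Sum>j\<le>k. of_nat (k choose Suc j) *\<^sub>C ?g (Suc j) (k - j)) + (\<Sum>j\<le>k. ?c j *\<^sub>C ?g (Suc j) (k - j))"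
      by (subst sum.atMost_Suc_shift) (simp add: scaleC_one scaleC_add_left sum.distrib add_ac)
    moreover have "?g 0 (Suc k) + (\<Sum>j\<le>k. of_nat (k choose Suc j) *\<^sub>C ?g (Suc j) (k - j))
      = (\<Sum>j\<le>Suc k. ?c j *\<^sub>C ?g j (Suc k - j))"
      by (subst sum.atMost_Suc_shift) (simp add: scaleC_one)
    moreover have "\<dots> = (\<Sum>j\<le>k. ?c j *\<^sub>C ?g j (Suc (k - j)))"
      by (simp add: Suc_diff_le)
    ultimately show ?thesis by (simp add: add_ac)
  qed
  show ?case unfolding 3 using prev_diff_trans[OF 1 2] by simp
qed

text \<open>The exponential of the map induced by \<open>T\<close> on \<open>gr F\<close>, a finite sum in each degree.\<close>

definition expo :: "('v \<Rightarrow> 'v) \<Rightarrow> (nat \<Rightarrow> 'v) \<Rightarrow> (nat \<Rightarrow> 'v)" where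
  "expo T w s = (\<Sum>k\<le>s. (1 / fact k) *\<^sub>C (T ^^ k) (w (s - k)))"

lemma graded_op_expo: assumes "raising T" shows "graded_op (expo T)"
proof -
  have lin: "clinear (T ^^ k)" for k using assms clinear_pow by (simp add: raising_def)
  have "(T ^^ k) (w (s - k)) \<in> F s" if "sec w" "k \<le> s" for w k s
    using raising_pow[OF assms, of "w (s - k)" "s - k" k] that by (simp add: sec_def)
  moreover have "(T ^^ k) (w (s - k)) \<in> prev F s" if "\<forall>s. w s \<in> prev F s" "k \<le> s" for w k s
    using raising_pow_prev[OF assms, of "w (s - k)" "s - k" k] that by simp
  ultimately show ?thesis
    unfolding graded_op_def sec_def expo_def
    by (auto intro!: F_closed(4,6) prev_closed(4,6) simp: sec_def clinear_add[OF lin] clinear_scale[OF lin]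
        scaleC_add_right sum.distrib cv.scale_sum_right scaleC_scaleC mult.commute)
qed

lemma expo_cong:
  assumes "raising T" "raising T'" "\<And>s u. u \<in> F s \<Longrightarrow> T u - T' u \<in> F s" "sec w"
  shows "cls (expo T w) = cls (expo T' w)"
proof (rule cls_eqI)
  fix s
  show "expo T w s - expo T' w s \<in> prev F s"
    unfolding expo_def sum_subtractf[symmetric] cv.scale_right_diff_distrib[symmetric]
  proof (intro prev_closed(6) prev_closed(4))
    fix k assume "k \<in> {..s}"
    then show "(T ^^ k) (w (s - k)) - (T' ^^ k) (w (s - k)) \<in> prev F s"
      using raising_pow_cong[OF assms(1-3), of "w (s - k)" "s - k" k] assms(4) by (simp add: sec_def)
  qed
qed

lemma expo_add:
  assumes "raising T" "raising T'" "\<And>s u. u \<in> F s \<Longrightarrow> T (T' u) - T' (T u) \<in> F (Suc s)" "sec w"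
  shows "cls (expo (\<lambda>x. T x + T' x) w) = cls (expo T (expo T' w))"
proof (rule cls_eqI)
  fix s
  let ?U = "\<lambda>x. T x + T' x"
  have lin: "clinear (T ^^ k)" for k using assms(1) clinear_pow by (simp add: raising_def)
  let ?g = "\<lambda>j i. (1 / (fact j * fact i)) *\<^sub>C (T ^^ j) ((T' ^^ i) (w (s - (j + i))))"
  have "expo T (expo T' w) s = (\<Sum>j\<le>s. \<Sum>i\<le>s - j. ?g j i)"
    unfolding expo_def
    by (intro sum.cong refl) (simp add: clinear_sum[OF lin] clinear_scale[OF lin] cv.scale_sum_right scaleC_scaleC)
  also have "\<dots> = (\<Sum>(j, i)\<in>{(j, i). j + i \<le> s}. ?g j i)"
    by (subst sum.Sigma) (auto intro!: sum.cong)
  \<comment> \<open>The two truncations together allow exactly \<open>j + i \<le> s\<close>, so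
    regrouping by the total power \<open>k\<close> leaves no terms over, and
    \<open>1 / (fact j * fact i)\<close> becomes a binomial coefficient divided by
    \<open>fact k\<close>.\<close>
  also have "\<dots> = (\<Sum>k\<le>s. \<Sum>j\<le>k. ?g j (k - j))" by (rule sum.triangle_reindex_eq)
  also have "\<dots> = (\<Sum>k\<le>s. (1 / fact k) *\<^sub>C (\<Sum>j\<le>k. of_nat (k choose j) *\<^sub>C (T ^^ j) ((T' ^^ (k - j)) (w (s - k)))))"
    unfolding cv.scale_sum_right scaleC_scaleC
    by (intro sum.cong refl) (simp add: binomial_fact)
  finally have eq: "expo T (expo T' w) s = \<dots>" .
  show "expo ?U w s - expo T (expo T' w) s \<in> prev F s"
    unfolding eq unfolding expo_def sum_subtractf[symmetric] cv.scale_right_diff_distrib[symmetric]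
  proof (intro prev_closed(6) prev_closed(4))
    fix k assume "k \<in> {..s}"
    then show "(?U ^^ k) (w (s - k))
      - (\<Sum>j\<le>k. of_nat (k choose j) *\<^sub>C (T ^^ j) ((T' ^^ (k - j)) (w (s - k)))) \<in> prev F s"
      using raising_binomial[OF assms(1-3), of "w (s - k)" "s - k" k] assms(4) by (simp add: sec_def)
  qed
qed

lemma expo_conj:
  assumes "clinear S" "\<And>u. S (T u) = T' (S u)"
  shows "S (expo T w s) = expo T' (\<lambda>r. S (w r)) s"
proof -
  have "S ((T ^^ k) u) = (T' ^^ k) (S u)" for k u by (induction k) (simp_all add: assms(2))
  then show ?thesis by (simp add: expo_def clinear_sum[OF assms(1)] clinear_scale[OF assms(1)])
qed

end

section \<open>Matrix coefficients and one-parameter groups of operators\<close>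

lemma functional_whole_compose: "functional whole \<psi> \<Longrightarrow> clinear S \<Longrightarrow> functional whole (\<lambda>u. \<psi> (S u))"
  by (simp add: functional_whole_iff clinear_add clinear_scale)

lemma functional_compose:
  "functional M \<psi> \<Longrightarrow> linear_endo M S \<Longrightarrow> functional M (\<lambda>u. \<psi> (S u))"
  by (simp add: functional_def linear_endo_def Pi_iff)

text \<open>Convergence is seen only through functionals, so the composition is expanded like a
  matrix product: its coefficient is a finite sum of coefficients of \<open>T t\<close> times
  coefficients of \<open>S t\<close>.\<close>

lemma tendsto_coefficient_compose:
  fixes S T :: "'b \<Rightarrow> 'v::complex_vector \<Rightarrow> 'v"
  assumes fd: "fin_dim TYPE('v)" and \<psi>: "functional whole \<psi>" and lin: "\<And>t. clinear (S t)" "clinear S0"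
    and S: "\<And>\<psi> u. functional whole \<psi> \<Longrightarrow> ((\<lambda>t. \<psi> (S t u)) \<longlongrightarrow> \<psi> (S0 u)) Fl"
    and T: "\<And>\<psi> u. functional whole \<psi> \<Longrightarrow> ((\<lambda>t. \<psi> (T t u)) \<longlongrightarrow> \<psi> (T0 u)) Fl"
  shows "((\<lambda>t. \<psi> (S t (T t u))) \<longlongrightarrow> \<psi> (S0 (T0 u))) Fl"
proof -
  obtain B :: "'v set" and c where B: "finite B" "\<And>x. functional whole (c x)" "\<And>w. w = (\<Sum>x\<in>B. c x w *\<^sub>C x)"
    using finite_basis[OF fd] by blast
  have fr: "frame whole B (\<lambda>x. x) c" using frame_whole[OF B] .
  have eq: "\<psi> (R w) = (\<Sum>x\<in>B. c x w * \<psi> (R x))" if "clinear R" for R w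
    using fr functional_whole_compose[OF \<psi> that] unfolding frame_def by (auto simp: whole_def)
  have "((\<lambda>t. \<Sum>x\<in>B. c x (T t u) * \<psi> (S t x)) \<longlongrightarrow> (\<Sum>x\<in>B. c x (T0 u) * \<psi> (S0 x))) Fl"
    by (intro tendsto_sum tendsto_mult T[OF B(2)] S[OF \<psi>])
  then show ?thesis
    by (simp only: eq[OF lin(1), where w = "T t u" for t, symmetric] eq[OF lin(2), where w = "T0 u", symmetric])
qed

text \<open>The product rule, by the same expansion as for limits.\<close>

lemma derivative_coefficient_compose:
  fixes S T :: "real \<Rightarrow> 'v::complex_vector \<Rightarrow> 'v"
  assumes fd: "fin_dim TYPE('v)" and \<psi>: "functional whole \<psi>" and lin: "\<And>t. clinear (S t)" "clinear S'"
    and S: "\<And>\<psi> u. functional whole \<psi> \<Longrightarrow> ((\<lambda>t. \<psi> (S t u)) has_vector_derivative \<psi> (S' u)) (at 0)"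
    and T: "\<And>\<psi> u. functional whole \<psi> \<Longrightarrow> ((\<lambda>t. \<psi> (T t u)) has_vector_derivative \<psi> (T' u)) (at 0)"
  shows "((\<lambda>t. \<psi> (S t (T t u))) has_vector_derivative \<psi> (S 0 (T' u) + S' (T 0 u))) (at 0)"
proof -
  obtain B :: "'v set" and c where B: "finite B" "\<And>x. functional whole (c x)" "\<And>w. w = (\<Sum>x\<in>B. c x w *\<^sub>C x)"
    using finite_basis[OF fd] by blast
  have fr: "frame whole B (\<lambda>x. x) c" using frame_whole[OF B] .
  have eq: "\<psi> (R w) = (\<Sum>x\<in>B. c x w * \<psi> (R x))" if "clinear R" for R w
    using fr functional_whole_compose[OF \<psi> that] unfolding frame_def by (auto simp: whole_def)
  have "\<psi> (S 0 (T' u) + S' (T 0 u)) = (\<Sum>x\<in>B. c x (T 0 u) * \<psi> (S' x) + c x (T' u) * \<psi> (S 0 x))"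
    using \<psi> eq[OF lin(1), where w = "T' u"] eq[OF lin(2), where w = "T 0 u"]
    unfolding functional_whole_iff by (simp add: sum.distrib)
  moreover have "((\<lambda>t. \<Sum>x\<in>B. c x (T t u) * \<psi> (S t x)) has_vector_derivative
      (\<Sum>x\<in>B. c x (T 0 u) * \<psi> (S' x) + c x (T' u) * \<psi> (S 0 x))) (at 0)"
    by (intro has_vector_derivative_sum has_vector_derivative_mult T[OF B(2)] S[OF \<psi>])
  ultimately show ?thesis
    by (simp only: eq[OF lin(1), where w = "T t u" for t, symmetric])
qed

lemma funpow_scaled_module:
  assumes M: "Module.module complex_ring M" and A: "linear_endo M A" and w: "w \<in> carrier M"
    and B: "\<And>x. x \<in> carrier M \<Longrightarrow> B x = c \<odot>\<^bsub>M\<^esub> A x"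
  shows "(A ^^ k) w \<in> carrier M" "(B ^^ k) w = c ^ k \<odot>\<^bsub>M\<^esub> (A ^^ k) w"
proof -
  interpret M: Module.module complex_ring M by (rule M)
  show *: "(A ^^ k) w \<in> carrier M" for k
    by (induction k) (use w A in \<open>auto simp: linear_endo_def\<close>)
  have A_scale: "A (d \<odot>\<^bsub>M\<^esub> x) = d \<odot>\<^bsub>M\<^esub> A x" if "x \<in> carrier M" for d x
    using A that by (auto simp: linear_endo_def)
  have Ac: "A x \<in> carrier M" if "x \<in> carrier M" for x using A that by (auto simp: linear_endo_def)
  have smult: "d \<odot>\<^bsub>M\<^esub> (d' \<odot>\<^bsub>M\<^esub> x) = (d * d') \<odot>\<^bsub>M\<^esub> x" "d \<odot>\<^bsub>M\<^esub> x \<in> carrier M" if "x \<in> carrier M" for d d' x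
    using M.smult_assoc1[of d d' x] M.smult_closed[of d x] that by (simp_all add: complex_ring_def)
  have one: "1 \<odot>\<^bsub>M\<^esub> x = x" if "x \<in> carrier M" for x
    using M.smult_one[of x] that by (simp add: complex_ring_def)
  show "(B ^^ k) w = c ^ k \<odot>\<^bsub>M\<^esub> (A ^^ k) w"
  proof (induction k)
    case 0
    then show ?case using w by (simp add: one)
  next
    case (Suc k)
    then show ?case using *[of k] B A_scale smult Ac by (simp add: ac_simps)
  qed
qed

text \<open>Lagrange's form of the remainder is a statement about real functions, so it is applied
  to real and imaginary parts separately; the remainder is at most
  \<open>C * ((R * \<bar>t\<bar>) ^ n / fact n)\<close>.\<close>

lemma Maclaurin_series_complex:
  fixes \<phi> :: "nat \<Rightarrow> real \<Rightarrow> complex"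
  assumes deriv: "\<And>k t. (\<phi> k has_vector_derivative \<phi> (Suc k) t) (at t)"
    and bound: "\<And>k t. \<bar>t\<bar> \<le> T \<Longrightarrow> norm (\<phi> k t) \<le> C * R ^ k" and t: "\<bar>t\<bar> \<le> T" and R: "R \<ge> 0"
  shows "(\<lambda>k. of_real t ^ k * \<phi> k 0 / fact k) sums \<phi> 0 t"
proof -
  have rem: "(\<lambda>n. C * ((R * \<bar>t\<bar>) ^ n / fact n)) \<longlonglongrightarrow> C * 0"
    by (intro tendsto_mult tendsto_const summable_LIMSEQ_zero)
      (use summable_exp_generic[of "R * \<bar>t\<bar>"] in \<open>simp add: field_simps scaleR_conv_of_real\<close>)
  have main: "(\<lambda>k. t ^ k * g (\<phi> k 0) / fact k) sums g (\<phi> 0 t)"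
    if g: "bounded_linear g" "\<And>z. \<bar>g z\<bar> \<le> norm z" for g :: "complex \<Rightarrow> real"
  proof -
    have d: "\<forall>k s. DERIV (\<lambda>s. g (\<phi> k s)) s :> g (\<phi> (Suc k) s)"
      using bounded_linear.has_vector_derivative[OF g(1) deriv]
      by (simp add: has_real_derivative_iff_has_vector_derivative)
    have "\<bar>(\<Sum>k<n. t ^ k * g (\<phi> k 0) / fact k) - g (\<phi> 0 t)\<bar> \<le> C * ((R * \<bar>t\<bar>) ^ n / fact n)" for n
    proof -
      obtain s where s: "\<bar>s\<bar> \<le> \<bar>t\<bar>"
        "g (\<phi> 0 t) = (\<Sum>k<n. g (\<phi> k 0) / fact k * t ^ k) + g (\<phi> n s) / fact n * t ^ n"
        using Maclaurin_all_le[of "\<lambda>k s. g (\<phi> k s)" "\<lambda>s. g (\<phi> 0 s)" t n] d by auto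
      have "\<bar>(\<Sum>k<n. t ^ k * g (\<phi> k 0) / fact k) - g (\<phi> 0 t)\<bar> = \<bar>g (\<phi> n s)\<bar> * \<bar>t\<bar> ^ n / fact n"
        using s(2) by (simp add: abs_mult power_abs mult.commute)
      also have "\<dots> \<le> (C * R ^ n) * \<bar>t\<bar> ^ n / fact n"
        using g(2)[of "\<phi> n s"] bound[of s n] s(1) t
        by (intro divide_right_mono mult_right_mono) auto
      finally show ?thesis by (simp add: power_mult_distrib mult.assoc)
    qed
    then have "(\<lambda>n. (\<Sum>k<n. t ^ k * g (\<phi> k 0) / fact k) - g (\<phi> 0 t)) \<longlonglongrightarrow> 0"
      by (intro Lim_null_comparison[OF _ rem[simplified]]) (auto intro!: always_eventually)
    then show ?thesis unfolding sums_def by (rule LIM_zero_cancel)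
  qed
  have "(\<lambda>k. Complex (t ^ k * Re (\<phi> k 0) / fact k) (t ^ k * Im (\<phi> k 0) / fact k)) sums
    Complex (Re (\<phi> 0 t)) (Im (\<phi> 0 t))"
    using main[OF bounded_linear_Re abs_Re_le_cmod] main[OF bounded_linear_Im abs_Im_le_cmod]
    by (simp add: sums_complex_iff)
  moreover have "Complex (t ^ k * Re z / fact k) (t ^ k * Im z / fact k) = of_real t ^ k * z / fact k" for k z
  proof -
    have "of_real t ^ k * z / fact k = of_real (t ^ k / fact k) * z" by simp
    then show ?thesis by (simp add: complex_eq_iff del: of_real_divide)
  qed
  ultimately show ?thesis by simp
qed

text \<open>The matrix coefficients are smooth, with \<open>k\<close>-th derivatives bounded by \<open>C R\<^sup>k\<close> on bounded
  intervals, so they are given by their Maclaurin series.\<close>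

lemma one_parameter_group_is_exp:
  fixes U :: "real \<Rightarrow> 'w \<Rightarrow> 'w"
  assumes M: "Module.module complex_ring M" and fr: "frame M (I :: 'i set) b c"
    and U: "\<And>t. linear_endo M (U t)" "\<And>s t w. w \<in> carrier M \<Longrightarrow> U (s + t) w = U s (U t w)"
      "\<And>w. w \<in> carrier M \<Longrightarrow> U 0 w = w"
    and A: "linear_endo M A"
    and deriv: "\<And>\<psi> w. functional M \<psi> \<Longrightarrow> w \<in> carrier M \<Longrightarrow>
       ((\<lambda>t. \<psi> (U t w)) has_vector_derivative \<psi> (A w)) (at 0)"
    and B: "\<And>w. w \<in> carrier M \<Longrightarrow> B w = of_real t \<odot>\<^bsub>M\<^esub> A w"
  shows "is_exp M B (U t)"
  unfolding is_exp_def
proof (intro ballI conjI allI impI)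
  fix w assume w: "w \<in> carrier M"
  show "U t w \<in> carrier M" using U(1)[of t] w by (auto simp: linear_endo_def)
  fix \<psi> assume \<psi>: "functional M \<psi>"
  have Ak: "(A ^^ k) w \<in> carrier M" for k using funpow_scaled_module(1)[OF M A w B] .
  have Uc: "U s x \<in> carrier M" if "x \<in> carrier M" for s x using U(1)[of s] that by (auto simp: linear_endo_def)
  have fin: "finite I" and bc: "\<And>i. i \<in> I \<Longrightarrow> b i \<in> carrier M" and cf: "\<And>i. i \<in> I \<Longrightarrow> functional M (c i)"
    and ex: "\<And>\<psi> w. functional M \<psi> \<Longrightarrow> w \<in> carrier M \<Longrightarrow> \<psi> w = (\<Sum>i\<in>I. c i w * \<psi> (b i))"
    using fr by (auto simp: frame_def)
  \<comment> \<open>The group law reduces a derivative at \<open>s\<close> to one at 0, because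
    \<open>\<psi>\<close> composed with \<open>U s\<close> is again a functional.\<close>
  have deriv': "((\<lambda>t. \<psi> (U t x)) has_vector_derivative \<psi> (U s (A x))) (at s)" if x: "x \<in> carrier M" for s x
  proof -
    have "((\<lambda>t. \<psi> (U s (U t x))) has_vector_derivative \<psi> (U s (A x))) (at 0)"
      by (rule deriv[OF functional_compose[OF \<psi> U(1)] x])
    then have "((\<lambda>t. \<psi> (U (t + s) x)) has_vector_derivative \<psi> (U s (A x))) (at 0)"
      by (simp add: U(2)[OF x, of s, symmetric] add.commute)
    then have "((\<lambda>t. \<psi> (U (t + s) x)) \<circ> (\<lambda>t. t - s) has_vector_derivative 1 *\<^sub>R \<psi> (U s (A x))) (at s)"
      by (intro vector_diff_chain_at) (auto intro!: derivative_eq_intros)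
    then show ?thesis by (simp add: o_def)
  qed
  \<comment> \<open>The sum of the absolute values of the matrix entries of \<open>A\<close> in the
    frame; it bounds the growth of the coordinates under \<open>A\<close>.\<close>
  define R where "R = (\<Sum>i\<in>I. \<Sum>j\<in>I. norm (c i (A (b j))))"
  have R0: "R \<ge> 0" by (simp add: R_def sum_nonneg)
  have cbound: "(\<Sum>i\<in>I. norm (c i ((A ^^ k) w))) \<le> (\<Sum>i\<in>I. norm (c i w)) * R ^ k" for k
  proof (induction k)
    case (Suc k)
    let ?x = "(A ^^ k) w"
    have "norm (c i (A ?x)) \<le> (\<Sum>j\<in>I. norm (c j ?x) * norm (c i (A (b j))))" if "i \<in> I" for i
      unfolding ex[OF functional_compose[OF cf[OF that] A] Ak[of k]]
      by (rule order.trans[OF norm_sum]) (simp add: norm_mult)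
    then have "(\<Sum>i\<in>I. norm (c i (A ?x))) \<le> (\<Sum>i\<in>I. \<Sum>j\<in>I. norm (c j ?x) * norm (c i (A (b j))))"
      by (rule sum_mono)
    also have "\<dots> \<le> (\<Sum>i\<in>I. \<Sum>j\<in>I. (\<Sum>l\<in>I. norm (c l ?x)) * norm (c i (A (b j))))"
      by (intro sum_mono mult_right_mono member_le_sum) (use fin in auto)
    also have "\<dots> = (\<Sum>l\<in>I. norm (c l ?x)) * R" by (simp add: R_def sum_distrib_left)
    also have "\<dots> \<le> (\<Sum>i\<in>I. norm (c i w)) * R ^ k * R" by (rule mult_right_mono[OF Suc R0])
    finally show ?case by (simp add: mult.assoc mult.commute)
  qed simp
  define \<phi> where "\<phi> k s = \<psi> (U s ((A ^^ k) w))" for k s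
  \<comment> \<open>Expanding in the frame leaves finitely many continuous functions, one for each
    frame vector, to be bounded on a compact interval.\<close>
  have "\<exists>K. \<forall>s\<in>{-\<bar>t\<bar>..\<bar>t\<bar>}. norm (\<psi> (U s (b i))) \<le> K" if "i \<in> I" for i
  proof -
    have "continuous_on {-\<bar>t\<bar>..\<bar>t\<bar>} (\<lambda>s. \<psi> (U s (b i)))"
      by (intro continuous_at_imp_continuous_on ballI has_vector_derivative_continuous[OF deriv'[OF bc[OF that]]])
    then have "bounded ((\<lambda>s. \<psi> (U s (b i))) ` {-\<bar>t\<bar>..\<bar>t\<bar>})"
      by (intro compact_imp_bounded compact_continuous_image) auto
    then show ?thesis unfolding bounded_iff by auto
  qed
  then obtain K where K: "\<And>i s. i \<in> I \<Longrightarrow> s \<in> {-\<bar>t\<bar>..\<bar>t\<bar>} \<Longrightarrow> norm (\<psi> (U s (b i))) \<le> K i" by metis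
  have bound: "norm (\<phi> k s) \<le> ((\<Sum>i\<in>I. norm (c i w)) * (\<Sum>i\<in>I. \<bar>K i\<bar>)) * R ^ k" if s: "\<bar>s\<bar> \<le> \<bar>t\<bar>" for k s
  proof -
    have "norm (\<phi> k s) \<le> (\<Sum>i\<in>I. norm (c i ((A ^^ k) w)) * norm (\<psi> (U s (b i))))"
      unfolding \<phi>_def ex[OF functional_compose[OF \<psi> U(1)] Ak]
      by (rule order.trans[OF norm_sum]) (simp add: norm_mult)
    also have "\<dots> \<le> (\<Sum>i\<in>I. norm (c i ((A ^^ k) w)) * (\<Sum>i\<in>I. \<bar>K i\<bar>))"
    proof (intro sum_mono mult_left_mono)
      fix i assume i: "i \<in> I"
      have "norm (\<psi> (U s (b i))) \<le> \<bar>K i\<bar>" using K[OF i, of s] s abs_le_iff[of s "\<bar>t\<bar>"] by force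
      also have "\<dots> \<le> (\<Sum>i\<in>I. \<bar>K i\<bar>)" by (rule member_le_sum) (use i fin in auto)
      finally show "norm (\<psi> (U s (b i))) \<le> (\<Sum>i\<in>I. \<bar>K i\<bar>)" .
    qed auto
    also have "\<dots> = (\<Sum>i\<in>I. norm (c i ((A ^^ k) w))) * (\<Sum>i\<in>I. \<bar>K i\<bar>)" by (simp add: sum_distrib_right)
    also have "\<dots> \<le> ((\<Sum>i\<in>I. norm (c i w)) * R ^ k) * (\<Sum>i\<in>I. \<bar>K i\<bar>)"
      by (rule mult_right_mono[OF cbound]) (simp add: sum_nonneg)
    finally show ?thesis by (simp add: ac_simps)
  qed
  have "(\<lambda>k. of_real t ^ k * \<phi> k 0 / fact k) sums \<phi> 0 t"
    by (rule Maclaurin_series_complex[OF _ bound _ R0]) (auto simp: \<phi>_def intro!: deriv'[OF Ak])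
  moreover have "\<psi> ((B ^^ k) w) = of_real t ^ k * \<phi> k 0" for k
  proof -
    have "(B ^^ k) w = of_real t ^ k \<odot>\<^bsub>M\<^esub> (A ^^ k) w" by (rule funpow_scaled_module(2)[OF M A w B])
    then show ?thesis using \<psi> Ak[of k] by (simp add: functional_def \<phi>_def U(3))
  qed
  ultimately show "(\<lambda>k. \<psi> ((B ^^ k) w) / fact k) sums \<psi> (U t w)" by (simp add: \<phi>_def)
qed

section \<open>Complex Lie groups\<close>

lemma complex_differentiable_at_compose:
  assumes "complex_differentiable_at f x" "complex_differentiable_at g (f x)"
  shows "complex_differentiable_at (\<lambda>x. g (f x)) x"
proof -
  obtain D E where "(f has_derivative D) (at x)" "\<forall>c u. D (c *\<^sub>C u) = c *\<^sub>C D u"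
    "(g has_derivative E) (at (f x))" "\<forall>c u. E (c *\<^sub>C u) = c *\<^sub>C E u"
    using assms unfolding complex_differentiable_at_def by blast
  then have "((\<lambda>x. g (f x)) has_derivative (\<lambda>u. E (D u))) (at x) \<and> (\<forall>c u. E (D (c *\<^sub>C u)) = c *\<^sub>C E (D u))"
    using diff_chain_at[of f D x g E] by (simp add: o_def)
  then show ?thesis unfolding complex_differentiable_at_def by blast
qed

lemma has_derivative_cong_eventually:
  assumes "(f has_derivative D) (at x)" "\<forall>\<^sub>F y in nhds x. f y = g y"
  shows "(g has_derivative D) (at x)"
  using assms has_derivative_transform_eventually[of f D x UNIV g] eventually_nhds_x_imp_x[OF assms(2)]
  by (simp add: eventually_nhds_conv_at)

lemma complex_differentiable_at_cong_eventually:
  assumes "complex_differentiable_at f x" "\<forall>\<^sub>F y in nhds x. f y = g y"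
  shows "complex_differentiable_at g x"
  using assms has_derivative_cong_eventually unfolding complex_differentiable_at_def by metis

lemma complex_differentiable_at_Pair:
  "complex_differentiable_at (\<lambda>b. (a, b)) x" "complex_differentiable_at (\<lambda>b. (b, a)) x"
proof -
  have "((\<lambda>b. (a, b)) has_derivative (\<lambda>u. (0, u))) (at x)" "((\<lambda>b. (b, a)) has_derivative (\<lambda>u. (u, 0))) (at x)"
    by (auto intro!: derivative_eq_intros)
  then show "complex_differentiable_at (\<lambda>b. (a, b)) x" "complex_differentiable_at (\<lambda>b. (b, a)) x"
    unfolding complex_differentiable_at_def by (auto intro!: exI simp: scaleC_prod_def)
qed

lemma has_vector_derivative_compose:
  fixes \<gamma> :: "real \<Rightarrow> 'a::real_normed_vector"
  assumes "(\<gamma> has_vector_derivative v) (at t)" "(f has_derivative D) (at (\<gamma> t))"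
  shows "((\<lambda>s. f (\<gamma> s)) has_vector_derivative D v) (at t)"
proof -
  have "((\<lambda>s. f (\<gamma> s)) has_derivative (\<lambda>u. D (u *\<^sub>R v))) (at t)"
    using diff_chain_at[OF assms(1)[unfolded has_vector_derivative_def] assms(2)] by (simp add: o_def)
  moreover have "D (u *\<^sub>R v) = u *\<^sub>R D v" for u
    using linear_scale[OF has_derivative_linear[OF assms(2)]] .
  ultimately show ?thesis by (simp add: has_vector_derivative_def)
qed

lemma has_vector_derivative_cong_eventually:
  assumes "(f has_vector_derivative D) (at x)" "\<forall>\<^sub>F y in nhds x. f y = g y"
  shows "(g has_vector_derivative D) (at x)"
  using has_derivative_cong_eventually assms unfolding has_vector_derivative_def by blast

locale lie_group_setup =
  fixes br :: "'g::complex_vector \<Rightarrow> 'g \<Rightarrow> 'g"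
    and G :: "('a, 'n::finite) cgroup"
    and k :: "'a set \<times> ('a \<Rightarrow> complex ^ 'n)"
    and \<theta> :: "'g \<Rightarrow> complex ^ 'n"
  assumes slg: "simple_lie_group G br k \<theta>"
begin

abbreviation "X \<equiv> gtop G"
abbreviation "k0 \<equiv> snd k \<one>\<^bsub>G\<^esub>"

lemma clg: "complex_lie_group G" and hla: "has_lie_algebra G br k \<theta>"
  using slg by (simp_all add: simple_lie_group_def)

lemma group_G: "group G" and topspace_G: "topspace X = carrier G"
  and complex_atlas: "complex_atlas X (atlas G)"
  using clg by (simp_all add: complex_lie_group_def)

sublocale group G by (rule group_G)

lemma continuous_mult: assumes "continuous_map Y X f" "continuous_map Y X g"
  shows "continuous_map Y X (\<lambda>y. f y \<otimes>\<^bsub>G\<^esub> g y)"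
proof -
  have "continuous_map (prod_topology X X) X (\<lambda>(x, y). x \<otimes>\<^bsub>G\<^esub> y)"
    using clg by (simp add: complex_lie_group_def)
  from continuous_map_compose[OF continuous_map_pairedI[OF assms] this] show ?thesis by (simp add: o_def)
qed

lemma continuous_mult_const: assumes "g \<in> carrier G" "continuous_map Y X f"
  shows "continuous_map Y X (\<lambda>y. g \<otimes>\<^bsub>G\<^esub> f y)" "continuous_map Y X (\<lambda>y. f y \<otimes>\<^bsub>G\<^esub> g)"
  using assms by (auto intro!: continuous_mult simp: topspace_G)

lemma k_atlas: "k \<in> atlas G" and one_chart: "\<one>\<^bsub>G\<^esub> \<in> fst k"
  and clinear_\<theta>: "clinear \<theta>" and bij_\<theta>: "bij \<theta>"
  using hla by (simp_all add: has_lie_algebra_def)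

abbreviation "\<theta>i \<equiv> inv_into UNIV \<theta>"

lemma \<theta>_inv [simp]: "\<theta> (\<theta>i u) = u" "\<theta>i (\<theta> x) = x"
  using bij_\<theta> by (simp_all add: bij_is_surj surj_f_inv_f bij_is_inj inv_f_f)

lemma chart:
  assumes "l \<in> atlas G"
  shows "openin X (fst l)" "fst l \<subseteq> carrier G" "open (snd l ` fst l)"
    "homeomorphic_map (subtopology X (fst l)) (top_of_set (snd l ` fst l)) (snd l)"
    "inj_on (snd l) (fst l)" "\<And>x. x \<in> fst l \<Longrightarrow> chart_inv l (snd l x) = x"
    "\<And>a. a \<in> snd l ` fst l \<Longrightarrow> chart_inv l a \<in> fst l \<and> snd l (chart_inv l a) = a"
proof -
  have *: "openin X (fst l) \<and> open (snd l ` fst l) \<and>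
     homeomorphic_map (subtopology X (fst l)) (top_of_set (snd l ` fst l)) (snd l)"
    using complex_atlas assms unfolding complex_atlas_def by (auto simp: case_prod_beta)
  then show o: "openin X (fst l)" and "open (snd l ` fst l)"
    and h: "homeomorphic_map (subtopology X (fst l)) (top_of_set (snd l ` fst l)) (snd l)" by auto
  show sub: "fst l \<subseteq> carrier G" using openin_subset[OF o] topspace_G by simp
  have "inj_on (snd l) (topspace (subtopology X (fst l)))" using h by (simp add: homeomorphic_eq_everything_map)
  then show inj: "inj_on (snd l) (fst l)" using sub by (simp add: topspace_G Int_absorb1)
  show "\<And>x. x \<in> fst l \<Longrightarrow> chart_inv l (snd l x) = x" using inj by (simp add: chart_inv_def)
  show "\<And>a. a \<in> snd l ` fst l \<Longrightarrow> chart_inv l a \<in> fst l \<and> snd l (chart_inv l a) = a"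
    by (simp add: chart_inv_def inv_into_into f_inv_into_f)
qed

lemma obtain_chart: assumes "x \<in> carrier G" obtains l where "l \<in> atlas G" "x \<in> fst l"
  using complex_atlas assms unfolding complex_atlas_def topspace_G by blast

text \<open>Derivatives depend only on germs, so group identities must be available in coordinates
  near the base point. Openness of the chart map keeps \<open>chart_inv l a\<close> in a prescribed
  neighbourhood.\<close>

lemma eventually_chart_inv:
  assumes "l \<in> atlas G" "x \<in> fst l" "openin X U" "x \<in> U"
  shows "\<forall>\<^sub>F a in nhds (snd l x). chart_inv l a \<in> U \<and> chart_inv l a \<in> fst l \<and> snd l (chart_inv l a) = a"
proof -
  note c = chart[OF assms(1)]
  have "openin (subtopology X (fst l)) (U \<inter> fst l)" using assms(3) openin_subtopology by blast
  then have "openin (top_of_set (snd l ` fst l)) (snd l ` (U \<inter> fst l))"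
    using homeomorphic_imp_open_map[OF c(4)] unfolding open_map_def by blast
  then have "open (snd l ` (U \<inter> fst l))" using c(3) openin_open_trans by blast
  moreover have "snd l x \<in> snd l ` (U \<inter> fst l)" using assms by blast
  moreover have "chart_inv l a \<in> U \<and> chart_inv l a \<in> fst l \<and> snd l (chart_inv l a) = a"
    if "a \<in> snd l ` (U \<inter> fst l)" for a using that c(6) by auto
  ultimately show ?thesis unfolding eventually_nhds by blast
qed

lemma open_preimage_translate:
  assumes "g \<in> carrier G" "g' \<in> carrier G" "openin X U"
  shows "openin X {y \<in> carrier G. g \<otimes>\<^bsub>G\<^esub> y \<otimes>\<^bsub>G\<^esub> g' \<in> U}" "openin X {y \<in> carrier G. g \<otimes>\<^bsub>G\<^esub> y \<in> U}"
proof -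
  have "continuous_map X X (\<lambda>y. g \<otimes>\<^bsub>G\<^esub> y)" "continuous_map X X (\<lambda>y. g \<otimes>\<^bsub>G\<^esub> y \<otimes>\<^bsub>G\<^esub> g')"
    using assms by (auto intro!: continuous_mult_const)
  from this[THEN openin_continuous_map_preimage, OF assms(3)]
  show "openin X {y \<in> carrier G. g \<otimes>\<^bsub>G\<^esub> y \<otimes>\<^bsub>G\<^esub> g' \<in> U}" "openin X {y \<in> carrier G. g \<otimes>\<^bsub>G\<^esub> y \<in> U}"
    unfolding topspace_G by auto
qed

lemma translate_differentiable:
  assumes "g \<in> carrier G" "l \<in> atlas G" "m \<in> atlas G" "x \<in> fst l"
  shows "g \<otimes>\<^bsub>G\<^esub> x \<in> fst m \<Longrightarrow> complex_differentiable_at (\<lambda>a. snd m (g \<otimes>\<^bsub>G\<^esub> chart_inv l a)) (snd l x)"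
    and "x \<otimes>\<^bsub>G\<^esub> g \<in> fst m \<Longrightarrow> complex_differentiable_at (\<lambda>a. snd m (chart_inv l a \<otimes>\<^bsub>G\<^esub> g)) (snd l x)"
proof -
  have mult: "complex_differentiable_at (\<lambda>(a, b). snd m (chart_inv k a \<otimes>\<^bsub>G\<^esub> chart_inv l b)) (snd k x, snd l y)"
    if "k \<in> atlas G" "l \<in> atlas G" "m \<in> atlas G" "x \<in> fst k" "y \<in> fst l" "x \<otimes>\<^bsub>G\<^esub> y \<in> fst m" for k l m x y
    using clg that unfolding complex_lie_group_def by blast
  obtain n where n: "n \<in> atlas G" "g \<in> fst n" using obtain_chart assms(1) by blast
  have g: "chart_inv n (snd n g) = g" using chart(6)[OF n(1)] n(2) by blast
  show "complex_differentiable_at (\<lambda>a. snd m (g \<otimes>\<^bsub>G\<^esub> chart_inv l a)) (snd l x)" if "g \<otimes>\<^bsub>G\<^esub> x \<in> fst m"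
    using complex_differentiable_at_compose[OF complex_differentiable_at_Pair(1) mult[OF n(1) assms(2,3) n(2) assms(4) that]]
    by (simp add: g)
  show "complex_differentiable_at (\<lambda>a. snd m (chart_inv l a \<otimes>\<^bsub>G\<^esub> g)) (snd l x)" if "x \<otimes>\<^bsub>G\<^esub> g \<in> fst m"
    using complex_differentiable_at_compose[OF complex_differentiable_at_Pair(2) mult[OF assms(2) n(1) assms(3,4) n(2) that]]
    by (simp add: g)
qed

section \<open>Conjugation and the adjoint representation\<close>

definition conj_chart :: "'a \<Rightarrow> complex ^ 'n \<Rightarrow> complex ^ 'n" where
  "conj_chart g a = snd k (g \<otimes>\<^bsub>G\<^esub> chart_inv k a \<otimes>\<^bsub>G\<^esub> inv\<^bsub>G\<^esub> g)"

definition dconj :: "'a \<Rightarrow> complex ^ 'n \<Rightarrow> complex ^ 'n" where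
  "dconj g = frechet_derivative (conj_chart g) (at k0)"

lemma chart_inv_k0 [simp]: "chart_inv k k0 = \<one>\<^bsub>G\<^esub>"
  using chart(6)[OF k_atlas one_chart] .

lemma conj_chart_k0 [simp]: "g \<in> carrier G \<Longrightarrow> conj_chart g k0 = k0"
  by (simp add: conj_chart_def)

text \<open>Left translation by \<open>g\<close> may leave the chart at the unit, so conjugation is
  factored through a chart \<open>m\<close> at \<open>g\<close>: left translation into
  \<open>m\<close>, then right translation back into \<open>k\<close>.\<close>

lemma complex_differentiable_conj: assumes g: "g \<in> carrier G"
  shows "complex_differentiable_at (conj_chart g) k0"
proof -
  obtain m where m: "m \<in> atlas G" "g \<in> fst m" using obtain_chart g by blast
  have L: "complex_differentiable_at (\<lambda>a. snd m (g \<otimes>\<^bsub>G\<^esub> chart_inv k a)) k0"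
    by (rule translate_differentiable(1)) (use g m k_atlas one_chart in auto)
  have "complex_differentiable_at (\<lambda>a. snd k (chart_inv m a \<otimes>\<^bsub>G\<^esub> inv\<^bsub>G\<^esub> g)) (snd m g)"
    by (rule translate_differentiable(2)) (use g m k_atlas one_chart in auto)
  then have R: "complex_differentiable_at (\<lambda>a. snd k (chart_inv m a \<otimes>\<^bsub>G\<^esub> inv\<^bsub>G\<^esub> g)) (snd m (g \<otimes>\<^bsub>G\<^esub> chart_inv k k0))"
    using g by simp
  have "\<forall>\<^sub>F a in nhds k0. chart_inv k a \<in> {y \<in> carrier G. g \<otimes>\<^bsub>G\<^esub> y \<in> fst m} \<and> chart_inv k a \<in> fst k
      \<and> snd k (chart_inv k a) = a"
    by (rule eventually_chart_inv[OF k_atlas one_chart open_preimage_translate(2)[OF g g chart(1)[OF m(1)]]])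
      (use g m in auto)
  then have "\<forall>\<^sub>F a in nhds k0. snd k (chart_inv m (snd m (g \<otimes>\<^bsub>G\<^esub> chart_inv k a)) \<otimes>\<^bsub>G\<^esub> inv\<^bsub>G\<^esub> g) = conj_chart g a"
    by (rule eventually_mono) (simp add: conj_chart_def chart(6)[OF m(1)])
  then show ?thesis
    by (rule complex_differentiable_at_cong_eventually[OF complex_differentiable_at_compose[OF L R]])
qed

lemma conj_derivative: assumes "g \<in> carrier G"
  shows "(conj_chart g has_derivative dconj g) (at k0)" "dconj g (c *\<^sub>C u) = c *\<^sub>C dconj g u"
    "dconj g (u + u') = dconj g u + dconj g u'"
proof -
  obtain D where D: "(conj_chart g has_derivative D) (at k0)" "\<And>c u. D (c *\<^sub>C u) = c *\<^sub>C D u"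
    using complex_differentiable_conj[OF assms] unfolding complex_differentiable_at_def by blast
  \<comment> \<open>\<open>frechet_derivative\<close> is a real derivative; uniqueness identifies it
    with the complex linear one.\<close>
  then have "dconj g = D" unfolding dconj_def using frechet_derivative_at by metis
  then show "(conj_chart g has_derivative dconj g) (at k0)" "dconj g (c *\<^sub>C u) = c *\<^sub>C dconj g u"
    "dconj g (u + u') = dconj g u + dconj g u'"
    using D linear_add[OF has_derivative_linear[OF D(1)]] by auto
qed

abbreviation "AD \<equiv> Ad G k \<theta>"

lemma \<theta>_Ad: "\<theta> (AD g x) = dconj g (\<theta> x)"
  by (simp add: Ad_def dconj_def conj_chart_def[abs_def])

lemma clinear_Ad: assumes "g \<in> carrier G" shows "clinear (AD g)"
proof (rule clinearI)
  have inj: "\<theta> x = \<theta> y \<Longrightarrow> x = y" for x y using bij_\<theta> by (simp add: bij_is_inj inj_eq)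
  show "AD g (x + y) = AD g x + AD g y" for x y
    by (rule inj) (simp add: clinear_add[OF clinear_\<theta>] \<theta>_Ad conj_derivative(3)[OF assms])
  show "AD g (c *\<^sub>C x) = c *\<^sub>C AD g x" for c x
    by (rule inj) (simp add: clinear_scale[OF clinear_\<theta>] \<theta>_Ad conj_derivative(2)[OF assms])
qed

lemma eventually_conj: assumes g: "g \<in> carrier G"
  shows "\<forall>\<^sub>F a in nhds k0. chart_inv k a \<in> carrier G \<and> snd k (chart_inv k a) = a
    \<and> chart_inv k (conj_chart g a) = g \<otimes>\<^bsub>G\<^esub> chart_inv k a \<otimes>\<^bsub>G\<^esub> inv\<^bsub>G\<^esub> g"
proof -
  have "\<forall>\<^sub>F a in nhds k0. chart_inv k a \<in> {y \<in> carrier G. g \<otimes>\<^bsub>G\<^esub> y \<otimes>\<^bsub>G\<^esub> inv\<^bsub>G\<^esub> g \<in> fst k}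
      \<and> chart_inv k a \<in> fst k \<and> snd k (chart_inv k a) = a"
    by (rule eventually_chart_inv[OF k_atlas one_chart open_preimage_translate(1)[OF g _ chart(1)[OF k_atlas]]])
      (use g one_chart in auto)
  then show ?thesis by (rule eventually_mono) (simp add: conj_chart_def chart(6)[OF k_atlas])
qed

lemma dconj_compose:
  assumes g: "g \<in> carrier G" and f: "(f has_derivative D) (at k0)"
  shows "((\<lambda>a. f (conj_chart g a)) has_derivative (\<lambda>u. D (dconj g u))) (at k0)"
  using diff_chain_at[OF conj_derivative(1)[OF g], of f D] f g by (simp add: o_def)

lemma Ad_mult: assumes g: "g \<in> carrier G" "g' \<in> carrier G" shows "AD (g \<otimes>\<^bsub>G\<^esub> g') x = AD g (AD g' x)"
proof -
  have "((\<lambda>a. conj_chart g (conj_chart g' a)) has_derivative (\<lambda>u. dconj g (dconj g' u))) (at k0)"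
    by (rule dconj_compose[OF g(2) conj_derivative(1)[OF g(1)]])
  moreover have "\<forall>\<^sub>F a in nhds k0. conj_chart g (conj_chart g' a) = conj_chart (g \<otimes>\<^bsub>G\<^esub> g') a"
    using eventually_conj[OF g(2)]
  proof (rule eventually_mono)
    fix a assume a: "chart_inv k a \<in> carrier G \<and> snd k (chart_inv k a) = a
      \<and> chart_inv k (conj_chart g' a) = g' \<otimes>\<^bsub>G\<^esub> chart_inv k a \<otimes>\<^bsub>G\<^esub> inv\<^bsub>G\<^esub> g'"
    then have "conj_chart g (conj_chart g' a)
        = snd k (g \<otimes>\<^bsub>G\<^esub> (g' \<otimes>\<^bsub>G\<^esub> chart_inv k a \<otimes>\<^bsub>G\<^esub> inv\<^bsub>G\<^esub> g') \<otimes>\<^bsub>G\<^esub> inv\<^bsub>G\<^esub> g)"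
      by (simp add: conj_chart_def[of g])
    also have "\<dots> = conj_chart (g \<otimes>\<^bsub>G\<^esub> g') a"
      using a g by (simp add: conj_chart_def inv_mult_group m_assoc)
    finally show "conj_chart g (conj_chart g' a) = conj_chart (g \<otimes>\<^bsub>G\<^esub> g') a" .
  qed
  ultimately have "(conj_chart (g \<otimes>\<^bsub>G\<^esub> g') has_derivative (\<lambda>u. dconj g (dconj g' u))) (at k0)"
    by (rule has_derivative_cong_eventually)
  then have "dconj (g \<otimes>\<^bsub>G\<^esub> g') = (\<lambda>u. dconj g (dconj g' u))"
    using conj_derivative(1)[of "g \<otimes>\<^bsub>G\<^esub> g'"] g has_derivative_unique by blast
  then have "\<theta> (AD (g \<otimes>\<^bsub>G\<^esub> g') x) = \<theta> (AD g (AD g' x))" by (simp add: \<theta>_Ad)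
  then show ?thesis by (metis \<theta>_inv(2))
qed

lemma Ad_one: "AD \<one>\<^bsub>G\<^esub> x = x"
proof -
  have "\<forall>\<^sub>F a in nhds k0. a = conj_chart \<one>\<^bsub>G\<^esub> a"
    using eventually_conj[OF one_closed] by (rule eventually_mono) (simp add: conj_chart_def)
  from has_derivative_cong_eventually[OF has_derivative_ident this]
  have "dconj \<one>\<^bsub>G\<^esub> = (\<lambda>u. u)" using conj_derivative(1)[OF one_closed] has_derivative_unique by blast
  then have "\<theta> (AD \<one>\<^bsub>G\<^esub> x) = \<theta> x" by (simp add: \<theta>_Ad)
  then show ?thesis by (metis \<theta>_inv(2))
qed

text \<open>For c near the unit, Ad of the conjugate of c by g, applied to Ad g y, equals Ad g (Ad c
  y). Both sides are differentiated in c at the unit, where the derivative of Ad is the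
  bracket.\<close>

lemma Ad_br: assumes g: "g \<in> carrier G" shows "AD g (br x y) = br (AD g x) (AD g y)"
proof -
  have d: "((\<lambda>a. \<theta> (AD (chart_inv k a) y)) has_derivative (\<lambda>u. \<theta> (br (\<theta>i u) y))) (at k0)" for y
    using hla by (simp add: has_lie_algebra_def)
  have 1: "((\<lambda>a. \<theta> (AD (chart_inv k (conj_chart g a)) (AD g y))) has_derivative
      (\<lambda>u. \<theta> (br (\<theta>i (dconj g u)) (AD g y)))) (at k0)"
    by (rule dconj_compose[OF g d])
  have "\<forall>\<^sub>F a in nhds k0. \<theta> (AD (chart_inv k (conj_chart g a)) (AD g y)) = dconj g (\<theta> (AD (chart_inv k a) y))"
    using eventually_conj[OF g]
  proof (rule eventually_mono)
    fix a assume a: "chart_inv k a \<in> carrier G \<and> snd k (chart_inv k a) = a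
      \<and> chart_inv k (conj_chart g a) = g \<otimes>\<^bsub>G\<^esub> chart_inv k a \<otimes>\<^bsub>G\<^esub> inv\<^bsub>G\<^esub> g"
    then have "AD (chart_inv k (conj_chart g a)) (AD g y) = AD g (AD (chart_inv k a) y)"
      using g by (simp add: Ad_mult[symmetric] m_assoc)
    then show "\<theta> (AD (chart_inv k (conj_chart g a)) (AD g y)) = dconj g (\<theta> (AD (chart_inv k a) y))"
      by (simp add: \<theta>_Ad[of g])
  qed
  from has_derivative_cong_eventually[OF 1 this]
  have "((\<lambda>a. dconj g (\<theta> (AD (chart_inv k a) y))) has_derivative (\<lambda>u. \<theta> (br (\<theta>i (dconj g u)) (AD g y)))) (at k0)" .
  moreover have "((\<lambda>a. dconj g (\<theta> (AD (chart_inv k a) y))) has_derivative (\<lambda>u. dconj g (\<theta> (br (\<theta>i u) y)))) (at k0)"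
    using bounded_linear.has_derivative[OF has_derivative_bounded_linear[OF conj_derivative(1)[OF g]] d] .
  ultimately have "dconj g (\<theta> (br (\<theta>i (\<theta> x)) y)) = \<theta> (br (\<theta>i (dconj g (\<theta> x))) (AD g y))"
    using has_derivative_unique by metis
  then have "\<theta> (AD g (br x y)) = \<theta> (br (AD g x) (AD g y))" by (simp add: \<theta>_Ad[symmetric])
  then show ?thesis by (metis \<theta>_inv(2))
qed

section \<open>One-parameter subgroups and the Borel subgroup\<close>

lemma one_parameter_subgroup_0: assumes "one_parameter_subgroup G k \<theta> \<gamma> x" shows "\<gamma> 0 = \<one>\<^bsub>G\<^esub>" "\<gamma> t \<in> carrier G"
proof -
  show *: "\<gamma> t \<in> carrier G" for t
    using assms continuous_map_image_subset_topspace[of euclideanreal X \<gamma>]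
    unfolding one_parameter_subgroup_def topspace_G by auto
  have "\<gamma> 0 \<otimes>\<^bsub>G\<^esub> \<gamma> 0 = \<gamma> 0" using assms unfolding one_parameter_subgroup_def by (metis add_0)
  then show "\<gamma> 0 = \<one>\<^bsub>G\<^esub>" using *[of 0] l_cancel_one by blast
qed

lemma eventually_one_parameter_subgroup:
  assumes "one_parameter_subgroup G k \<theta> \<gamma> x" shows "\<forall>\<^sub>F t in nhds 0. \<gamma> t \<in> fst k"
proof -
  have "openin euclideanreal {t \<in> topspace euclideanreal. \<gamma> t \<in> fst k}"
    using assms openin_continuous_map_preimage chart(1)[OF k_atlas] unfolding one_parameter_subgroup_def by blast
  then show ?thesis using one_parameter_subgroup_0[OF assms] one_chart
    unfolding eventually_nhds by (intro exI[of _ "{t. \<gamma> t \<in> fst k}"]) auto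
qed

lemma one_parameter_subgroup_conj:
  assumes \<gamma>: "one_parameter_subgroup G k \<theta> \<gamma> x" and g: "g \<in> carrier G"
  shows "one_parameter_subgroup G k \<theta> (\<lambda>t. g \<otimes>\<^bsub>G\<^esub> \<gamma> t \<otimes>\<^bsub>G\<^esub> inv\<^bsub>G\<^esub> g) (AD g x)"
  unfolding one_parameter_subgroup_def
proof (intro conjI allI)
  note c = one_parameter_subgroup_0[OF \<gamma>]
  show "continuous_map euclideanreal X (\<lambda>t. g \<otimes>\<^bsub>G\<^esub> \<gamma> t \<otimes>\<^bsub>G\<^esub> inv\<^bsub>G\<^esub> g)"
    using \<gamma> g by (auto intro!: continuous_mult_const simp: one_parameter_subgroup_def)
  show "g \<otimes>\<^bsub>G\<^esub> \<gamma> (s + t) \<otimes>\<^bsub>G\<^esub> inv\<^bsub>G\<^esub> g =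
      g \<otimes>\<^bsub>G\<^esub> \<gamma> s \<otimes>\<^bsub>G\<^esub> inv\<^bsub>G\<^esub> g \<otimes>\<^bsub>G\<^esub> (g \<otimes>\<^bsub>G\<^esub> \<gamma> t \<otimes>\<^bsub>G\<^esub> inv\<^bsub>G\<^esub> g)" for s t
  proof -
    have "\<gamma> (s + t) = \<gamma> s \<otimes>\<^bsub>G\<^esub> \<gamma> t" using \<gamma> by (simp add: one_parameter_subgroup_def)
    moreover have "inv\<^bsub>G\<^esub> g \<otimes>\<^bsub>G\<^esub> (g \<otimes>\<^bsub>G\<^esub> y) = y" if "y \<in> carrier G" for y
      using g that by (simp add: m_assoc[symmetric])
    ultimately show ?thesis using c(2) g by (simp add: m_assoc)
  qed
  have "((\<lambda>t. conj_chart g (snd k (\<gamma> t))) has_vector_derivative dconj g (\<theta> x)) (at 0)"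
    by (rule has_vector_derivative_compose)
      (use \<gamma> conj_derivative(1)[OF g] c(1) in \<open>simp_all add: one_parameter_subgroup_def\<close>)
  moreover have "\<forall>\<^sub>F t in nhds 0. conj_chart g (snd k (\<gamma> t)) = snd k (g \<otimes>\<^bsub>G\<^esub> \<gamma> t \<otimes>\<^bsub>G\<^esub> inv\<^bsub>G\<^esub> g)"
    using eventually_one_parameter_subgroup[OF \<gamma>]
    by (rule eventually_mono) (simp add: conj_chart_def chart(6)[OF k_atlas])
  ultimately show "((\<lambda>t. snd k (g \<otimes>\<^bsub>G\<^esub> \<gamma> t \<otimes>\<^bsub>G\<^esub> inv\<^bsub>G\<^esub> g)) has_vector_derivative \<theta> (AD g x)) (at 0)"
    unfolding \<theta>_Ad by (rule has_vector_derivative_cong_eventually)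
qed

text \<open>\<open>borel_subgroup\<close> describes b by the one-parameter subgroups inside
  \<open>B\<close>; conjugation by an element of \<open>B\<close> keeps them in \<open>B\<close> and
  moves the initial velocity by \<open>AD g\<close>.\<close>

lemma Ad_borel: assumes "borel_subgroup G k \<theta> b B" "g \<in> B" "x \<in> b" shows "AD g x \<in> b"
proof -
  have sg: "subgroup B G" and b: "b = {x. \<exists>\<gamma>. one_parameter_subgroup G k \<theta> \<gamma> x \<and> range \<gamma> \<subseteq> B}"
    using assms(1) by (auto simp: borel_subgroup_def)
  obtain \<gamma> where \<gamma>: "one_parameter_subgroup G k \<theta> \<gamma> x" "range \<gamma> \<subseteq> B" using assms(3) b by blast
  have "range (\<lambda>t. g \<otimes>\<^bsub>G\<^esub> \<gamma> t \<otimes>\<^bsub>G\<^esub> inv\<^bsub>G\<^esub> g) \<subseteq> B"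
    using \<gamma>(2) assms(2) by (auto intro!: subgroup.m_closed[OF sg] subgroup.m_inv_closed[OF sg])
  then show ?thesis
    using one_parameter_subgroup_conj[OF \<gamma>(1) subgroup.mem_carrier[OF sg assms(2)]] b by blast
qed

end

section \<open>The PBW filtration of a highest weight module\<close>

lemma functionals_separate:
  fixes x y :: "'v::complex_vector"
  assumes "fin_dim TYPE('v)" "\<And>\<psi> :: 'v \<Rightarrow> complex. functional whole \<psi> \<Longrightarrow> \<psi> x = \<psi> y" shows "x = y"
proof -
  obtain S :: "'v set" and c where S: "finite S" "\<And>x. functional whole (c x)" "\<And>w. w = (\<Sum>x\<in>S. c x w *\<^sub>C x)"
    using finite_basis[OF assms(1)] by blast
  have "x = (\<Sum>s\<in>S. c s x *\<^sub>C s)" by (rule S(3))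
  also have "\<dots> = (\<Sum>s\<in>S. c s y *\<^sub>C s)" using assms(2)[OF S(2)] by simp
  also have "\<dots> = y" by (rule S(3)[symmetric])
  finally show ?thesis .
qed

lemma abelian_group_whole: "abelian_group (whole :: (complex, 'v::complex_vector) module)"
proof (rule abelian_groupI)
  fix x :: 'v
  show "\<exists>y\<in>carrier whole. y \<oplus>\<^bsub>whole\<^esub> x = \<zero>\<^bsub>whole\<^esub>"
    by (rule bexI[of _ "- x"]) (auto simp: whole_def)
qed (auto simp: whole_def algebra_simps)

lemma minus_whole: "x \<ominus>\<^bsub>whole\<^esub> y = x - (y :: 'v::complex_vector)"
proof -
  interpret M: abelian_group "whole :: (complex, 'v) module" by (rule abelian_group_whole)
  have "\<ominus>\<^bsub>whole\<^esub> y = - y" by (rule M.minus_equality) (auto simp: whole_def)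
  then show ?thesis by (simp add: a_minus_def whole_def)
qed

locale hw_module = cartan_setup br h P e f
  for br :: "'g::complex_vector \<Rightarrow> 'g \<Rightarrow> 'g"
    and h :: "'g set"
    and P :: "('g \<Rightarrow> complex) set"
    and e f :: "('g \<Rightarrow> complex) \<Rightarrow> 'g" +
  fixes lam :: "'g \<Rightarrow> complex"
    and \<rho> :: "'g \<Rightarrow> 'v::complex_vector \<Rightarrow> 'v"
    and v :: 'v
  assumes lmod: "lie_module br whole \<rho>"
    and irr: "irreducible_module \<rho>"
    and hwv: "highest_weight_vector br h P \<rho> lam v"
begin

lemma clinear_\<rho>: "clinear (\<rho> x)"
  using lmod by (simp add: lie_module_def linear_endo_whole_iff)

lemma \<rho>_simps: "\<rho> (x + y) w = \<rho> x w + \<rho> y w" "\<rho> (c *\<^sub>C x) w = c *\<^sub>C \<rho> x w"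
  and \<rho>_br: "\<rho> (br x y) w = \<rho> x (\<rho> y w) - \<rho> y (\<rho> x w)"
  using lmod by (auto simp: lie_module_def minus_whole) (auto simp: whole_def)

lemma \<rho>_split: "\<rho> z w = \<rho> (z - pr z) w + \<rho> (pr z) w"
  using \<rho>_simps(1)[of "z - pr z" "pr z"] by simp

lemma \<rho>_diff: "\<rho> (x - y) w = \<rho> x w - \<rho> y w" and \<rho>_0: "\<rho> 0 w = 0"
proof -
  have "clinear (\<lambda>x. \<rho> x w)" by (rule clinearI) (simp_all add: \<rho>_simps)
  then show "\<rho> (x - y) w = \<rho> x w - \<rho> y w" "\<rho> 0 w = 0"
    using clinear_diff[of "\<lambda>x. \<rho> x w"] clinear_0[of "\<lambda>x. \<rho> x w"] by auto
qed

text \<open>The set \<open>K\<close> of starting vectors is a parameter: \<open>{v}\<close> gives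
  the PBW filtration, while a set of vectors annihilated by \<open>NP\<close> is used to show that
  all such vectors are multiples of \<open>v\<close>.\<close>

definition filt :: "'v set \<Rightarrow> nat \<Rightarrow> 'v set" where
  "filt K s = cv.span {foldr \<rho> xs u | xs u. u \<in> K \<and> set xs \<subseteq> N \<and> length xs \<le> s}"

lemma subspace_filt: "cv.subspace (filt K s)" by (simp add: filt_def)

lemma filt_mono: "s \<le> t \<Longrightarrow> filt K s \<subseteq> filt K t"
  unfolding filt_def by (rule cv.span_mono) (blast intro: order_trans)

lemma foldr_in_filt: "u \<in> K \<Longrightarrow> set xs \<subseteq> N \<Longrightarrow> foldr \<rho> xs u \<in> filt K (length xs)"
  unfolding filt_def by (rule cv.span_base) auto

lemma filt_N: assumes "y \<in> N" "w \<in> filt K s" shows "\<rho> y w \<in> filt K (Suc s)"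
  using assms(2) unfolding filt_def[of K s]
proof (rule clinear_span_subset[OF _ clinear_\<rho> subspace_filt])
  fix w assume "w \<in> {foldr \<rho> xs u |xs u. u \<in> K \<and> set xs \<subseteq> N \<and> length xs \<le> s}"
  then obtain xs u where *: "w = foldr \<rho> xs u" "u \<in> K" "set xs \<subseteq> N" "length xs \<le> s" by blast
  then have "foldr \<rho> (y # xs) u \<in> filt K (length (y # xs))"
    using assms(1) by (intro foldr_in_filt) auto
  then show "\<rho> y w \<in> filt K (Suc s)" using * filt_mono[of "length (y # xs)" "Suc s"] by auto
qed

lemma filt_b:
  assumes K: "\<And>x u. x \<in> b \<Longrightarrow> u \<in> K \<Longrightarrow> \<rho> x u \<in> cv.span K" and "x \<in> b" "w \<in> filt K s"
  shows "\<rho> x w \<in> filt K s"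
proof -
  have *: "\<rho> x (foldr \<rho> xs u) \<in> filt K (length xs)" if "u \<in> K" "set xs \<subseteq> N" "x \<in> b" for xs u x
    using that(2,3)
  proof (induction xs arbitrary: x)
    case Nil
    have "cv.span K \<subseteq> filt K 0" unfolding filt_def by (rule cv.span_mono) force
    then show ?case using K[OF \<open>x \<in> b\<close> \<open>u \<in> K\<close>] by auto
  next
    case (Cons y ys)
    let ?w = "foldr \<rho> ys u" and ?n = "length ys"
    \<comment> \<open>The bracket is split by \<open>pr\<close>. Its part in b is handled by the
      induction hypothesis for a new element of b, hence the arbitrary \<open>x\<close>; its part in
      \<open>N\<close> takes the place of the letter \<open>y\<close>.\<close>
    have "\<rho> x (\<rho> y ?w) = \<rho> y (\<rho> x ?w) + \<rho> (br x y) ?w" by (simp add: \<rho>_br)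
    also have "\<rho> (br x y) ?w = \<rho> (br x y - pr (br x y)) ?w + \<rho> (pr (br x y)) ?w" by (rule \<rho>_split)
    finally have eq: "\<rho> x (\<rho> y ?w) = \<rho> y (\<rho> x ?w) + (\<rho> (br x y - pr (br x y)) ?w + \<rho> (pr (br x y)) ?w)" .
    have "\<rho> y (\<rho> x ?w) \<in> filt K (Suc ?n)" using Cons by (intro filt_N) auto
    moreover have "\<rho> (br x y - pr (br x y)) ?w \<in> filt K (Suc ?n)"
      using Cons.IH[OF _ proj_b] Cons.prems filt_mono[of ?n "Suc ?n"] by auto
    moreover have "\<rho> (pr (br x y)) ?w \<in> filt K (Suc ?n)"
      using \<open>u \<in> K\<close> Cons.prems by (intro filt_N foldr_in_filt) auto
    ultimately show ?case unfolding list.size foldr.simps o_apply eq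
      by (simp add: cv.subspace_add[OF subspace_filt])
  qed
  show ?thesis using assms(3) unfolding filt_def[of K s]
  proof (rule clinear_span_subset[OF _ clinear_\<rho>])
    show "cv.subspace (cv.span {foldr \<rho> xs u |xs u. u \<in> K \<and> set xs \<subseteq> N \<and> length xs \<le> s})" by simp
    fix w assume "w \<in> {foldr \<rho> xs u |xs u. u \<in> K \<and> set xs \<subseteq> N \<and> length xs \<le> s}"
    then obtain xs u where "w = foldr \<rho> xs u" "u \<in> K" "set xs \<subseteq> N" "length xs \<le> s" by blast
    then have "\<rho> x w \<in> filt K s" using *[of u xs x] assms(2) filt_mono by blast
    then show "\<rho> x w \<in> cv.span {foldr \<rho> xs u |xs u. u \<in> K \<and> set xs \<subseteq> N \<and> length xs \<le> s}"
      unfolding filt_def .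
  qed
qed

text \<open>Elements of b keep each step and those of \<open>N\<close> move to the next one, so the
  union is a nonzero submodule of an irreducible module.\<close>

lemma filt_exhausts:
  assumes K: "\<And>x u. x \<in> b \<Longrightarrow> u \<in> K \<Longrightarrow> \<rho> x u \<in> cv.span K" and u: "u \<in> K" "u \<noteq> 0"
  shows "(\<Union>s. filt K s) = UNIV"
proof -
  have "cv.subspace (\<Union>s. filt K s)"
  proof (rule cv.subspaceI)
    show "0 \<in> (\<Union>s. filt K s)" using cv.subspace_0[OF subspace_filt] by blast
    fix x y assume "x \<in> (\<Union>s. filt K s)" "y \<in> (\<Union>s. filt K s)"
    then obtain s t where "x \<in> filt K s" "y \<in> filt K t" by blast
    then have "x \<in> filt K (max s t)" "y \<in> filt K (max s t)"
      using filt_mono[of s "max s t" K] filt_mono[of t "max s t" K] by auto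
    then show "x + y \<in> (\<Union>s. filt K s)" using cv.subspace_add[OF subspace_filt] by blast
  next
    fix c x assume "x \<in> (\<Union>s. filt K s)"
    then show "c *\<^sub>C x \<in> (\<Union>s. filt K s)" using cv.subspace_scale[OF subspace_filt] by blast
  qed
  moreover have "\<rho> z w \<in> filt K (Suc s)" if "w \<in> filt K s" for z w s
  proof -
    have "\<rho> (z - pr z) w \<in> filt K (Suc s)"
      using filt_b[of K "z - pr z" w s, OF K proj_b that] filt_mono[of s "Suc s"] by auto
    then show ?thesis
      using filt_N[OF proj_N that, of z] \<rho>_split[of z w] cv.subspace_add[OF subspace_filt] by auto
  qed
  then have "\<forall>z. \<rho> z ` (\<Union>s. filt K s) \<subseteq> (\<Union>s. filt K s)" by blast
  ultimately have "(\<Union>s. filt K s) = {0} \<or> (\<Union>s. filt K s) = UNIV"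
    using irr unfolding irreducible_module_def by blast
  moreover have "u \<in> (\<Union>s. filt K s)" using foldr_in_filt[OF u(1), of "[]"] by auto
  ultimately show ?thesis using u(2) by blast
qed

section \<open>The highest weight line\<close>

lemma v_nonzero: "v \<noteq> 0" and NP_v: "x \<in> NP \<Longrightarrow> \<rho> x v = 0" and h_v: "t \<in> h \<Longrightarrow> \<rho> t v = lam t *\<^sub>C v"
  using hwv by (auto simp: highest_weight_vector_def)

lemma b_v: assumes "x \<in> b" shows "\<rho> x v \<in> cv.span {v}"
proof -
  obtain a t where "a \<in> NP" "t \<in> h" "x = a + t" using assms unfolding borel_algebra_def by blast
  then show ?thesis by (simp add: \<rho>_simps NP_v h_v cv.span_base cv.span_scale)
qed

abbreviation "F \<equiv> pbw_filtration N \<rho> v"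

lemma pbw_filt: "F s = filt {v} s"
  unfolding pbw_filtration_def filt_def by (rule arg_cong[where f = cv.span]) blast

lemma F_N: "y \<in> N \<Longrightarrow> w \<in> F s \<Longrightarrow> \<rho> y w \<in> F (Suc s)"
  unfolding pbw_filt by (rule filt_N)

lemma F_b: "x \<in> b \<Longrightarrow> w \<in> F s \<Longrightarrow> \<rho> x w \<in> F s"
  unfolding pbw_filt by (rule filt_b) (use b_v in auto)

lemma F_exhausts: "(\<Union>s. F s) = UNIV"
  unfolding pbw_filt by (rule filt_exhausts[of _ v]) (use b_v v_nonzero in auto)

text \<open>Let \<open>\<xi>\<close> be positive on the positive roots. The sum \<open>W\<close> of the eigenspaces of \<open>\<xi>\<close> with eigenvalue
  below that of \<open>v\<close> complements \<open>v\<close>, and a vector of \<open>W\<close> annihilated by \<open>n\<^sup>+\<close> generates a submodule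
  inside \<open>W\<close>.\<close>

lemma NP_invariants: assumes w: "\<And>x. x \<in> NP \<Longrightarrow> \<rho> x w = 0" shows "w \<in> cv.span {v}"
proof -
  obtain \<xi> where \<xi>: "\<xi> \<in> h" "\<And>\<alpha>. \<alpha> \<in> roots br h \<Longrightarrow> Re (\<alpha> \<xi>) > 0 \<longleftrightarrow> \<alpha> \<in> P"
    "\<And>\<alpha>. \<alpha> \<in> P \<Longrightarrow> Re (\<alpha> \<xi>) > 0" using obtain_\<xi> by blast
  \<comment> \<open>Only the single operator \<open>\<rho> \<xi>\<close> is used, indexed by a
    one-element set; comparing real parts of its eigenvalues replaces the partial order on
    weights.\<close>
  define E where "E = (\<lambda>c. weight_space {()} (\<lambda>_. \<rho> \<xi>) (\<lambda>_. c))"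
  define Q where "Q = {c. Re c < Re (lam \<xi>)}"
  define W where "W = cv.span (\<Union>c\<in>Q. E c)"
  have E: "w \<in> E c \<longleftrightarrow> \<rho> \<xi> w = c *\<^sub>C w" for c w by (simp add: E_def weight_space_def)
  have sW: "cv.subspace W" by (simp add: W_def)
  have vW: "v \<notin> W"
  proof
    assume "v \<in> W"
    then have "v = 0" unfolding W_def E_def
      by (rule weight_vector_in_span_other_weights[OF clinear_\<rho>, where m = "lam \<xi>"])
        (use h_v[OF \<xi>(1)] in \<open>auto simp: weight_space_def Q_def\<close>)
    then show False using v_nonzero by simp
  qed
  have lower: "\<rho> y w \<in> E (c - \<alpha> \<xi>)" if "\<alpha> \<in> P" "y \<in> root_space br h (- \<alpha>)" "w \<in> E c" for \<alpha> y w c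
  proof -
    have "\<rho> \<xi> (\<rho> y w) = \<rho> y (\<rho> \<xi> w) + \<rho> (br \<xi> y) w" by (simp add: \<rho>_br)
    moreover have "br \<xi> y = (- \<alpha> \<xi>) *\<^sub>C y" using that(2) \<xi>(1) by (simp add: root_space_def)
    ultimately have "\<rho> \<xi> (\<rho> y w) = c *\<^sub>C \<rho> y w + (- \<alpha> \<xi>) *\<^sub>C \<rho> y w"
      using that(3) by (simp only: E \<rho>_simps clinear_scale[OF clinear_\<rho>])
    then show ?thesis unfolding E by (simp only: scaleC_add_left[symmetric] diff_conv_add_uminus)
  qed
  have NW: "\<rho> y w \<in> W" if "y \<in> N" "w \<in> W" for y w
  proof -
    have *: "\<rho> y w \<in> W" if y: "y \<in> (\<Union>\<alpha>\<in>P. root_space br h (- \<alpha>))" for y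
      using \<open>w \<in> W\<close> unfolding W_def[THEN eqset_imp_iff, of w]
    proof (rule clinear_span_subset[OF _ clinear_\<rho> sW])
      fix w assume "w \<in> (\<Union>c\<in>Q. E c)"
      then obtain c \<alpha> where c: "c \<in> Q" "w \<in> E c" "\<alpha> \<in> P" "y \<in> root_space br h (- \<alpha>)" using y by blast
      then have "\<rho> y w \<in> E (c - \<alpha> \<xi>)" "c - \<alpha> \<xi> \<in> Q" using lower \<xi>(3)[of \<alpha>] by (auto simp: Q_def)
      then show "\<rho> y w \<in> W" unfolding W_def by (blast intro: cv.span_base)
    qed
    show ?thesis using that(1) unfolding n_minus_def
    proof (rule clinear_span_subset[where f = "\<lambda>y. \<rho> y w"])
      show "clinear (\<lambda>y. \<rho> y w)" by (rule clinearI) (simp_all add: \<rho>_simps)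
    qed (use sW * in auto)
  qed
  have Nv: "\<rho> y v \<in> W" if "y \<in> N" for y
    using that unfolding n_minus_def
  proof (rule clinear_span_subset[where f = "\<lambda>y. \<rho> y v"])
    show "clinear (\<lambda>y. \<rho> y v)" by (rule clinearI) (simp_all add: \<rho>_simps)
    fix y assume "y \<in> (\<Union>\<alpha>\<in>P. root_space br h (- \<alpha>))"
    then obtain \<alpha> where "\<alpha> \<in> P" "y \<in> root_space br h (- \<alpha>)" by blast
    then have "\<rho> y v \<in> E (lam \<xi> - \<alpha> \<xi>)" "lam \<xi> - \<alpha> \<xi> \<in> Q"
      using lower[of \<alpha> y v "lam \<xi>"] h_v[OF \<xi>(1)] \<xi>(3)[of \<alpha>] by (auto simp: E Q_def)
    then show "\<rho> y v \<in> W" unfolding W_def by (blast intro: cv.span_base)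
  qed (rule sW)
  have hW: "\<rho> t w \<in> W" if "t \<in> h" "w \<in> W" for t w
    using that(2) unfolding W_def[THEN eqset_imp_iff, of w]
  proof (rule clinear_span_subset[OF _ clinear_\<rho> sW])
    fix w assume "w \<in> (\<Union>c\<in>Q. E c)"
    then obtain c where c: "c \<in> Q" "\<rho> \<xi> w = c *\<^sub>C w" unfolding E[symmetric] by blast
    have "\<rho> \<xi> (\<rho> t w) = \<rho> t (\<rho> \<xi> w)" using \<rho>_br[of \<xi> t w] h_abelian[OF \<xi>(1) that(1)] by (simp add: \<rho>_0)
    then have "\<rho> t w \<in> E c" by (simp add: E c clinear_scale[OF clinear_\<rho>])
    then show "\<rho> t w \<in> W" unfolding W_def using c(1) by (blast intro: cv.span_base)
  qed
  have foldr_W: "foldr \<rho> xs u \<in> W" if "set xs \<subseteq> N" "u \<in> W" for xs u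
    using that(1) by (induction xs) (use that(2) NW in auto)
  \<comment> \<open>h maps \<open>K\<close> to itself: it normalises \<open>NP\<close>, and it
    preserves \<open>W\<close> because it commutes with \<open>\<xi>\<close>. This is the stability
    that \<open>filt_exhausts\<close> asks of \<open>K\<close>.\<close>
  define K where "K = {u \<in> W. \<forall>x\<in>NP. \<rho> x u = 0}"
  have bK: "\<rho> x u \<in> cv.span K" if xb: "x \<in> b" and uK: "u \<in> K" for x u
  proof -
    obtain a t where *: "a \<in> NP" "t \<in> h" "x = a + t" using xb unfolding borel_algebra_def by blast
    have "\<rho> y (\<rho> t u) = 0" if "y \<in> NP" for y
    proof -
      have "br y t \<in> NP" using br_h_NP[OF *(2) that] br_anti[of t y] cv.subspace_neg[OF subspace_NP]
        by (metis minus_minus)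
      then have "\<rho> (br y t) u = 0" "\<rho> y u = 0" using \<open>u \<in> K\<close> that by (auto simp: K_def)
      then show ?thesis using \<rho>_br[of y t u] clinear_0[OF clinear_\<rho>] by simp
    qed
    then have "\<rho> t u \<in> K" using hW[OF *(2)] that(2) by (simp add: K_def)
    moreover have "\<rho> x u = \<rho> t u" using * that(2) by (simp add: \<rho>_simps K_def)
    ultimately show ?thesis by (simp add: cv.span_base)
  qed
  have K0: "u = 0" if "u \<in> K" for u
  proof (rule ccontr)
    assume "u \<noteq> 0"
    have "filt K s \<subseteq> W" for s
      unfolding filt_def by (rule cv.span_minimal[OF _ sW]) (use foldr_W in \<open>auto simp: K_def\<close>)
    then show False using filt_exhausts[of K u, OF bK that \<open>u \<noteq> 0\<close>] vW by blast
  qed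
  have dec: "\<exists>c. w - c *\<^sub>C v \<in> W" for w
  proof -
    have "cv.subspace {w. \<exists>c. w - c *\<^sub>C v \<in> W}"
    proof (rule cv.subspaceI)
      show "0 \<in> {w. \<exists>c. w - c *\<^sub>C v \<in> W}" using cv.subspace_0[OF sW] by (auto intro: exI[of _ 0])
      fix x y assume "x \<in> {w. \<exists>c. w - c *\<^sub>C v \<in> W}" "y \<in> {w. \<exists>c. w - c *\<^sub>C v \<in> W}"
      then obtain c d where "x - c *\<^sub>C v \<in> W" "y - d *\<^sub>C v \<in> W" by blast
      from cv.subspace_add[OF sW this] have "x + y - (c + d) *\<^sub>C v \<in> W"
        by (simp add: scaleC_add_left algebra_simps)
      then show "x + y \<in> {w. \<exists>c. w - c *\<^sub>C v \<in> W}" by blast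
    next
      fix d x assume "x \<in> {w. \<exists>c. w - c *\<^sub>C v \<in> W}"
      then obtain c where "x - c *\<^sub>C v \<in> W" by blast
      from cv.subspace_scale[OF sW this, of d] have "d *\<^sub>C x - (d * c) *\<^sub>C v \<in> W"
        by (simp add: cv.scale_right_diff_distrib scaleC_scaleC)
      then show "d *\<^sub>C x \<in> {w. \<exists>c. w - c *\<^sub>C v \<in> W}" by blast
    qed
    moreover have "\<exists>c. foldr \<rho> xs v - c *\<^sub>C v \<in> W" if "set xs \<subseteq> N" for xs
    proof (cases xs)
      case Nil
      then show ?thesis using cv.subspace_0[OF sW] by (intro exI[of _ 1]) (simp add: scaleC_one)
    next
      \<comment> \<open>\<open>foldr\<close> applies the last letter first. That letter sends
        \<open>v\<close> into \<open>W\<close> and the others stay there, so the list is taken apart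
        at its end.\<close>
      case (Cons y ys)
      have "foldr \<rho> (ys @ [y]) v \<in> W" if "set (ys @ [y]) \<subseteq> N" for ys y
        using that foldr_W[of ys "\<rho> y v"] Nv by simp
      then have "foldr \<rho> xs v \<in> W" using Cons that by (metis append_butlast_last_id list.distinct(1))
      then show ?thesis by (intro exI[of _ 0]) simp
    qed
    ultimately have "filt {v} s \<subseteq> {w. \<exists>c. w - c *\<^sub>C v \<in> W}" for s
      unfolding filt_def by (intro cv.span_minimal) auto
    then show ?thesis using F_exhausts unfolding pbw_filt by blast
  qed
  then obtain c where c: "w - c *\<^sub>C v \<in> W" by blast
  have "w - c *\<^sub>C v \<in> K"
    using c w NP_v by (simp add: K_def clinear_diff[OF clinear_\<rho>] clinear_scale[OF clinear_\<rho>])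
  then have "w = c *\<^sub>C v" using K0 by fastforce
  then show ?thesis by (simp add: cv.span_base cv.span_scale)
qed

text \<open>The degrees of a finite spanning set have a common bound, and there the filtration is
  everything.\<close>

lemma filtration_F:
  assumes "fin_dim TYPE('v)" shows "\<exists>m. filtration F m"
proof -
  obtain S :: "'v set" where S: "finite S" "cv.span S = UNIV" using assms by (auto simp: fin_dim_def)
  have "\<forall>x. \<exists>s. x \<in> F s" using F_exhausts by blast
  then obtain d where d: "\<And>x. x \<in> F (d x)" by metis
  obtain m where m: "\<And>x. x \<in> S \<Longrightarrow> d x \<le> m" using S(1) finite_nat_set_iff_bounded_le[of "d ` S"] by auto
  have "S \<subseteq> F m" using d m filt_mono unfolding pbw_filt by blast
  then have "F m = UNIV" using S(2) cv.span_minimal[of S "F m"] subspace_filt unfolding pbw_filt by auto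
  moreover have "F s \<subseteq> F (Suc s)" for s using filt_mono[of s "Suc s"] unfolding pbw_filt by simp
  ultimately have "filtration F m"
    using assms subspace_filt unfolding pbw_filt by unfold_locales auto
  then show ?thesis ..
qed

end

section \<open>The degenerate Lie algebra and the degenerate group acting on the graded space\<close>

locale hw_filtration = hw_module br h P e f lam \<rho> v + filtration "pbw_filtration (n_minus br h P) \<rho> v" m
  for br :: "'g::complex_vector \<Rightarrow> 'g \<Rightarrow> 'g"
    and h :: "'g set"
    and P :: "('g \<Rightarrow> complex) set"
    and e f :: "('g \<Rightarrow> complex) \<Rightarrow> 'g"
    and lam :: "'g \<Rightarrow> complex"
    and \<rho> :: "'g \<Rightarrow> 'v::complex_vector \<Rightarrow> 'v"
    and v :: 'v and m :: nat
begin

text \<open>Stated for the whole Lie algebra and not only for \<open>N\<close>, because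
  \<open>Ad g\<close> need not preserve \<open>N\<close>.\<close>

lemma raising_\<rho>: "raising (\<rho> z)"
  unfolding raising_def
proof (intro conjI allI image_subsetI clinear_\<rho>)
  fix s w assume w: "w \<in> F s"
  have "\<rho> (z - pr z) w \<in> F (Suc s)" using F_b[OF proj_b w] F_mono by blast
  then show "\<rho> z w \<in> F (Suc s)" unfolding \<rho>_split[of z w] using F_N[OF proj_N w] F_closed(2) by blast
qed

definition dop :: "'g \<Rightarrow> (nat \<Rightarrow> 'v) \<Rightarrow> nat \<Rightarrow> 'v" where
  "dop z w = (\<lambda>s. shift 0 (\<rho> (z - pr z)) w s + shift 1 (\<rho> (pr z)) w s)"

lemma dop_simps: "dop z w 0 = \<rho> (z - pr z) (w 0)" "dop z w (Suc s) = \<rho> (z - pr z) (w (Suc s)) + \<rho> (pr z) (w s)"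
  by (simp_all add: dop_def shift_def)

lemma graded_op_shifts: "graded_op (shift 0 (\<rho> (z - pr z)))" "graded_op (shift 1 (\<rho> y))"
proof -
  show "graded_op (shift 0 (\<rho> (z - pr z)))"
    by (rule graded_op_shift[OF clinear_\<rho>]) (use F_b[OF proj_b] in auto)
  show "graded_op (shift 1 (\<rho> y))"
    by (rule graded_op_shift[OF clinear_\<rho>]) (use raising_\<rho>[of y] in \<open>auto simp: raising_def\<close>)
qed

lemma graded_op_dop: "graded_op (dop z)"
  using graded_op_shifts(1)[of z] graded_op_shifts(2)[of "pr z"]
  unfolding graded_op_def dop_def sec_def
  by (simp add: F_closed prev_closed scaleC_add_right add_ac)

lemma action_cls: assumes "sec w" shows "degenerate_action N b \<rho> F z (cls w) = cls (dop z w)"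
proof -
  have "gr_map F 0 (\<rho> (z - pr z)) (cls w) = cls (shift 0 (\<rho> (z - pr z)) w)"
    by (rule gr_map_cls[OF clinear_\<rho> _ assms]) (use F_b[OF proj_b] in auto)
  moreover have "gr_map F 1 (\<rho> (pr z)) (cls w) = cls (shift 1 (\<rho> (pr z)) w)"
    by (rule gr_map_cls[OF clinear_\<rho> _ assms]) (use raising_\<rho>[of "pr z"] in \<open>auto simp: raising_def\<close>)
  ultimately show ?thesis by (simp add: degenerate_action_def add_gr dop_def)
qed

lemma dop_add: "dop (x + y) w s = dop x w s + dop y w s"
  by (cases s) (simp_all add: dop_simps \<rho>_simps \<rho>_diff algebra_simps)

lemma dop_scale: "dop (c *\<^sub>C x) w s = c *\<^sub>C dop x w s"
  by (cases s) (simp_all add: dop_simps \<rho>_simps \<rho>_diff scaleC_add_right cv.scale_right_diff_distrib)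

text \<open>The two operators agree up to \<open>\<rho> [y, y']\<close> and the \<open>b\<close>-parts of \<open>[x, y']\<close> and \<open>[x', y]\<close>,
  which vanish in the graded space for degree reasons.\<close>

lemma dop_dbr: assumes w: "sec w" shows "dop (dbr z z') w s - (dop z (dop z' w) s - dop z' (dop z w) s) \<in> prev F s"
proof -
  let ?x = "z - pr z" and ?x' = "z' - pr z'" and ?y = "pr z" and ?y' = "pr z'"
  have wF: "w s \<in> F s" for s using w by (simp add: sec_def)
  have D: "dop (dbr z z') w s = (if s = 0 then \<rho> (br ?x ?x') (w 0) else
     \<rho> (br ?x ?x') (w s) + \<rho> (pr (br ?x ?y')) (w (s - 1)) - \<rho> (pr (br ?x' ?y)) (w (s - 1)))" for s
    by (cases s) (simp_all only: dop_simps dbr_minus_proj, simp_all add: proj_dbr \<rho>_diff add_diff_eq del: br_simps(9,10))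
  show ?thesis
  proof (cases s)
    case 0
    then show ?thesis unfolding D by (simp add: dop_simps \<rho>_br prev_closed del: br_simps(9,10))
  next
    case (Suc r)
    define u where "u = w r"
    have u: "u \<in> F r" using wF u_def by simp
    \<comment> \<open>The contribution of two factors from \<open>N\<close>, which involves the
      component two degrees below \<open>s\<close>. It is absent for \<open>r = 0\<close>, where
      \<open>w (r - 1)\<close> would wrongly mean \<open>w 0\<close>.\<close>
    define q where "q = (if r = 0 then 0 else \<rho> (br ?y ?y') (w (r - 1)))"
    have q: "q \<in> F r"
    proof (cases r)
      case 0
      then show ?thesis by (simp add: q_def F_closed)
    next
      case (Suc r')
      then show ?thesis using raising_\<rho>[of "br ?y ?y'"] wF[of r'] by (auto simp: q_def raising_def)
    qed
    have "dop z (dop z' w) s - dop z' (dop z w) s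
      = \<rho> (br ?x ?x') (w s) + \<rho> (br ?x ?y') u - \<rho> (br ?x' ?y) u + q"
      unfolding Suc q_def u_def
      by (cases r) (simp_all add: dop_simps \<rho>_br clinear_add[OF clinear_\<rho>] algebra_simps del: br_simps(9,10))
    then have "dop (dbr z z') w s - (dop z (dop z' w) s - dop z' (dop z w) s)
      = \<rho> (br ?x' ?y - pr (br ?x' ?y)) u - \<rho> (br ?x ?y' - pr (br ?x ?y')) u - q"
      unfolding D using Suc by (simp add: u_def[symmetric] \<rho>_diff algebra_simps del: br_simps(9,10))
    also have "\<dots> \<in> F r" by (intro F_closed(3) F_b[OF proj_b u] q)
    finally show ?thesis using Suc by simp
  qed
qed

lemma linear_endo_action: "linear_endo (gr F) (degenerate_action N b \<rho> F z)"
proof -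
  note l = graded_op_dop[of z]
  have "linear_endo (gr F) (lift (dop z))" by (rule linear_endo_lift[OF l])
  moreover have "degenerate_action N b \<rho> F z a = lift (dop z) a" if "a \<in> carrier (gr F)" for a
    using that by (elim carrier_grE) (simp add: action_cls lift_cls[OF l])
  moreover interpret M: Module.module complex_ring "gr F" by (rule module_gr)
  have "c \<odot>\<^bsub>gr F\<^esub> a \<in> carrier (gr F)" if "a \<in> carrier (gr F)" for c a
    using M.smult_closed[of c a] that by (simp add: complex_ring_def)
  ultimately show ?thesis unfolding linear_endo_def Pi_iff by simp
qed

lemma lie_module_gr: "lie_module (degenerate_bracket br h P e f) (gr F) (degenerate_action N b \<rho> F)"
  unfolding lie_module_def degenerate_bracket_eq
proof (intro conjI allI ballI lie_algebra_dbr module_gr linear_endo_action)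
  fix x y c a assume "a \<in> carrier (gr F)"
  then obtain w where w: "sec w" "a = cls w" by (rule carrier_grE)
  note sd = graded_op_sec[OF graded_op_dop]
  show "degenerate_action N b \<rho> F (x + y) a = degenerate_action N b \<rho> F x a \<oplus>\<^bsub>gr F\<^esub> degenerate_action N b \<rho> F y a"
    using w by (simp add: action_cls add_gr dop_add[abs_def])
  show "degenerate_action N b \<rho> F (c *\<^sub>C x) a = c \<odot>\<^bsub>gr F\<^esub> degenerate_action N b \<rho> F x a"
    using w by (simp add: action_cls smult_gr dop_scale[abs_def])
  show "degenerate_action N b \<rho> F (dbr x y) a = degenerate_action N b \<rho> F x (degenerate_action N b \<rho> F y a)
      \<ominus>\<^bsub>gr F\<^esub> degenerate_action N b \<rho> F y (degenerate_action N b \<rho> F x a)"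
    using w sd by (simp add: action_cls minus_gr) (intro cls_eqI dop_dbr)
qed

lemma expo_0: "expo (\<rho> 0) w = w"
proof
  fix s
  have "(\<rho> 0 ^^ Suc k) u = 0" for k u by (simp add: \<rho>_0)
  then have "(\<rho> 0 ^^ k) u = (if k = 0 then u else 0)" for k u by (cases k) simp_all
  then show "expo (\<rho> 0) w s = w s" by (simp add: expo_def if_distrib[of "\<lambda>x. c *\<^sub>C x" for c] scaleC_one cong: if_cong)
qed

text \<open>The commutator of \<open>\<rho> x\<close> and \<open>\<rho> y\<close> comes from a
  single Lie algebra element, so it raises degrees by at most one and is invisible on
  classes.\<close>

lemma expo_\<rho>_add: assumes "sec w" shows "cls (expo (\<rho> (x + y)) w) = cls (expo (\<rho> x) (expo (\<rho> y) w))"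
proof -
  have "\<rho> x (\<rho> y u) - \<rho> y (\<rho> x u) \<in> F (Suc s)" if "u \<in> F s" for u s
    using raising_\<rho>[of "br x y"] that unfolding raising_def by (auto simp: \<rho>_br[symmetric])
  then show ?thesis using expo_add[OF raising_\<rho> raising_\<rho> _ assms, of x y] by (simp add: \<rho>_simps[abs_def])
qed

text \<open>\<open>z\<close> and \<open>pr z\<close> differ by an element of b, which preserves each
  step of the filtration, so both induce the same map of degree one.\<close>

lemma expo_\<rho>_proj: assumes "sec w" shows "cls (expo (\<rho> (pr z)) w) = cls (expo (\<rho> z) w)"
proof -
  have "\<rho> z u - \<rho> (pr z) u \<in> F s" if "u \<in> F s" for u s
    using F_b[OF proj_b that] by (simp add: \<rho>_diff)
  then show ?thesis using expo_cong[OF raising_\<rho> raising_\<rho> _ assms, of z "pr z"] by simp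
qed

end

section \<open>The Borel subgroup acting on the filtration\<close>

locale hw_group = hw_filtration br h P e f lam \<rho> v m + lie_group_setup br G k \<theta>
  for br :: "'g::complex_vector \<Rightarrow> 'g \<Rightarrow> 'g"
    and h :: "'g set"
    and P :: "('g \<Rightarrow> complex) set"
    and e f :: "('g \<Rightarrow> complex) \<Rightarrow> 'g"
    and lam :: "'g \<Rightarrow> complex"
    and \<rho> :: "'g \<Rightarrow> 'v::complex_vector \<Rightarrow> 'v"
    and v :: 'v and m :: nat
    and G :: "('a, 'n::finite) cgroup"
    and k :: "'a set \<times> ('a \<Rightarrow> complex ^ 'n)"
    and \<theta> :: "'g \<Rightarrow> complex ^ 'n" +
  fixes B :: "'a set" and \<sigma> :: "'a \<Rightarrow> 'v \<Rightarrow> 'v"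
  assumes borel: "borel_subgroup G k \<theta> (borel_algebra br h P) B"
    and integ: "integrates G k \<theta> \<sigma> \<rho>"
begin

lemma subgroup_B: "subgroup B G" using borel by (simp add: borel_subgroup_def)

lemma B_carrier: "g \<in> B \<Longrightarrow> g \<in> carrier G" using subgroup.mem_carrier[OF subgroup_B] .

lemma group_module_\<sigma>: "group_module G whole \<sigma>" using integ by (simp add: integrates_def)

lemma \<sigma>_simps: "g \<in> carrier G \<Longrightarrow> clinear (\<sigma> g)" "\<sigma> \<one>\<^bsub>G\<^esub> w = w"
  "g \<in> carrier G \<Longrightarrow> g' \<in> carrier G \<Longrightarrow> \<sigma> (g \<otimes>\<^bsub>G\<^esub> g') w = \<sigma> g (\<sigma> g' w)"
  using group_module_\<sigma> by (auto simp: group_module_def linear_endo_whole_iff) (auto simp: whole_def)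

lemma \<sigma>_derivative: "functional whole \<psi> \<Longrightarrow>
  ((\<lambda>a. \<psi> (\<sigma> (chart_inv k a) w)) has_derivative (\<lambda>u. \<psi> (\<rho> (\<theta>i u) w))) (at k0)"
  using integ unfolding integrates_def by blast

text \<open>For c near the unit, the conjugate of c by g acts on \<sigma> g w as \<sigma> g
  (\<sigma> c w). Differentiating the coefficients of both sides in c at the unit gives the claim
  under every functional, and functionals determine a vector.\<close>

lemma \<sigma>_\<rho>: assumes g: "g \<in> carrier G" shows "\<sigma> g (\<rho> x w) = \<rho> (AD g x) (\<sigma> g w)"
proof (rule functionals_separate[OF fin_dim])
  fix \<psi> :: "'v \<Rightarrow> complex" assume \<psi>: "functional whole \<psi>"
  let ?w = "\<sigma> g w"
  have 1: "((\<lambda>a. \<psi> (\<sigma> (chart_inv k (conj_chart g a)) ?w)) has_derivative (\<lambda>u. \<psi> (\<rho> (\<theta>i (dconj g u)) ?w))) (at k0)"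
    by (rule dconj_compose[OF g \<sigma>_derivative[OF \<psi>]])
  have "\<forall>\<^sub>F a in nhds k0. \<psi> (\<sigma> (chart_inv k (conj_chart g a)) ?w) = \<psi> (\<sigma> g (\<sigma> (chart_inv k a) w))"
    using eventually_conj[OF g]
  proof (rule eventually_mono)
    fix a assume a: "chart_inv k a \<in> carrier G \<and> snd k (chart_inv k a) = a
      \<and> chart_inv k (conj_chart g a) = g \<otimes>\<^bsub>G\<^esub> chart_inv k a \<otimes>\<^bsub>G\<^esub> inv\<^bsub>G\<^esub> g"
    then have "\<sigma> (chart_inv k (conj_chart g a)) ?w = \<sigma> g (\<sigma> (chart_inv k a) w)"
      using g by (simp add: \<sigma>_simps(3)[symmetric] m_assoc)
    then show "\<psi> (\<sigma> (chart_inv k (conj_chart g a)) ?w) = \<psi> (\<sigma> g (\<sigma> (chart_inv k a) w))" by simp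
  qed
  from has_derivative_cong_eventually[OF 1 this]
  have "((\<lambda>a. \<psi> (\<sigma> g (\<sigma> (chart_inv k a) w))) has_derivative (\<lambda>u. \<psi> (\<rho> (\<theta>i (dconj g u)) ?w))) (at k0)" .
  moreover have "((\<lambda>a. \<psi> (\<sigma> g (\<sigma> (chart_inv k a) w))) has_derivative (\<lambda>u. \<psi> (\<sigma> g (\<rho> (\<theta>i u) w)))) (at k0)"
    by (rule \<sigma>_derivative[OF functional_whole_compose[OF \<psi> \<sigma>_simps(1)[OF g]]])
  ultimately have "(\<lambda>u. \<psi> (\<sigma> g (\<rho> (\<theta>i u) w))) = (\<lambda>u. \<psi> (\<rho> (\<theta>i (dconj g u)) ?w))"
    using has_derivative_unique by blast
  from fun_cong[OF this, of "\<theta> x"]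
  show "\<psi> (\<sigma> g (\<rho> x w)) = \<psi> (\<rho> (AD g x) ?w)" by (simp add: \<theta>_Ad[symmetric])
qed

lemma Ad_b: "g \<in> B \<Longrightarrow> x \<in> b \<Longrightarrow> AD g x \<in> b"
  using Ad_borel[OF borel] .

lemma Ad_NP: assumes g: "g \<in> B" and x: "x \<in> NP" shows "AD g x \<in> NP"
proof -
  have "x \<in> cv.span {br x y |x y. x \<in> b \<and> y \<in> b}" using NP_derived x by blast
  then show ?thesis
  proof (rule clinear_span_subset[OF _ clinear_Ad[OF B_carrier[OF g]] subspace_NP])
    fix z assume "z \<in> {br x y |x y. x \<in> b \<and> y \<in> b}"
    then show "AD g z \<in> NP" using Ad_br[OF B_carrier[OF g]] Ad_b[OF g] br_b_b by auto
  qed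
qed

text \<open>\<open>\<sigma> g v\<close> is again annihilated by \<open>n\<^sup>+ = [b, b]\<close>, hence a multiple of \<open>v\<close>. This argument
  replaces the closed subgroup theorem, by which \<open>B\<close> would be generated by exponentials from \<open>b\<close>.\<close>

lemma \<sigma>_v: assumes g: "g \<in> B" shows "\<sigma> g v \<in> cv.span {v}"
proof (rule NP_invariants)
  fix x assume x: "x \<in> NP"
  have gi: "inv\<^bsub>G\<^esub> g \<in> B" using subgroup.m_inv_closed[OF subgroup_B g] .
  note c = B_carrier[OF g]
  have "\<sigma> g (\<rho> (AD (inv\<^bsub>G\<^esub> g) x) v) = \<rho> (AD g (AD (inv\<^bsub>G\<^esub> g) x)) (\<sigma> g v)" by (rule \<sigma>_\<rho>[OF c])
  also have "AD g (AD (inv\<^bsub>G\<^esub> g) x) = x" using c by (simp add: Ad_mult[symmetric] Ad_one)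
  finally show "\<rho> x (\<sigma> g v) = 0" using NP_v[OF Ad_NP[OF gi x]] clinear_0[OF \<sigma>_simps(1)[OF c]] by simp
qed

lemma \<sigma>_F: assumes g: "g \<in> B" and w: "w \<in> F s" shows "\<sigma> g w \<in> F s"
proof -
  note c = B_carrier[OF g]
  have *: "\<sigma> g (foldr \<rho> xs v) \<in> F (length xs)" for xs
  proof (induction xs)
    case Nil
    have "cv.span {v} \<subseteq> F 0" unfolding pbw_filt filt_def by (rule cv.span_mono) force
    then show ?case using \<sigma>_v[OF g] by auto
  next
    case (Cons y ys)
    then show ?case using raising_\<rho>[of "AD g y"] by (auto simp: \<sigma>_\<rho>[OF c] raising_def)
  qed
  show ?thesis using w unfolding pbw_filtration_def[of _ _ _ s]
  proof (rule clinear_span_subset[OF _ \<sigma>_simps(1)[OF c]])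
    fix w assume "w \<in> {foldr \<rho> xs v |xs. set xs \<subseteq> N \<and> length xs \<le> s}"
    then obtain xs where "w = foldr \<rho> xs v" "length xs \<le> s" by blast
    then have "\<sigma> g w \<in> F s" using *[of xs] filt_mono[of "length xs" s "{v}"] unfolding pbw_filt by auto
    then show "\<sigma> g w \<in> cv.span {foldr \<rho> xs v |xs. set xs \<subseteq> N \<and> length xs \<le> s}"
      unfolding pbw_filtration_def .
  qed simp
qed

section \<open>The degenerate group and its action\<close>

abbreviation "DG \<equiv> degenerate_group G k \<theta> N b B"

lemma proj_Ad_proj: "g \<in> B \<Longrightarrow> pr (AD g (pr z)) = pr (AD g z)"
  using proj_of_b[OF Ad_b[OF _ proj_b], of g z] clinear_diff[OF clinear_Ad[OF B_carrier], of g z "pr z"] by simp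

lemma degenerate_simps: "carrier DG = N \<times> B" "\<one>\<^bsub>DG\<^esub> = (0, \<one>\<^bsub>G\<^esub>)"
  "(y, g) \<otimes>\<^bsub>DG\<^esub> (y', g') = (y + pr (AD g y'), g \<otimes>\<^bsub>G\<^esub> g')"
  by (simp_all add: degenerate_group_def)

lemma group_DG: "group DG"
proof (rule groupI)
  note [simp] = degenerate_simps B_carrier subgroup.m_closed[OF subgroup_B] subgroup.m_inv_closed[OF subgroup_B]
    subgroup.one_closed[OF subgroup_B] cv.subspace_add[OF subspace_N] cv.subspace_0[OF subspace_N]
    cv.subspace_neg[OF subspace_N] proj_Ad_proj Ad_mult Ad_one
    clinear_add[OF clinear_Ad] clinear_0[OF clinear_Ad] clinear_neg[OF clinear_Ad]
  show "x \<otimes>\<^bsub>DG\<^esub> y \<in> carrier DG" if "x \<in> carrier DG" "y \<in> carrier DG" for x y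
    using that by (cases x; cases y) auto
  show "\<one>\<^bsub>DG\<^esub> \<in> carrier DG" by simp
  show "x \<otimes>\<^bsub>DG\<^esub> y \<otimes>\<^bsub>DG\<^esub> z = x \<otimes>\<^bsub>DG\<^esub> (y \<otimes>\<^bsub>DG\<^esub> z)"
    if "x \<in> carrier DG" "y \<in> carrier DG" "z \<in> carrier DG" for x y z
    using that by (cases x; cases y; cases z) (auto simp: m_assoc add.assoc)
  show "\<one>\<^bsub>DG\<^esub> \<otimes>\<^bsub>DG\<^esub> x = x" if "x \<in> carrier DG" for x using that by (cases x) auto
  show "\<exists>y\<in>carrier DG. y \<otimes>\<^bsub>DG\<^esub> x = \<one>\<^bsub>DG\<^esub>" if x: "x \<in> carrier DG" for x
  proof (cases x)
    case (Pair y g)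
    \<comment> \<open>The first component of the witness is chosen to cancel what the inverse of
      \<open>g\<close> makes of \<open>y\<close> modulo b.\<close>
    then show ?thesis using x
      by (intro bexI[of _ "(- pr (AD (inv\<^bsub>G\<^esub> g) y), inv\<^bsub>G\<^esub> g)"]) auto
  qed
qed

text \<open>The pair \<open>(y, g)\<close> is the product of y paired with the unit and of 0 paired
  with g, so \<open>g\<close> acts first and the exponential of \<open>y\<close> second.\<close>

definition dsec :: "'g \<times> 'a \<Rightarrow> (nat \<Rightarrow> 'v) \<Rightarrow> (nat \<Rightarrow> 'v)" where
  "dsec q w = expo (\<rho> (fst q)) (\<lambda>s. \<sigma> (snd q) (w s))"

definition \<tau> :: "'g \<times> 'a \<Rightarrow> (nat \<Rightarrow> 'v set) \<Rightarrow> (nat \<Rightarrow> 'v set)" where "\<tau> q = lift (dsec q)"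

lemma sec_\<sigma>: "g \<in> B \<Longrightarrow> sec w \<Longrightarrow> sec (\<lambda>s. \<sigma> g (w s))"
  by (simp add: sec_def \<sigma>_F)

lemma graded_op_\<sigma>: assumes "g \<in> B" shows "graded_op (\<lambda>w s. \<sigma> g (w s))"
proof -
  have "graded_op (shift 0 (\<sigma> g))"
    by (rule graded_op_shift[OF \<sigma>_simps(1)[OF B_carrier[OF assms]]]) (use \<sigma>_F[OF assms] in auto)
  moreover have "shift 0 (\<sigma> g) = (\<lambda>w s. \<sigma> g (w s))" by (simp add: fun_eq_iff shift_def)
  ultimately show ?thesis by simp
qed

lemma graded_op_dsec: assumes "q \<in> carrier DG" shows "graded_op (dsec q)"
  using graded_op_comp[OF graded_op_expo[OF raising_\<rho>] graded_op_\<sigma>, of "snd q" "fst q"] assms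
  by (auto simp: degenerate_simps dsec_def[abs_def])

lemma graded_op_cls_cong: "graded_op \<Phi> \<Longrightarrow> sec w \<Longrightarrow> sec w' \<Longrightarrow> cls w = cls w' \<Longrightarrow> cls (\<Phi> w) = cls (\<Phi> w')"
  using lift_cls[of \<Phi> w] lift_cls[of \<Phi> w'] by simp

text \<open>Moving \<open>\<sigma> g\<close> past the exponential of \<open>\<rho> y'\<close> yields
  that of \<open>\<rho> (AD g y')\<close>, while the group law contains the projection of
  \<open>AD g y'\<close>. The two exponentials agree on classes, and exponentials of sums multiply
  there, so the identity is one of classes and not of representatives.\<close>

lemma dsec_mult:
  assumes q: "q \<in> carrier DG" "q' \<in> carrier DG" and w: "sec w"
  shows "cls (dsec (q \<otimes>\<^bsub>DG\<^esub> q') w) = cls (dsec q (dsec q' w))"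
proof -
  obtain y g y' g' where *: "q = (y, g)" "q' = (y', g')" "y \<in> N" "g \<in> B" "y' \<in> N" "g' \<in> B"
    using q by (auto simp: degenerate_simps)
  note c = B_carrier[OF *(4)] B_carrier[OF *(6)]
  let ?u = "\<lambda>s. \<sigma> (g \<otimes>\<^bsub>G\<^esub> g') (w s)"
  have u: "sec ?u" using * w sec_\<sigma> subgroup.m_closed[OF subgroup_B] by blast
  have s: "sec (expo (\<rho> z) ?u)" for z using graded_op_sec[OF graded_op_expo[OF raising_\<rho>] u] .
  have "cls (dsec (q \<otimes>\<^bsub>DG\<^esub> q') w) = cls (expo (\<rho> (y + pr (AD g y'))) ?u)"
    by (simp add: * degenerate_simps dsec_def)
  also have "\<dots> = cls (expo (\<rho> y) (expo (\<rho> (pr (AD g y'))) ?u))" by (rule expo_\<rho>_add[OF u])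
  also have "\<dots> = cls (expo (\<rho> y) (expo (\<rho> (AD g y')) ?u))"
    by (rule graded_op_cls_cong[OF graded_op_expo[OF raising_\<rho>] s s expo_\<rho>_proj[OF u]])
  also have "expo (\<rho> (AD g y')) ?u = (\<lambda>s. \<sigma> g (expo (\<rho> y') (\<lambda>s. \<sigma> g' (w s)) s))"
  proof
    fix s
    have "\<sigma> g (expo (\<rho> y') u s) = expo (\<rho> (AD g y')) (\<lambda>r. \<sigma> g (u r)) s" for u
      by (rule expo_conj[OF \<sigma>_simps(1)[OF c(1)]]) (rule \<sigma>_\<rho>[OF c(1)])
    then show "expo (\<rho> (AD g y')) ?u s = \<sigma> g (expo (\<rho> y') (\<lambda>s. \<sigma> g' (w s)) s)"
      by (simp only: \<sigma>_simps(3)[OF c])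
  qed
  finally show ?thesis by (simp add: * dsec_def)
qed

lemma \<tau>_cls: "q \<in> carrier DG \<Longrightarrow> sec w \<Longrightarrow> \<tau> q (cls w) = cls (dsec q w)"
  unfolding \<tau>_def by (rule lift_cls[OF graded_op_dsec])

lemma group_module_\<tau>: "group_module DG (gr F) \<tau>"
  unfolding group_module_def
proof (intro conjI ballI group_DG module_gr)
  interpret DG: group DG by (rule group_DG)
  show "linear_endo (gr F) (\<tau> q)" if "q \<in> carrier DG" for q
    unfolding \<tau>_def by (rule linear_endo_lift[OF graded_op_dsec[OF that]])
  fix a assume "a \<in> carrier (gr F)"
  then obtain w where w: "sec w" "a = cls w" by (rule carrier_grE)
  have "dsec \<one>\<^bsub>DG\<^esub> w = w" by (simp add: dsec_def degenerate_simps expo_0 \<sigma>_simps(2))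
  then show "\<tau> \<one>\<^bsub>DG\<^esub> a = a" using \<tau>_cls[OF DG.one_closed w(1)] w(2) by simp
  show "\<tau> (q \<otimes>\<^bsub>DG\<^esub> q') a = \<tau> q (\<tau> q' a)" if "q \<in> carrier DG" "q' \<in> carrier DG" for q q'
    using that w by (simp add: \<tau>_cls dsec_mult graded_op_sec[OF graded_op_dsec])
qed

text \<open>Reduces coefficients on the graded space to finite sums of coefficients of operators on
  the original module, whose limits and derivatives can be computed.\<close>

lemma coefficient_\<tau>:
  assumes \<psi>: "functional (gr F) \<psi>" and w: "sec w"
  obtains \<Psi> where "\<And>s. functional whole (\<Psi> s)"
    "\<And>q. q \<in> carrier DG \<Longrightarrow> \<psi> (\<tau> q (cls w))
      = (\<Sum>s\<le>m. \<Sum>k\<le>s. (1 / fact k) * \<Psi> s ((\<rho> (fst q) ^^ k) (\<sigma> (snd q) (w (s - k)))))"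
    "\<And>w. sec w \<Longrightarrow> \<psi> (cls w) = (\<Sum>s\<le>m. \<Psi> s (w s))"
proof -
  obtain \<Psi> where \<Psi>: "\<And>s. functional whole (\<Psi> s)" "\<And>w. sec w \<Longrightarrow> \<psi> (cls w) = (\<Sum>s\<le>m. \<Psi> s (w s))"
    "\<And>s u. u \<in> F s \<Longrightarrow> \<Psi> s u = \<psi> (cls (\<lambda>r. if r = s then u else 0))"
    using functional_gr_decompose[OF \<psi>] by blast
  have "\<psi> (\<tau> q (cls w)) = (\<Sum>s\<le>m. \<Sum>k\<le>s. (1 / fact k) * \<Psi> s ((\<rho> (fst q) ^^ k) (\<sigma> (snd q) (w (s - k)))))"
    if q: "q \<in> carrier DG" for q
  proof -
    have "\<psi> (\<tau> q (cls w)) = (\<Sum>s\<le>m. \<Psi> s (dsec q w s))"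
      unfolding \<tau>_cls[OF q w] by (rule \<Psi>(2)[OF graded_op_sec[OF graded_op_dsec[OF q] w]])
    also have "\<dots> = (\<Sum>s\<le>m. \<Sum>k\<le>s. (1 / fact k) * \<Psi> s ((\<rho> (fst q) ^^ k) (\<sigma> (snd q) (w (s - k)))))"
      using \<Psi>(1)[unfolded functional_whole_iff] by (simp add: dsec_def expo_def functional_whole_sum[OF \<Psi>(1)])
    finally show ?thesis .
  qed
  then show thesis by (rule that[OF \<Psi>(1) _ \<Psi>(2)])
qed

section \<open>Continuity of the action and its one-parameter subgroups\<close>

lemma scaleR_vec_eq: "r *\<^sub>R a = of_real r *\<^sub>C (a :: complex ^ 'n)"
  by (simp add: vec_eq_iff scaleC_vec_def scaleC_complex_def scaleR_conv_of_real[where 'a = complex])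

lemma bounded_linear_coefficient:
  assumes \<psi>: "functional whole \<psi>" shows "bounded_linear (\<lambda>a. \<psi> (\<rho> (\<theta>i a) u))"
proof (rule linear_conv_bounded_linear[THEN iffD1], rule linearI)
  have add: "\<theta>i (a + a') = \<theta>i a + \<theta>i a'" for a a'
    using \<theta>_inv(2)[of "\<theta>i a + \<theta>i a'"] clinear_add[OF clinear_\<theta>] by simp
  have scale: "\<theta>i (c *\<^sub>C a) = c *\<^sub>C \<theta>i a" for c a
    using \<theta>_inv(2)[of "c *\<^sub>C \<theta>i a"] clinear_scale[OF clinear_\<theta>] by simp
  show "\<psi> (\<rho> (\<theta>i (a + a')) u) = \<psi> (\<rho> (\<theta>i a) u) + \<psi> (\<rho> (\<theta>i a') u)" for a a'
    using \<psi> unfolding functional_whole_iff by (simp add: add \<rho>_simps)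
  show "\<psi> (\<rho> (\<theta>i (r *\<^sub>R a)) u) = r *\<^sub>R \<psi> (\<rho> (\<theta>i a) u)" for r a
    using \<psi> unfolding functional_whole_iff scaleR_vec_eq
    by (simp add: scale \<rho>_simps scaleR_conv_of_real)
qed

text \<open>In each chart the coefficient is complex differentiable, hence continuous; the charts
  form an open cover, over which continuity is glued.\<close>

lemma continuous_\<sigma>: assumes \<psi>: "functional whole \<psi>"
  shows "continuous_map X euclidean (\<lambda>g. \<psi> (\<sigma> g w))"
proof (rule pasting_lemma[where I = "atlas G" and T = fst and f = "\<lambda>_ g. \<psi> (\<sigma> g w)"])
  fix l assume l: "l \<in> atlas G"
  note c = chart[OF l]
  show "openin X (fst l)" by (rule c(1))
  have "complex_differentiable_at (\<lambda>a. \<psi> (\<sigma> (chart_inv l a) w)) (snd l x)" if "x \<in> fst l" for x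
    using integ \<psi> l that unfolding integrates_def by blast
  then have "isCont (\<lambda>a. \<psi> (\<sigma> (chart_inv l a) w)) (snd l x)" if "x \<in> fst l" for x
    using that has_derivative_continuous unfolding complex_differentiable_at_def by blast
  then have "continuous_on (snd l ` fst l) (\<lambda>a. \<psi> (\<sigma> (chart_inv l a) w))"
    by (intro continuous_at_imp_continuous_on) auto
  then have "continuous_map (subtopology X (fst l)) euclidean ((\<lambda>a. \<psi> (\<sigma> (chart_inv l a) w)) \<circ> snd l)"
    by (intro continuous_map_compose[OF homeomorphic_imp_continuous_map[OF c(4)]]) simp
  then show "continuous_map (subtopology X (fst l)) euclidean (\<lambda>g. \<psi> (\<sigma> g w))"
    by (rule continuous_map_eq) (simp add: c(6))
next
  fix x assume "x \<in> topspace X"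
  then obtain l where "l \<in> atlas G" "x \<in> fst l" using obtain_chart topspace_G by auto
  then show "\<exists>j. j \<in> atlas G \<and> x \<in> fst j \<and> \<psi> (\<sigma> x w) = \<psi> (\<sigma> x w)" by blast
qed simp

abbreviation "DT \<equiv> degenerate_topology G \<theta> N B"

lemma topspace_DT: "topspace DT = carrier DG"
  by (auto simp: degenerate_topology_def degenerate_simps topspace_pullback_topology topspace_G B_carrier)

lemma continuous_coefficients_\<tau>: "continuous_coefficients DT (gr F) \<tau>"
  unfolding continuous_coefficients_def
proof (intro allI ballI impI)
  fix \<psi> a assume \<psi>: "functional (gr F) \<psi>" and "a \<in> carrier (gr F)"
  then obtain w where w: "sec w" "a = cls w" by (elim carrier_grE)
  obtain \<Psi> where \<Psi>: "\<And>s. functional whole (\<Psi> s)"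
    "\<And>q. q \<in> carrier DG \<Longrightarrow> \<psi> (\<tau> q (cls w))
      = (\<Sum>s\<le>m. \<Sum>k\<le>s. (1 / fact k) * \<Psi> s ((\<rho> (fst q) ^^ k) (\<sigma> (snd q) (w (s - k)))))"
    "\<And>w. sec w \<Longrightarrow> \<psi> (cls w) = (\<Sum>s\<le>m. \<Psi> s (w s))"
    using coefficient_\<tau>[OF \<psi> w(1)] by blast
  have cont_y: "continuous_map DT euclidean (\<lambda>q. \<psi>' (\<rho> (fst q) u))" if "functional whole \<psi>'" for \<psi>' u
  proof -
    have "continuous_map euclidean euclidean (\<lambda>a. \<psi>' (\<rho> (\<theta>i a) u))"
      using bounded_linear.continuous_on[OF bounded_linear_coefficient[OF that] continuous_on_id] by simp
    then have "continuous_map (pullback_topology N \<theta> euclidean) euclidean ((\<lambda>a. \<psi>' (\<rho> (\<theta>i a) u)) \<circ> \<theta>)"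
      by (rule continuous_map_pullback)
    from continuous_map_compose[OF continuous_map_fst this] show ?thesis
      unfolding degenerate_topology_def by (simp add: o_def)
  qed
  have cont_g: "continuous_map DT euclidean (\<lambda>q. \<psi>' (\<sigma> (snd q) u))" if "functional whole \<psi>'" for \<psi>' u
    using continuous_map_compose[OF continuous_map_snd continuous_map_from_subtopology[OF continuous_\<sigma>[OF that, of u]]]
    unfolding degenerate_topology_def by (simp add: o_def)
  \<comment> \<open>Induction on the power, splitting off one factor \<open>\<rho> (fst q)\<close>.
    The functional has to be arbitrary, since expanding the composition calls on all coordinate
    functionals.\<close>
  have tends: "((\<lambda>q. \<psi>' ((\<rho> (fst q) ^^ k) (\<sigma> (snd q) u))) \<longlongrightarrow> \<psi>' ((\<rho> (fst q0) ^^ k) (\<sigma> (snd q0) u))) (atin DT q0)"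
    if q0: "q0 \<in> topspace DT" and "functional whole \<psi>'" for \<psi>' k q0 u
    using that(2)
  proof (induction k arbitrary: \<psi>' u)
    case 0
    then show ?case using cont_g[OF 0, of u] q0 by (auto simp: continuous_map_atin)
  next
    case (Suc k)
    have y: "((\<lambda>q. \<psi>' (\<rho> (fst q) u)) \<longlongrightarrow> \<psi>' (\<rho> (fst q0) u)) (atin DT q0)" if "functional whole \<psi>'" for \<psi>' u
      using cont_y[OF that, of u] q0 by (auto simp: continuous_map_atin)
    show ?case unfolding funpow.simps o_apply
      by (rule tendsto_coefficient_compose[where S = "\<lambda>q. \<rho> (fst q)" and ?S0.0 = "\<rho> (fst q0)"
            and T = "\<lambda>q u. (\<rho> (fst q) ^^ k) (\<sigma> (snd q) u)"
            and ?T0.0 = "\<lambda>u. (\<rho> (fst q0) ^^ k) (\<sigma> (snd q0) u)", OF fin_dim Suc.prems clinear_\<rho> clinear_\<rho> y Suc.IH])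
  qed
  show "continuous_map DT euclidean (\<lambda>q. \<psi> (\<tau> q a))"
  proof (rule continuous_map_eq)
    show "continuous_map DT euclidean
      (\<lambda>q. \<Sum>s\<le>m. \<Sum>k\<le>s. (1 / fact k) * \<Psi> s ((\<rho> (fst q) ^^ k) (\<sigma> (snd q) (w (s - k)))))"
      unfolding continuous_map_atin limitin_canonical_iff
      by (intro ballI tendsto_sum tendsto_mult tendsto_const tends \<Psi>(1))
  qed (simp add: \<Psi>(2) w(2) topspace_DT)
qed

lemma derivative_\<sigma>:
  assumes \<gamma>: "one_parameter_subgroup G k \<theta> \<gamma> x" and \<psi>: "functional whole \<psi>"
  shows "((\<lambda>t. \<psi> (\<sigma> (\<gamma> t) u)) has_vector_derivative \<psi> (\<rho> x u)) (at 0)"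
proof -
  have "((\<lambda>t. snd k (\<gamma> t)) has_vector_derivative \<theta> x) (at 0)" "snd k (\<gamma> 0) = k0"
    using \<gamma> one_parameter_subgroup_0[OF \<gamma>] by (simp_all add: one_parameter_subgroup_def)
  then have "((\<lambda>t. \<psi> (\<sigma> (chart_inv k (snd k (\<gamma> t))) u)) has_vector_derivative \<psi> (\<rho> (\<theta>i (\<theta> x)) u)) (at 0)"
    by (intro has_vector_derivative_compose[where f = "\<lambda>a. \<psi> (\<sigma> (chart_inv k a) u)"
          and D = "\<lambda>a. \<psi> (\<rho> (\<theta>i a) u)"]) (simp_all add: \<sigma>_derivative[OF \<psi>])
  moreover have "\<forall>\<^sub>F t in nhds 0. \<psi> (\<sigma> (chart_inv k (snd k (\<gamma> t))) u) = \<psi> (\<sigma> (\<gamma> t) u)"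
    using eventually_one_parameter_subgroup[OF \<gamma>] by (rule eventually_mono) (simp add: chart(6)[OF k_atlas])
  ultimately show ?thesis using has_vector_derivative_cong_eventually by fastforce
qed

lemma one_parameter_\<tau>:
  assumes \<Gamma>: "degenerate_one_parameter_subgroup G k \<theta> N b B \<Gamma> z"
  shows "is_exp (gr F) (degenerate_action N b \<rho> F (of_real t *\<^sub>C z)) (\<tau> (\<Gamma> t))"
proof -
  interpret DG: group DG by (rule group_DG)
  have ran: "\<Gamma> t \<in> carrier DG" for t
    using \<Gamma> unfolding degenerate_one_parameter_subgroup_def by blast
  have hom: "\<Gamma> (s + t) = \<Gamma> s \<otimes>\<^bsub>DG\<^esub> \<Gamma> t" for s t
    using \<Gamma> unfolding degenerate_one_parameter_subgroup_def by blast
  have d1: "((\<lambda>t. \<theta> (fst (\<Gamma> t))) has_vector_derivative \<theta> (pr z)) (at 0)"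
    and d2: "one_parameter_subgroup G k \<theta> (\<lambda>t. snd (\<Gamma> t)) (z - pr z)"
    using \<Gamma> unfolding degenerate_one_parameter_subgroup_def by blast+
  have \<Gamma>0: "\<Gamma> 0 = \<one>\<^bsub>DG\<^esub>" using hom[of 0 0] ran[of 0] DG.l_cancel_one[of "\<Gamma> 0" "\<Gamma> 0"] by simp
  then have \<Gamma>0': "fst (\<Gamma> 0) = 0" "snd (\<Gamma> 0) = \<one>\<^bsub>G\<^esub>" by (simp_all add: degenerate_simps)
  note gm = group_module_\<tau>[unfolded group_module_def]
  obtain I :: "(nat \<times> 'v) set" and c c' where fr: "frame (gr F) I c c'" using frame_gr by blast
  \<comment> \<open>\<open>D k\<close> is the derivative at 0 of the power of exponent
    \<open>k\<close> of \<open>\<rho> (fst (\<Gamma> t))\<close>. That operator is zero at 0, so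
    only \<open>k = 1\<close> survives; \<open>E k\<close> adds the derivative of the group part,
    which is visible only for \<open>k = 0\<close>.\<close>
  define D where "D k u = (if k = 1 then \<rho> (pr z) u else 0)" for k :: nat and u
  define E where "E k u = (if k = 0 then \<rho> (z - pr z) u else 0) + D k u" for k :: nat and u
  have clin_D: "clinear (D k)" for k
    by (rule clinearI) (simp_all add: D_def clinear_add[OF clinear_\<rho>] clinear_scale[OF clinear_\<rho>])
  have dy: "((\<lambda>t. \<psi> (\<rho> (fst (\<Gamma> t)) u)) has_vector_derivative \<psi> (\<rho> (pr z) u)) (at 0)"
    if \<psi>: "functional whole \<psi>" for \<psi> u
    using bounded_linear.has_vector_derivative[OF bounded_linear_coefficient[OF \<psi>] d1] by simp
  have pow0: "(\<rho> 0 ^^ k) u = (if k = 0 then u else 0)" for k u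
    by (cases k) (simp_all add: \<rho>_0)
  have dpow: "((\<lambda>t. \<psi> ((\<rho> (fst (\<Gamma> t)) ^^ k) u)) has_vector_derivative \<psi> (D k u)) (at 0)"
    if "functional whole \<psi>" for \<psi> k u
    using that
  proof (induction k arbitrary: \<psi> u)
    case 0
    have "\<psi> 0 = 0" using functional_whole_sum[OF 0, of "\<lambda>_. 0" "{}"] by simp
    then show ?case by (simp add: D_def)
  next
    case (Suc k)
    have "((\<lambda>t. \<psi> (\<rho> (fst (\<Gamma> t)) ((\<rho> (fst (\<Gamma> t)) ^^ k) u))) has_vector_derivative
      \<psi> (\<rho> (fst (\<Gamma> 0)) (D k u) + \<rho> (pr z) ((\<rho> (fst (\<Gamma> 0)) ^^ k) u))) (at 0)"
      by (rule derivative_coefficient_compose[where S = "\<lambda>t. \<rho> (fst (\<Gamma> t))" and S' = "\<rho> (pr z)"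
            and T = "\<lambda>t. \<rho> (fst (\<Gamma> t)) ^^ k" and T' = "D k", OF fin_dim Suc.prems clinear_\<rho> clinear_\<rho> dy Suc.IH])
    moreover have "\<rho> (fst (\<Gamma> 0)) (D k u) + \<rho> (pr z) ((\<rho> (fst (\<Gamma> 0)) ^^ k) u) = D (Suc k) u"
      by (simp add: \<Gamma>0' \<rho>_0 pow0 D_def clinear_0[OF clinear_\<rho>])
    ultimately show ?case by simp
  qed
  have dE: "((\<lambda>t. \<psi> ((\<rho> (fst (\<Gamma> t)) ^^ k) (\<sigma> (snd (\<Gamma> t)) u))) has_vector_derivative \<psi> (E k u)) (at 0)"
    if \<psi>: "functional whole \<psi>" for \<psi> k u
  proof -
    have "((\<lambda>t. \<psi> ((\<rho> (fst (\<Gamma> t)) ^^ k) (\<sigma> (snd (\<Gamma> t)) u))) has_vector_derivative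
      \<psi> ((\<rho> (fst (\<Gamma> 0)) ^^ k) (\<rho> (z - pr z) u) + D k (\<sigma> (snd (\<Gamma> 0)) u))) (at 0)"
      by (rule derivative_coefficient_compose[where S = "\<lambda>t. \<rho> (fst (\<Gamma> t)) ^^ k" and S' = "D k"
            and T = "\<lambda>t. \<sigma> (snd (\<Gamma> t))" and T' = "\<rho> (z - pr z)", OF fin_dim \<psi> clinear_pow[OF clinear_\<rho>] clin_D dpow derivative_\<sigma>[OF d2]])
    moreover have "(\<rho> (fst (\<Gamma> 0)) ^^ k) (\<rho> (z - pr z) u) + D k (\<sigma> (snd (\<Gamma> 0)) u) = E k u"
      by (simp add: \<Gamma>0' pow0 \<sigma>_simps(2) E_def)
    ultimately show ?thesis by simp
  qed
  \<comment> \<open>So the derivative of the truncated exponential consists of the part of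
    \<open>z\<close> in b, which keeps the degree, and the part in \<open>N\<close>, which raises
    it.\<close>
  have E_sum: "(\<Sum>k\<le>s. (1 / fact k) *\<^sub>C E k (w (s - k))) = dop z w s" for w s
  proof (cases s)
    case 0
    then show ?thesis by (simp add: E_def D_def dop_simps scaleC_one)
  next
    case (Suc r)
    have "(\<Sum>k\<le>s. (1 / fact k) *\<^sub>C E k (w (s - k))) = (\<Sum>k\<in>{0, 1}. (1 / fact k) *\<^sub>C E k (w (s - k)))"
      by (rule sum.mono_neutral_right) (use Suc in \<open>auto simp: E_def D_def\<close>)
    then show ?thesis using Suc by (simp add: E_def D_def dop_simps scaleC_one)
  qed
  show ?thesis
  proof (rule one_parameter_group_is_exp[OF module_gr fr, where A = "degenerate_action N b \<rho> F z"])
    show "linear_endo (gr F) (\<tau> (\<Gamma> t))" for t using gm ran by blast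
    show "\<tau> (\<Gamma> (s + t)) a = \<tau> (\<Gamma> s) (\<tau> (\<Gamma> t) a)" if "a \<in> carrier (gr F)" for s t a
      using gm ran that unfolding hom by blast
    show "\<tau> (\<Gamma> 0) a = a" if "a \<in> carrier (gr F)" for a using gm that unfolding \<Gamma>0 by blast
    show "linear_endo (gr F) (degenerate_action N b \<rho> F z)" by (rule linear_endo_action)
    show "degenerate_action N b \<rho> F (of_real t *\<^sub>C z) a = of_real t \<odot>\<^bsub>gr F\<^esub> degenerate_action N b \<rho> F z a"
      if "a \<in> carrier (gr F)" for a
      using lie_module_gr that unfolding lie_module_def by blast
    fix \<psi> a assume \<psi>: "functional (gr F) \<psi>" and "a \<in> carrier (gr F)"
    then obtain w where w: "sec w" "a = cls w" by (elim carrier_grE)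
    obtain \<Psi> where \<Psi>: "\<And>s. functional whole (\<Psi> s)"
      "\<And>q. q \<in> carrier DG \<Longrightarrow> \<psi> (\<tau> q (cls w))
        = (\<Sum>s\<le>m. \<Sum>k\<le>s. (1 / fact k) * \<Psi> s ((\<rho> (fst q) ^^ k) (\<sigma> (snd q) (w (s - k)))))"
      "\<And>w. sec w \<Longrightarrow> \<psi> (cls w) = (\<Sum>s\<le>m. \<Psi> s (w s))"
      using coefficient_\<tau>[OF \<psi> w(1)] by blast
    have "\<psi> (degenerate_action N b \<rho> F z a) = (\<Sum>s\<le>m. \<Psi> s (dop z w s))"
      using w graded_op_sec[OF graded_op_dop] by (simp add: action_cls \<Psi>(3))
    also have "\<dots> = (\<Sum>s\<le>m. \<Sum>k\<le>s. (1 / fact k) * \<Psi> s (E k (w (s - k))))"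
      unfolding E_sum[symmetric] functional_whole_sum[OF \<Psi>(1)]
      using \<Psi>(1)[unfolded functional_whole_iff] by simp
    finally have eq: "\<psi> (degenerate_action N b \<rho> F z a) = \<dots>" .
    show "((\<lambda>t. \<psi> (\<tau> (\<Gamma> t) a)) has_vector_derivative \<psi> (degenerate_action N b \<rho> F z a)) (at 0)"
      unfolding eq unfolding w(2) \<Psi>(2)[OF ran]
      by (intro has_vector_derivative_sum has_vector_derivative_mult_right dE \<Psi>(1))
  qed
qed

end

theorem proposition2p5:
  fixes br :: "'g::complex_vector \<Rightarrow> 'g \<Rightarrow> 'g"
    and h :: "'g set"
    and P :: "('g \<Rightarrow> complex) set"
    and e f :: "('g \<Rightarrow> complex) \<Rightarrow> 'g"
    and G :: "('a, 'n::finite) cgroup"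
    and k :: "'a set \<times> ('a \<Rightarrow> complex ^ 'n)"
    and \<theta> :: "'g \<Rightarrow> complex ^ 'n"
    and B :: "'a set"
    and lam :: "'g \<Rightarrow> complex"
    and \<rho> :: "'g \<Rightarrow> 'v::complex_vector \<Rightarrow> 'v"
    and v :: 'v
    and \<sigma> :: "'a \<Rightarrow> 'v \<Rightarrow> 'v"
  defines "N \<equiv> n_minus br h P"
    and "b \<equiv> borel_algebra br h P"
    and "F \<equiv> pbw_filtration (n_minus br h P) \<rho> v"
  assumes "simple_lie_algebra br"
    and "cartan_decomposition br h P"
    and "chevalley_vectors br h P e f"
    and "simple_lie_group G br k \<theta>"
    and "borel_subgroup G k \<theta> b B"
    and "dominant_integral br h P e f lam"
    and "lie_module br whole \<rho>"
    and "irreducible_module \<rho>"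
    and "highest_weight_vector br h P \<rho> lam v"
    and "integrates G k \<theta> \<sigma> \<rho>"
  shows "(\<forall>y\<in>N. \<forall>s. \<rho> y ` F s \<subseteq> F (Suc s))
    \<and> (\<forall>x\<in>b. \<forall>s. \<rho> x ` F s \<subseteq> F s)
    \<and> lie_module (degenerate_bracket br h P e f) (gr F) (degenerate_action N b \<rho> F)
    \<and> (\<exists>\<tau>. group_module (degenerate_group G k \<theta> N b B) (gr F) \<tau>
         \<and> continuous_coefficients (degenerate_topology G \<theta> N B) (gr F) \<tau>
         \<and> (\<forall>\<Gamma> z. degenerate_one_parameter_subgroup G k \<theta> N b B \<Gamma> z \<longrightarrow>
              (\<forall>t. is_exp (gr F) (degenerate_action N b \<rho> F (of_real t *\<^sub>C z)) (\<tau> (\<Gamma> t)))))"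
proof -
  interpret hw_module br h P e f lam \<rho> v
    by unfold_locales (use assms in auto)
  \<comment> \<open>Finite dimension, which bounds the filtration, is part of
    \<open>integrates\<close>.\<close>
  have "fin_dim TYPE('v)" using assms unfolding integrates_def by blast
  then obtain m where "filtration (pbw_filtration (n_minus br h P) \<rho> v) m" using filtration_F by blast
  then interpret filtration "pbw_filtration (n_minus br h P) \<rho> v" m .
  interpret hw_group br h P e f lam \<rho> v m G k \<theta> B \<sigma>
    by unfold_locales (use assms in auto)
  show ?thesis unfolding N_def b_def F_def
  proof (intro conjI ballI allI impI image_subsetI exI[of _ \<tau>])
    show "lie_module (degenerate_bracket br h P e f) (gr (pbw_filtration (n_minus br h P) \<rho> v))
      (degenerate_action (n_minus br h P) (borel_algebra br h P) \<rho> (pbw_filtration (n_minus br h P) \<rho> v))"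
      by (rule lie_module_gr)
  qed (use F_N F_b group_module_\<tau> continuous_coefficients_\<tau> one_parameter_\<tau> in blast)+
qed

end
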